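(* Let $G$ be a finite simple graph on a vertex set $V$, and let $S \subseteq V$. Suppose that $G \setminus S$, the induced subgraph of $G$ on the vertices $V \setminus S$, is either a chordal graph or the five-cycle $C_5$. Then $\mathrm{Ind}(G \cup W(S))$ is vertex decomposable. In particular, $G \cup W(S)$ is sequentially Cohen-Macaulay.
   Context: For a finite simple graph $G=(V,E)$, a subset $U \subseteq V$ is independent if no edge $e\in E$ is contained in $U$; the independence complex $\mathrm{Ind}(G)$ is the simplicial complex of all independent sets of $G$ (including $\emptyset$). A graph is chordal if it has no induced cycles of length $\geq 4$. $G \cup W(S)$ is the graph obtained from $G$ by adding a whisker to every vertex of $S$: for each $x \in S$ add a new vertex $y_x$ (distinct for distinct $x$) and the single edge $\{x,y_x\}$. Simplicial complexes: facets are the maximal faces under inclusion; a simplex is a complex having exactly one facet (the complex $\{\emptyset\}$ counts as a simplex). For a vertex $v$ with $\{v\}\in\Delta$, $\Delta \setminus v = \{\tau \in \Delta : v \notin \tau\}$ and $\mathrm{link}_\Delta(v) = \{\tau \in \Delta : v \notin \tau,\ \tau \cup \{v\} \in \Delta\}$. Vertex decomposable (non-pure sense), defined recursively: $\Delta$ is vertex decomposable if either $\Delta$ is a simplex, or there is a vertex $v$ (with $\{v\}\in\Delta$) such that $\Delta \setminus v$ and $\mathrm{link}_\Delta(v)$ are both vertex decomposable and have no facet in common. Sequentially Cohen-Macaulay graphs: let $k$ be a field. For a finite simple graph $H$ with vertices $x_1,\dots,x_m$ identified with the variables of $R = k[x_1,\dots,x_m]$, the edge ideal is $I(H) = (x_ix_j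 : \{x_i,x_j\} \text{ an edge of } H) \subseteq R$. The graph $H$ is sequentially Cohen-Macaulay if $R/I(H)$ is, i.e. there is a finite filtration of graded $R$-modules $0 = M_0 \subset M_1 \subset \cdots \subset M_t = R/I(H)$ such that $M_i/M_{i-1}$ is Cohen-Macaulay for each $i\in\{1,\dots,t\}$ and $\dim M_i/M_{i-1} < \dim M_{i+1}/M_i$ for all $i\in\{1,\dots,t-1\}$. *)

theory Defs
  imports "HOL-Algebra.QuotRing" "HOL-Algebra.Module"
    "HOL-Library.Poly_Mapping" "HOL-Library.Extended_Nat"
begin

section \<open>Graphs\<close>

record 'a ugraph =
  vertices :: "'a set"
  edges :: "'a set set"

definition finite_simple_graph :: "'a ugraph \<Rightarrow> bool" where
  "finite_simple_graph G \<longleftrightarrow>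
     finite (vertices G) \<and> (\<forall>e\<in>edges G. e \<subseteq> vertices G \<and> card e = 2)"

definition induced_subgraph :: "'a ugraph \<Rightarrow> 'a set \<Rightarrow> 'a ugraph" where
  "induced_subgraph G U = \<lparr>vertices = U, edges = {e \<in> edges G. e \<subseteq> U}\<rparr>"

definition graph_iso :: "'a ugraph \<Rightarrow> 'b ugraph \<Rightarrow> bool" where
  "graph_iso G H \<longleftrightarrow>
     (\<exists>f. bij_betw f (vertices G) (vertices H) \<and> edges H = (\<lambda>e. f ` e) ` edges G)"

text \<open>This is the cycle \<open>C\<^sub>n\<close> for \<open>n \<ge> 3\<close> only.\<close>

definition cycle_graph :: "nat \<Rightarrow> nat ugraph" where
  "cycle_graph n = \<lparr>vertices = {0..<n}, edges = {{i, (i + 1) mod n} | i. i < n}\<rparr>"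

definition chordal :: "'a ugraph \<Rightarrow> bool" where
  "chordal G \<longleftrightarrow>
     \<not> (\<exists>U n. U \<subseteq> vertices G \<and> n \<ge> 4 \<and> graph_iso (induced_subgraph G U) (cycle_graph n))"

text \<open>\<open>Inl x\<close> is the original vertex \<open>x\<close>; \<open>Inr x\<close> is the new vertex \<open>y\<^sub>x\<close>.\<close>

definition whisker :: "'a ugraph \<Rightarrow> 'a set \<Rightarrow> ('a + 'a) ugraph" where
  "whisker G S =
     \<lparr>vertices = Inl ` vertices G \<union> Inr ` S,
      edges = (\<lambda>e. Inl ` e) ` edges G \<union> {{Inl x, Inr x} | x. x \<in> S}\<rparr>"

definition Ind :: "'a ugraph \<Rightarrow> 'a set set" where
  "Ind G = {U. U \<subseteq> vertices G \<and> \<not> (\<exists>e\<in>edges G. e \<subseteq> U)}"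


section \<open>Vertex decomposability\<close>

definition simplicial_complex :: "'a set set \<Rightarrow> bool" where
  "simplicial_complex \<Delta> \<longleftrightarrow> finite (\<Union>\<Delta>) \<and> (\<forall>\<tau>\<in>\<Delta>. \<forall>\<sigma>. \<sigma> \<subseteq> \<tau> \<longrightarrow> \<sigma> \<in> \<Delta>)"

definition facets :: "'a set set \<Rightarrow> 'a set set" where
  "facets \<Delta> = {F \<in> \<Delta>. \<forall>\<tau>\<in>\<Delta>. F \<subseteq> \<tau> \<longrightarrow> \<tau> = F}"

definition is_simplex :: "'a set set \<Rightarrow> bool" where
  "is_simplex \<Delta> \<longleftrightarrow> simplicial_complex \<Delta> \<and> (\<exists>!F. F \<in> facets \<Delta>)"

definition deletion :: "'a set set \<Rightarrow> 'a \<Rightarrow> 'a set set" where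
  "deletion \<Delta> v = {\<tau> \<in> \<Delta>. v \<notin> \<tau>}"

definition link :: "'a set set \<Rightarrow> 'a \<Rightarrow> 'a set set" where
  "link \<Delta> v = {\<tau> \<in> \<Delta>. v \<notin> \<tau> \<and> \<tau> \<union> {v} \<in> \<Delta>}"

inductive vertex_decomposable :: "'a set set \<Rightarrow> bool" where
  simplex: "is_simplex \<Delta> \<Longrightarrow> vertex_decomposable \<Delta>"
| shed: "\<lbrakk>simplicial_complex \<Delta>; {v} \<in> \<Delta>;
          vertex_decomposable (deletion \<Delta> v); vertex_decomposable (link \<Delta> v);
          facets (deletion \<Delta> v) \<inter> facets (link \<Delta> v) = {}\<rbrakk>
         \<Longrightarrow> vertex_decomposable \<Delta>"


section \<open>Modules: quotients, Krull dimension, depth\<close>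

text \<open>A module record also has the fields \<open>mult\<close> and \<open>one\<close>. They play no role in the locale
  \<^locale>\<open>Module.module\<close>, and quotient modules leave them undefined.\<close>

definition self_module :: "'r ring \<Rightarrow> ('r, 'r) module" where
  "self_module R =
     \<lparr>carrier = carrier R, mult = mult R, one = one R, zero = zero R, add = add R,
      smult = mult R\<rparr>"

definition quot_module :: "('r, 'm) module \<Rightarrow> 'm set \<Rightarrow> ('r, 'm set) module" where
  "quot_module M N =
     \<lparr>carrier = a_rcosets\<^bsub>M\<^esub> N, mult = undefined, one = undefined, zero = N, add = set_add M,
      smult = (\<lambda>a X. \<Union>x\<in>X. N +>\<^bsub>M\<^esub> (a \<odot>\<^bsub>M\<^esub> x))\<rparr>"

definition submodule_span :: "'r ring \<Rightarrow> ('r, 'm) module \<Rightarrow> 'm set \<Rightarrow> 'm set" where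
  "submodule_span R M X = \<Inter>{N. submodule N R M \<and> X \<subseteq> N}"

definition annihilator :: "'r ring \<Rightarrow> ('r, 'm) module \<Rightarrow> 'r set" where
  "annihilator R M = {a \<in> carrier R. \<forall>x\<in>carrier M. a \<odot>\<^bsub>M\<^esub> x = \<zero>\<^bsub>M\<^esub>}"

text \<open>The supremum of the empty set is \<open>0\<close> in \<^typ>\<open>enat\<close>, so the zero ring gets dimension \<open>0\<close>.\<close>

definition krull_dim :: "'r ring \<Rightarrow> enat" where
  "krull_dim R =
     Sup {enat n | n. \<exists>P. (\<forall>i\<le>n. primeideal (P i) R) \<and> (\<forall>i<n. P i \<subset> P (Suc i))}"

definition module_dim :: "'r ring \<Rightarrow> ('r, 'm) module \<Rightarrow> enat" where
  "module_dim R M = krull_dim (R Quot annihilator R M)"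

definition list_times_module :: "'r ring \<Rightarrow> ('r, 'm) module \<Rightarrow> 'r list \<Rightarrow> 'm set" where
  "list_times_module R M fs =
     submodule_span R M {f \<odot>\<^bsub>M\<^esub> x | f x. f \<in> set fs \<and> x \<in> carrier M}"

definition nonzerodivisor_on :: "('r, 'm) module \<Rightarrow> 'r \<Rightarrow> bool" where
  "nonzerodivisor_on M f \<longleftrightarrow> (\<forall>x\<in>carrier M. f \<odot>\<^bsub>M\<^esub> x = \<zero>\<^bsub>M\<^esub> \<longrightarrow> x = \<zero>\<^bsub>M\<^esub>)"

definition regular_sequence :: "'r ring \<Rightarrow> ('r, 'm) module \<Rightarrow> 'r list \<Rightarrow> bool" where
  "regular_sequence R M fs \<longleftrightarrow>
     set fs \<subseteq> carrier R \<and>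
     (\<forall>i<length fs.
        nonzerodivisor_on (quot_module M (list_times_module R M (take i fs))) (fs ! i)) \<and>
     list_times_module R M fs \<noteq> carrier M"

definition module_depth :: "'r ring \<Rightarrow> 'r set \<Rightarrow> ('r, 'm) module \<Rightarrow> enat" where
  "module_depth R \<mm> M = Sup {enat (length fs) | fs. regular_sequence R M fs \<and> set fs \<subseteq> \<mm>}"

text \<open>For a finitely generated graded module \<open>M\<close> over a standard graded polynomial ring \<open>R\<close> with
  homogeneous maximal ideal \<open>\<mm>\<close>, as usual in the graded setting.\<close>

definition cohen_macaulay :: "'r ring \<Rightarrow> 'r set \<Rightarrow> ('r, 'm) module \<Rightarrow> bool" where
  "cohen_macaulay R \<mm> M \<longleftrightarrow> module_depth R \<mm> M = module_dim R M"


section \<open>Sequentially Cohen-Macaulay graded modules\<close>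

text \<open>\<open>grd d\<close> is the degree-\<open>d\<close> component of the ambient graded module \<open>M\<close>. A submodule is
  graded iff all its elements are sums of homogeneous elements that it contains.\<close>

definition graded_submodule ::
  "'r ring \<Rightarrow> ('r, 'm) module \<Rightarrow> (nat \<Rightarrow> 'm set) \<Rightarrow> 'm set \<Rightarrow> bool" where
  "graded_submodule R M grd N \<longleftrightarrow>
     submodule N R M \<and>
     (\<forall>x\<in>N. \<exists>n f. (\<forall>d\<le>n. f d \<in> N \<inter> grd d) \<and> x = finsum M f {..n})"

definition subquotient :: "('r, 'm) module \<Rightarrow> 'm set \<Rightarrow> 'm set \<Rightarrow> ('r, 'm set) module" where
  "subquotient M N' N = quot_module (M\<lparr>carrier := N'\<rparr>) N"

definition sequentially_cohen_macaulay ::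
  "'r ring \<Rightarrow> 'r set \<Rightarrow> ('r, 'm) module \<Rightarrow> (nat \<Rightarrow> 'm set) \<Rightarrow> bool" where
  "sequentially_cohen_macaulay R \<mm> M grd \<longleftrightarrow>
     (\<exists>(t :: nat) (N :: nat \<Rightarrow> 'm set).
        N 0 = {\<zero>\<^bsub>M\<^esub>} \<and> N t = carrier M \<and>
        (\<forall>i\<le>t. graded_submodule R M grd (N i)) \<and>
        (\<forall>i\<in>{1..t}. N (i - 1) \<subset> N i) \<and>
        (\<forall>i\<in>{1..t}. cohen_macaulay R \<mm> (subquotient M (N i) (N (i - 1)))) \<and>
        (\<forall>i\<in>{1..<t}.
           module_dim R (subquotient M (N i) (N (i - 1)))
             < module_dim R (subquotient M (N (i + 1)) (N i))))"


section \<open>Edge ideals\<close>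

text \<open>A monomial is a finitely supported exponent vector.\<close>

type_synonym ('v, 'k) mpoly = "('v \<Rightarrow>\<^sub>0 nat) \<Rightarrow>\<^sub>0 'k"

definition mpoly_ring :: "'v set \<Rightarrow> ('v, 'k::field) mpoly ring" where
  "mpoly_ring V =
     \<lparr>carrier = {p. \<forall>m\<in>Poly_Mapping.keys p. Poly_Mapping.keys m \<subseteq> V},
      mult = (*), one = 1, zero = 0, add = (+)\<rparr>"

definition var :: "'v \<Rightarrow> ('v, 'k::field) mpoly" where
  "var x = Poly_Mapping.single (Poly_Mapping.single x 1) 1"

definition mon_degree :: "('v \<Rightarrow>\<^sub>0 nat) \<Rightarrow> nat" where
  "mon_degree m = (\<Sum>x\<in>Poly_Mapping.keys m. Poly_Mapping.lookup m x)"

definition homogeneous_part :: "'v set \<Rightarrow> nat \<Rightarrow> ('v, 'k::field) mpoly set" where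
  "homogeneous_part V d =
     {p \<in> carrier (mpoly_ring V). \<forall>m\<in>Poly_Mapping.keys p. mon_degree m = d}"

definition irrelevant_ideal :: "'v set \<Rightarrow> ('v, 'k::field) mpoly set" where
  "irrelevant_ideal V = Idl\<^bsub>mpoly_ring V\<^esub> (var ` V)"

definition edge_ideal :: "'v ugraph \<Rightarrow> ('v, 'k::field) mpoly set" where
  "edge_ideal H = Idl\<^bsub>mpoly_ring (vertices H)\<^esub> {var x * var y | x y. {x, y} \<in> edges H}"

text \<open>\<open>R/I(H)\<close> as an \<open>R\<close>-module, with the grading induced from the polynomial ring \<open>R\<close>.\<close>

definition edge_module :: "'v ugraph \<Rightarrow> (('v, 'k::field) mpoly, ('v, 'k) mpoly set) module" where
  "edge_module H = quot_module (self_module (mpoly_ring (vertices H))) (edge_ideal H)"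

definition edge_module_part :: "'v ugraph \<Rightarrow> nat \<Rightarrow> ('v, 'k::field) mpoly set set" where
  "edge_module_part H d =
     (\<lambda>p. edge_ideal H +>\<^bsub>mpoly_ring (vertices H)\<^esub> p) ` homogeneous_part (vertices H) d"

definition sequentially_cohen_macaulay_graph :: "'k::field itself \<Rightarrow> 'v ugraph \<Rightarrow> bool" where
  "sequentially_cohen_macaulay_graph _ H \<longleftrightarrow>
     sequentially_cohen_macaulay (mpoly_ring (vertices H) :: ('v, 'k) mpoly ring)
       (irrelevant_ideal (vertices H)) (edge_module H) (edge_module_part H)"

end

theory Submission
  imports Defs
begin

text \<open>
  Every vertex of \<open>S\<close> can be shed, because its whisker leaf is isolated after its deletion and absent
  from its link. What remains is an induced subgraph of \<open>G \<setminus> S\<close> with isolated vertices. A proper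
  induced subgraph of the five-cycle has too few edges to contain an induced cycle, so any vertex of
  the five-cycle can be shed as well, and everything reduces to chordal graphs. By Dirac's theorem
  these have a simplicial vertex, and each neighbour of it is a shedding vertex.

  A vertex decomposition yields a shelling, which can be reordered by decreasing dimension. Let \<open>I\<^sub>d\<close>
  be the Stanley--Reisner ideal of the subcomplex spanned by the facets of cardinality at least \<open>d\<close>.
  The shelling filters \<open>I\<^bsub>d+1\<^esub> / I\<^sub>d\<close> with quotients that are shifted polynomial rings \<open>k[F]\<close>
  with \<open>|F| = d\<close>. On each of these the elementary symmetric polynomials \<open>e\<^sub>d, \<dots>, e\<^sub>1\<close> form a
  regular sequence: \<open>e\<^sub>d\<close> acts as the product of the variables, and the quotient by it belongs to the
  boundary of a simplex, which is again shellable, so one proceeds by induction on \<open>d\<close>. Both the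
  dimension and the depth are at most \<open>d\<close>, because \<open>d + 1\<close> elements satisfy a polynomial relation
  modulo the annihilator, while a strict chain of primes and a regular sequence forbid such a relation.
\<close>

text \<open>A regular sequence adapted to a single facet could not be glued along a filtration whose
  pieces belong to different facets. The elementary symmetric polynomials of all variables in
  \<open>V\<close> serve every facet at once: modulo the variables outside \<open>F\<close> they
  become those of the variables of \<open>F\<close>, and the boundary faces of \<open>F\<close> see
  the tail of the same sequence. This is why the induction on \<open>d\<close> closes up. Krull
  dimension is defined by chains of primes and depth by arbitrary regular sequences, so both need
  upper bounds for objects without monomial structure. One counting argument supplies both. From a
  chain of primes pick an element of each prime outside the previous one; from a regular sequence
  form the ideals of multipliers that send the module into its successive submodules. In either case
  the products of \<open>n\<close> such elements with exponents at most \<open>K\<close> are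
  linearly independent modulo the bottom ideal, while faces of cardinality at most \<open>d\<close>
  leave room for monomials of order \<open>K ^ d\<close> only. Hence
  \<open>n \<le> d\<close>.\<close>

section \<open>Shellings\<close>

text \<open>\<open>R F\<close> is the restriction of the facet \<open>F\<close>: the faces of
  \<open>F\<close> lying in no earlier facet form the interval from \<open>R F\<close> to
  \<open>F\<close>. Ranks \<open>r\<close> replace a list, so that concatenating and reordering
  shellings is arithmetic on ranks. Facets of different cardinality are allowed.\<close>

definition shelling :: "'a set set \<Rightarrow> ('a set \<Rightarrow> nat) \<Rightarrow> ('a set \<Rightarrow> 'a set) \<Rightarrow> bool" where
  "shelling \<F> r R \<longleftrightarrow> inj_on r \<F> \<and>
     (\<forall>F\<in>\<F>. R F \<subseteq> F \<and>
        (\<forall>U\<subseteq>F. (\<exists>F'\<in>\<F>. r F' < r F \<and> U \<subseteq> F') \<longleftrightarrow> \<not> R F \<subseteq> U))"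

lemma shelling_restriction_subset: "shelling \<F> r R \<Longrightarrow> F \<in> \<F> \<Longrightarrow> R F \<subseteq> F"
  by (simp add: shelling_def)

lemma shelling_iff:
  "shelling \<F> r R \<Longrightarrow> F \<in> \<F> \<Longrightarrow> U \<subseteq> F \<Longrightarrow>
     (\<exists>F'\<in>\<F>. r F' < r F \<and> U \<subseteq> F') \<longleftrightarrow> \<not> R F \<subseteq> U"
  by (simp add: shelling_def)

lemma shelling_inj: "shelling \<F> r R \<Longrightarrow> inj_on r \<F>"
  by (simp add: shelling_def)

lemma simplicial_complexD: "simplicial_complex \<Delta> \<Longrightarrow> \<tau> \<in> \<Delta> \<Longrightarrow> U \<subseteq> \<tau> \<Longrightarrow> U \<in> \<Delta>"
  by (simp add: simplicial_complex_def)

lemma facets_maximal: "F \<in> facets \<Delta> \<Longrightarrow> \<tau> \<in> \<Delta> \<Longrightarrow> F \<subseteq> \<tau> \<Longrightarrow> \<tau> = F"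
  by (simp add: facets_def)

lemma simplicial_complex_deletion:
  "simplicial_complex \<Delta> \<Longrightarrow> simplicial_complex (deletion \<Delta> v)"
  unfolding simplicial_complex_def deletion_def by (auto intro: finite_subset)

lemma finite_simplicial_complex: "simplicial_complex \<Delta> \<Longrightarrow> finite \<Delta>"
  unfolding simplicial_complex_def using finite_UnionD by blast

lemma ex_facet_superset:
  assumes "finite \<Delta>" "\<tau> \<in> \<Delta>"
  shows "\<exists>F\<in>facets \<Delta>. \<tau> \<subseteq> F"
proof -
  obtain F where "F \<in> \<Delta>" "\<tau> \<subseteq> F" "\<forall>U\<in>\<Delta>. F \<subseteq> U \<longrightarrow> U = F"
    using finite_has_maximal2[OF assms] by metis
  then show ?thesis unfolding facets_def by blast
qed

lemma facets_subset: "facets \<Delta> \<subseteq> \<Delta>"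
  unfolding facets_def by blast

lemma facets_antichain: "F \<in> facets \<Delta> \<Longrightarrow> F' \<in> facets \<Delta> \<Longrightarrow> F \<subseteq> F' \<Longrightarrow> F = F'"
  unfolding facets_def by blast

text \<open>Disjointness keeps a facet of the deletion maximal in the whole complex: if
  \<open>v\<close> could be added to it, it would be a face of the link, hence a facet there as
  well.\<close>

lemma facets_shed:
  assumes \<Delta>: "simplicial_complex \<Delta>"
    and disj: "facets (deletion \<Delta> v) \<inter> facets (link \<Delta> v) = {}"
  shows "facets \<Delta> = facets (deletion \<Delta> v) \<union> insert v ` facets (link \<Delta> v)"
    (is "_ = ?D \<union> insert v ` ?L")
proof (intro equalityI subsetI)
  fix F assume F: "F \<in> facets \<Delta>"
  show "F \<in> ?D \<union> insert v ` ?L"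
  proof (cases "v \<in> F")
    case False
    then show ?thesis using F unfolding facets_def deletion_def by auto
  next
    case True
    have "F - {v} \<in> \<Delta>" using simplicial_complexD[OF \<Delta>, of F] F facets_subset by blast
    moreover have "(F - {v}) \<union> {v} = F" using True by auto
    ultimately have "F - {v} \<in> link \<Delta> v"
      using F by (auto simp: link_def facets_def)
    moreover have "\<tau> = F - {v}" if "\<tau> \<in> link \<Delta> v" "F - {v} \<subseteq> \<tau>" for \<tau>
    proof -
      have "\<tau> \<union> {v} \<in> \<Delta>" "v \<notin> \<tau>" using that by (auto simp: link_def)
      moreover have "F \<subseteq> \<tau> \<union> {v}" using that by auto
      ultimately have "\<tau> \<union> {v} = F" using F unfolding facets_def by blast
      then show ?thesis using \<open>v \<notin> \<tau>\<close> by auto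
    qed
    ultimately have "F - {v} \<in> ?L" unfolding facets_def by blast
    moreover have "F = insert v (F - {v})" using True by auto
    ultimately show ?thesis by blast
  qed
next
  fix F assume "F \<in> ?D \<union> insert v ` ?L"
  then show "F \<in> facets \<Delta>"
  proof
    assume F: "F \<in> ?D"
    then have Fv: "F \<in> \<Delta>" "v \<notin> F" by (auto simp: facets_def deletion_def)
    have "\<tau> = F" if \<tau>: "\<tau> \<in> \<Delta>" "F \<subseteq> \<tau>" for \<tau>
    proof (cases "v \<in> \<tau>")
      case False
      then show ?thesis using F \<tau> by (auto simp: facets_def deletion_def)
    next
      case True
      then have "F \<union> {v} \<in> \<Delta>" using simplicial_complexD[OF \<Delta> \<tau>(1)] \<tau>(2) by simp
      then have "F \<in> link \<Delta> v" using Fv by (auto simp: link_def)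
      moreover have "U = F" if "U \<in> link \<Delta> v" "F \<subseteq> U" for U
        using F that unfolding facets_def deletion_def link_def by blast
      ultimately have "F \<in> ?L" unfolding facets_def by blast
      then show ?thesis using F disj by blast
    qed
    then show ?thesis using Fv unfolding facets_def by blast
  next
    assume "F \<in> insert v ` ?L"
    then obtain E where E: "F = insert v E" "E \<in> ?L" by blast
    then have Ev: "E \<in> \<Delta>" "v \<notin> E" "F \<in> \<Delta>" by (auto simp: facets_def link_def)
    have "\<tau> = F" if \<tau>: "\<tau> \<in> \<Delta>" "F \<subseteq> \<tau>" for \<tau>
    proof -
      have v: "v \<in> \<tau>" using E \<tau> by auto
      then have "(\<tau> - {v}) \<union> {v} = \<tau>" by auto
      then have "\<tau> - {v} \<in> link \<Delta> v"
        using \<tau> simplicial_complexD[OF \<Delta> \<tau>(1)] by (simp add: link_def Diff_subset)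
      moreover have "E \<subseteq> \<tau> - {v}" using E Ev \<tau> by auto
      ultimately have "\<tau> - {v} = E" by (rule facets_maximal[OF E(2)])
      then show ?thesis using E v by auto
    qed
    then show ?thesis using Ev unfolding facets_def by blast
  qed
qed

text \<open>The shelling of the deletion comes first, followed by the cones with apex
  \<open>v\<close> over the shelling of the link. A face of such a cone without \<open>v\<close>
  already lies in the deletion, so the restriction of \<open>insert v E\<close> is
  \<open>insert v (R2 E)\<close>.\<close>

lemma vertex_decomposable_imp_shelling:
  assumes "vertex_decomposable \<Delta>"
  shows "\<exists>r R. shelling (facets \<Delta>) r R"
  using assms
proof induction
  case (simplex \<Delta>)
  then obtain F where "facets \<Delta> = {F}" unfolding is_simplex_def by blast
  then have "shelling (facets \<Delta>) (\<lambda>_. 0) (\<lambda>_. {})" unfolding shelling_def by auto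
  then show ?case by blast
next
  case (shed \<Delta> v)
  let ?D = "facets (deletion \<Delta> v)" and ?L = "facets (link \<Delta> v)"
  obtain r1 R1 where 1: "shelling ?D r1 R1" using shed by blast
  obtain r2 R2 where 2: "shelling ?L r2 R2" using shed by blast
  have fin: "finite ?D"
    using finite_simplicial_complex[OF simplicial_complex_deletion[OF shed(1)]] facets_subset
    by (rule rev_finite_subset)
  obtain N where N: "\<And>F. F \<in> ?D \<Longrightarrow> r1 F < N"
    using fin by (metis finite_imageI finite_nat_set_iff_bounded imageI)
  have D: "v \<notin> F" if "F \<in> ?D" for F using that by (auto simp: facets_def deletion_def)
  have L: "v \<notin> F" if "F \<in> ?L" for F using that by (auto simp: facets_def link_def)
  define r where "r F = (if v \<in> F then N + r2 (F - {v}) else r1 F)" for F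
  define R where "R F = (if v \<in> F then insert v (R2 (F - {v})) else R1 F)" for F
  have rD: "r F = r1 F" "R F = R1 F" if "F \<in> ?D" for F
    using D[OF that] by (auto simp: r_def R_def)
  have rL: "r (insert v E) = N + r2 E" "R (insert v E) = insert v (R2 E)" if "E \<in> ?L" for E
    using L[OF that] by (auto simp: r_def R_def)
  have eq: "facets \<Delta> = ?D \<union> insert v ` ?L" by (rule facets_shed[OF shed(1,5)])
  have "shelling (?D \<union> insert v ` ?L) r R"
    unfolding shelling_def
  proof (intro conjI ballI allI impI)
    have "inj_on r ?D" using 1 rD by (simp add: shelling_def inj_on_def)
    moreover have "inj_on r (insert v ` ?L)" using 2 rL by (auto simp add: shelling_def inj_on_def)
    moreover have "r ` ?D \<inter> r ` insert v ` ?L = {}" using rD rL N by fastforce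
    ultimately show "inj_on r (?D \<union> insert v ` ?L)" by (subst inj_on_Un) auto
  next
    fix F assume "F \<in> ?D \<union> insert v ` ?L"
    then show "R F \<subseteq> F" using rD rL 1 2 unfolding shelling_def by fastforce
  next
    fix F U assume F: "F \<in> ?D \<union> insert v ` ?L" and U: "U \<subseteq> F"
    show "(\<exists>F'\<in>?D \<union> insert v ` ?L. r F' < r F \<and> U \<subseteq> F') \<longleftrightarrow> \<not> R F \<subseteq> U"
      using F
    proof
      assume F: "F \<in> ?D"
      have "(\<exists>F'\<in>?D \<union> insert v ` ?L. r F' < r F \<and> U \<subseteq> F') \<longleftrightarrow> (\<exists>F'\<in>?D. r1 F' < r1 F \<and> U \<subseteq> F')"
      proof -
        have "\<not> r (insert v E) < r F" if "E \<in> ?L" for E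
          using rD(1)[OF F] rL(1)[OF that] N[OF F] by simp
        then show ?thesis using rD(1)[OF F] rD(1) by (auto simp: bex_Un)
      qed
      then show ?thesis using shelling_iff[OF 1 F U] rD(2)[OF F] by simp
    next
      assume "F \<in> insert v ` ?L"
      then obtain E where E: "F = insert v E" "E \<in> ?L" by blast
      show ?thesis
      proof (cases "v \<in> U")
        case False
        have "U \<subseteq> E" "E \<in> deletion \<Delta> v"
          using False U E by (auto simp: facets_def link_def deletion_def)
        then obtain F' where "F' \<in> ?D" "U \<subseteq> F'"
          using ex_facet_superset[OF finite_simplicial_complex[OF simplicial_complex_deletion[OF shed(1)]], of E v]
          by blast
        moreover then have "r F' < r F" using N rD rL E by fastforce
        ultimately show ?thesis using False E rL by auto
      next
        case True
        have "(\<exists>F'\<in>?D \<union> insert v ` ?L. r F' < r F \<and> U \<subseteq> F') \<longleftrightarrow>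
            (\<exists>E'\<in>?L. r2 E' < r2 E \<and> U \<subseteq> insert v E')"
        proof -
          have "\<not> U \<subseteq> F'" if "F' \<in> ?D" for F' using True D[OF that] by blast
          moreover have "r (insert v E') < r F \<longleftrightarrow> r2 E' < r2 E" if "E' \<in> ?L" for E'
            using rL(1)[OF that] rL(1)[OF E(2)] E(1) by simp
          ultimately show ?thesis by auto
        qed
        also have "\<dots> \<longleftrightarrow> (\<exists>E'\<in>?L. r2 E' < r2 E \<and> U - {v} \<subseteq> E')"
          by (metis Diff_single_insert insert_mono insert_Diff True subset_insert_iff)
        also have "\<dots> \<longleftrightarrow> \<not> R2 E \<subseteq> U - {v}"
          using E U by (intro shelling_iff[OF 2]) auto
        also have "\<dots> \<longleftrightarrow> \<not> R F \<subseteq> U"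
        proof -
          have "v \<notin> R2 E" using 2 E L unfolding shelling_def by blast
          then show ?thesis using E rL True by auto
        qed
        finally show ?thesis .
      qed
    qed
  qed
  then show ?case using eq by metis
qed

text \<open>Delete from \<open>F\<close> one vertex of \<open>R F\<close> outside \<open>U\<close>.
  What remains lies in an earlier facet, and properly so because the facets form an antichain; that
  facet therefore has at least as many vertices as \<open>F\<close>.\<close>

lemma shelling_card_mono:
  assumes sh: "shelling \<F> r R"
    and anti: "\<And>F F'. F \<in> \<F> \<Longrightarrow> F' \<in> \<F> \<Longrightarrow> F \<subseteq> F' \<Longrightarrow> F = F'"
    and fin: "\<And>F. F \<in> \<F> \<Longrightarrow> finite F"
    and F: "F \<in> \<F>" "U \<subseteq> F" "\<not> R F \<subseteq> U"
  shows "\<exists>F'\<in>\<F>. r F' < r F \<and> U \<subseteq> F' \<and> card F \<le> card F'"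
proof -
  obtain x where x: "x \<in> R F" "x \<notin> U" using F by blast
  then have "\<not> R F \<subseteq> F - {x}" by blast
  then obtain F' where F': "F' \<in> \<F>" "r F' < r F" "F - {x} \<subseteq> F'"
    using sh F(1) unfolding shelling_def by (metis Diff_subset)
  have xF: "x \<in> F" using sh F x unfolding shelling_def by blast
  have "F' \<noteq> F - {x}" using anti[of F' F] F' F by auto
  then have "card (F - {x}) < card F'" using F' fin by (intro psubset_card_mono) auto
  then have "card F \<le> card F'" using xF fin[OF F(1)] by simp
  then show ?thesis using F' F x by blast
qed

text \<open>The rearrangement lemma of Bjorner and Wachs.\<close>

lemma shelling_rearrange:
  assumes sh: "shelling \<F> r R" and finF: "finite \<F>"
    and anti: "\<And>F F'. F \<in> \<F> \<Longrightarrow> F' \<in> \<F> \<Longrightarrow> F \<subseteq> F' \<Longrightarrow> F = F'"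
    and fin: "\<And>F. F \<in> \<F> \<Longrightarrow> finite F"
  shows "\<exists>r'. shelling \<F> r' R \<and> (\<forall>d. \<exists>a. \<forall>F\<in>\<F>. r' F < a \<longleftrightarrow> d < card F)"
proof -
  obtain M where M: "\<And>F. F \<in> \<F> \<Longrightarrow> r F < M"
    using finF by (metis finite_imageI finite_nat_set_iff_bounded imageI)
  obtain N where N: "\<And>F. F \<in> \<F> \<Longrightarrow> card F < N"
    using finF by (metis finite_imageI finite_nat_set_iff_bounded imageI)
  \<comment> \<open>Lexicographic rank: larger facets first, ties broken by \<open>r\<close>, which
    stays below \<open>M\<close>. Facets of cardinality \<open>c\<close> have ranks from
    \<open>(N - c) * M\<close> to just below \<open>(N - c + 1) * M\<close>, which yields the
    thresholds \<open>(N - d) * M\<close> further down.\<close>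
  define r' where "r' F = (N - card F) * M + r F" for F
  have lt1: "r' F < r' F'" if "F \<in> \<F>" "F' \<in> \<F>" "card F' < card F" for F F'
  proof -
    have "r' F < (N - card F + 1) * M" using M[OF that(1)] by (simp add: r'_def)
    also have "\<dots> \<le> (N - card F') * M" using N that by (intro mult_right_mono) force+
    also have "\<dots> \<le> r' F'" by (simp add: r'_def)
    finally show ?thesis .
  qed
  have lt: "r' F < r' F' \<longleftrightarrow> card F' < card F \<or> card F' = card F \<and> r F < r F'"
    if "F \<in> \<F>" "F' \<in> \<F>" for F F'
    using lt1[OF that] lt1[OF that(2,1)] by (cases "card F" "card F'" rule: linorder_cases) (auto simp: r'_def)
  \<comment> \<open>If \<open>F'\<close> follows \<open>F\<close> in the old order, it is strictly
    larger, and \<open>U\<close>, being contained in both, already occurs before \<open>F'\<close>;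
    so \<open>shelling_card_mono\<close> replaces \<open>F'\<close> by an older facet that is no
    smaller. The descent stops at a facet before \<open>F\<close>.\<close>
  have covered: "\<not> R F \<subseteq> U"
    if "F \<in> \<F>" "U \<subseteq> F" "F' \<in> \<F>" "U \<subseteq> F'" "F' \<noteq> F" "card F \<le> card F'"
      "card F < card F' \<or> r F' < r F" for F F' U
    using that(3-)
  proof (induction "r F'" arbitrary: F' rule: less_induct)
    case less
    show ?case
    proof (cases "r F' < r F")
      case True
      then show ?thesis using sh less.prems that(1,2) unfolding shelling_def by blast
    next
      case False
      then have ll: "r F < r F'" "card F < card F'"
        using sh that(1) less.prems unfolding shelling_def inj_on_def by (metis linorder_less_linear)+
      then have "\<not> R F' \<subseteq> U" using sh less.prems that(1,2) unfolding shelling_def by blast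
      then obtain F'' where "F'' \<in> \<F>" "r F'' < r F'" "U \<subseteq> F''" "card F' \<le> card F''"
        using shelling_card_mono[OF sh anti fin, of F' U] less.prems by blast
      then show ?thesis using less.hyps[of F''] ll by (metis le_trans leD less_le_trans order.strict_implies_order)
    qed
  qed
  have "shelling \<F> r' R"
    unfolding shelling_def
  proof (intro conjI ballI allI impI)
    show "inj_on r' \<F>"
    proof (rule inj_onI, rule ccontr)
      fix F F' assume *: "F \<in> \<F>" "F' \<in> \<F>" "r' F = r' F'" "F \<noteq> F'"
      then have "r F \<noteq> r F'" using shelling_inj[OF sh] by (auto dest: inj_onD)
      then show False using lt[OF *(1,2)] lt[OF *(2,1)] *(3) by linarith
    qed
    show "R F \<subseteq> F" if "F \<in> \<F>" for F using sh that unfolding shelling_def by blast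
    fix F U assume F: "F \<in> \<F>" "U \<subseteq> F"
    show "(\<exists>F'\<in>\<F>. r' F' < r' F \<and> U \<subseteq> F') \<longleftrightarrow> \<not> R F \<subseteq> U"
    proof
      assume "\<exists>F'\<in>\<F>. r' F' < r' F \<and> U \<subseteq> F'"
      then show "\<not> R F \<subseteq> U" using covered F lt by (metis less_irrefl order.strict_implies_order order_refl)
    next
      assume "\<not> R F \<subseteq> U"
      then obtain F' where "F' \<in> \<F>" "r F' < r F" "U \<subseteq> F'" "card F \<le> card F'"
        using shelling_card_mono[OF sh anti fin] F by blast
      then show "\<exists>F'\<in>\<F>. r' F' < r' F \<and> U \<subseteq> F'" using lt F by (metis le_eq_less_or_eq)
    qed
  qed
  moreover have "\<exists>a. \<forall>F\<in>\<F>. r' F < a \<longleftrightarrow> d < card F" for d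
  proof (intro exI ballI)
    fix F assume F: "F \<in> \<F>"
    show "r' F < (N - d) * M \<longleftrightarrow> d < card F"
    proof
      assume "d < card F"
      then have "N - card F + 1 \<le> N - d" using N[OF F] by simp
      then have "(N - card F + 1) * M \<le> (N - d) * M" by (rule mult_right_mono) simp
      then show "r' F < (N - d) * M" using M[OF F] by (simp add: r'_def)
    next
      assume *: "r' F < (N - d) * M"
      show "d < card F"
      proof (rule ccontr)
        assume "\<not> d < card F"
        then have "(N - d) * M \<le> (N - card F) * M" by (intro mult_right_mono) auto
        then show False using * unfolding r'_def by linarith
      qed
    qed
  qed
  ultimately show ?thesis by blast
qed

section \<open>Vertex decomposability of whiskered graphs\<close>

text \<open>The edge set stays fixed while the vertex set shrinks: edges not contained in
  \<open>W\<close> have no effect, so deletions and links are again of this form.\<close>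

abbreviation Ind_on :: "'b set set \<Rightarrow> 'b set \<Rightarrow> 'b set set" where
  "Ind_on E W \<equiv> Ind \<lparr>vertices = W, edges = E\<rparr>"

definition nbrs :: "'b set set \<Rightarrow> 'b \<Rightarrow> 'b set" where
  "nbrs E v = {u. {u, v} \<in> E}"

abbreviation clnbrs :: "'b set set \<Rightarrow> 'b \<Rightarrow> 'b set" where
  "clnbrs E v \<equiv> insert v (nbrs E v)"

definition simplicial :: "'b set set \<Rightarrow> 'b set \<Rightarrow> 'b \<Rightarrow> bool" where
  "simplicial E W s \<longleftrightarrow>
     s \<in> W \<and> (\<forall>a\<in>W \<inter> nbrs E s. \<forall>b\<in>W \<inter> nbrs E s. a \<noteq> b \<longrightarrow> {a, b} \<in> E)"

abbreviation iso_cycle :: "'b set set \<Rightarrow> 'b set \<Rightarrow> nat \<Rightarrow> bool" where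
  "iso_cycle E U n \<equiv> graph_iso \<lparr>vertices = U, edges = {e \<in> E. e \<subseteq> U}\<rparr> (cycle_graph n)"

definition chordal_on :: "'b set set \<Rightarrow> 'b set \<Rightarrow> bool" where
  "chordal_on E W \<longleftrightarrow>
     \<not> (\<exists>U n. U \<subseteq> W \<and> n \<ge> 4 \<and> iso_cycle E U n)"

lemma Ind_eq: "Ind G = Ind_on (edges G) (vertices G)"
  by (simp add: Ind_def)

lemma nbrs_sym: "u \<in> nbrs E v \<longleftrightarrow> v \<in> nbrs E u"
  by (simp add: nbrs_def insert_commute)

lemma chordal_on_mono: "chordal_on E W \<Longrightarrow> W' \<subseteq> W \<Longrightarrow> chordal_on E W'"
  unfolding chordal_on_def by (meson order_trans)

lemma chordal_induced_subgraph: "chordal (induced_subgraph G W) \<longleftrightarrow> chordal_on (edges G) W"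
proof -
  have "{e \<in> {e \<in> edges G. e \<subseteq> W}. e \<subseteq> U} = {e \<in> edges G. e \<subseteq> U}" if "U \<subseteq> W" for U
    using that by auto
  then show ?thesis
    by (auto simp: chordal_def chordal_on_def induced_subgraph_def)
qed

lemma simplicial_complex_indep: "finite W \<Longrightarrow> simplicial_complex (Ind_on E W)"
  unfolding simplicial_complex_def Ind_def
  by (auto intro: finite_subset[of _ W])

lemma deletion_indep: "deletion (Ind_on E W) v = Ind_on E (W - {v})"
  by (auto simp: deletion_def Ind_def)

lemma edge_of_two:
  assumes "\<forall>e\<in>E. card e = 2" "e \<in> E" "v \<in> e"
  obtains u where "e = {u, v}" "u \<noteq> v" "u \<in> nbrs E v"
proof -
  obtain a b where "e = {a, b}" "a \<noteq> b" using assms by (metis card_2_iff)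
  then show ?thesis using that[of a] that[of b] assms
    by (metis doubleton_eq_iff insertE mem_Collect_eq nbrs_def singletonD)
qed

lemma self_notin_nbrs: "\<forall>e\<in>E. card e = 2 \<Longrightarrow> v \<notin> nbrs E v"
  by (force simp: nbrs_def)

lemma link_indep:
  assumes "\<forall>e\<in>E. card e = 2" "v \<in> W"
  shows "link (Ind_on E W) v = Ind_on E (W - clnbrs E v)"
proof (intro equalityI subsetI)
  fix \<tau> assume "\<tau> \<in> link (Ind_on E W) v"
  then have *: "\<tau> \<subseteq> W" "v \<notin> \<tau>" "\<And>e. e \<in> E \<Longrightarrow> \<not> e \<subseteq> insert v \<tau>"
    by (auto simp: link_def Ind_def)
  have "u \<notin> nbrs E v" if "u \<in> \<tau>" for u
    using *(3)[of "{u, v}"] that by (auto simp: nbrs_def)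
  then show "\<tau> \<in> Ind_on E (W - clnbrs E v)"
    using * by (auto simp: Ind_def)
next
  fix \<tau> assume "\<tau> \<in> Ind_on E (W - clnbrs E v)"
  then have *: "\<tau> \<subseteq> W" "v \<notin> \<tau>" "\<tau> \<inter> nbrs E v = {}" "\<And>e. e \<in> E \<Longrightarrow> \<not> e \<subseteq> \<tau>"
    by (auto simp: Ind_def)
  have "\<not> e \<subseteq> insert v \<tau>" if "e \<in> E" for e
  proof (cases "v \<in> e")
    case True
    then obtain u where "e = {u, v}" "u \<noteq> v" "u \<in> nbrs E v"
      using edge_of_two[OF assms(1) \<open>e \<in> E\<close> True] by metis
    then show ?thesis using * by auto
  next
    case False
    then show ?thesis using *(4)[OF that] by auto
  qed
  then show "\<tau> \<in> link (Ind_on E W) v"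
    using * assms by (auto simp: link_def Ind_def)
qed

text \<open>A common facet of deletion and link would be an independent set outside the closed
  neighbourhood of \<open>v\<close> that is maximal in \<open>W - {v}\<close>; \<open>ext\<close>
  rules this out.\<close>

lemma vertex_decomposable_indep_shed:
  assumes "\<forall>e\<in>E. card e = 2" "finite W" "v \<in> W"
    and "vertex_decomposable (Ind_on E (W - {v}))"
    and "vertex_decomposable (Ind_on E (W - clnbrs E v))"
    and ext: "\<And>U. U \<in> Ind_on E (W - clnbrs E v) \<Longrightarrow>
          \<exists>w\<in>W - {v} - U. insert w U \<in> Ind_on E (W - {v})"
  shows "vertex_decomposable (Ind_on E W)"
proof (rule vertex_decomposable.shed)
  show "simplicial_complex (Ind_on E W)" by (rule simplicial_complex_indep[OF assms(2)])
  show "{v} \<in> Ind_on E W"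
  proof -
    have "\<not> e \<subseteq> {v}" if "e \<in> E" for e
    proof
      assume "e \<subseteq> {v}"
      then have "card e \<le> 1" using card_mono[of "{v}" e] by simp
      then show False using assms(1) that by auto
    qed
    then show ?thesis using assms(3) by (auto simp: Ind_def)
  qed
  show "vertex_decomposable (deletion (Ind_on E W) v)"
    using assms(4) by (simp add: deletion_indep)
  show "vertex_decomposable (link (Ind_on E W) v)"
    using assms(5) by (simp add: link_indep[OF assms(1,3)])
  show "facets (deletion (Ind_on E W) v) \<inter> facets (link (Ind_on E W) v) = {}"
  proof (rule equals0I)
    fix F assume F: "F \<in> facets (deletion (Ind_on E W) v) \<inter> facets (link (Ind_on E W) v)"
    then obtain w where "w \<notin> F" "insert w F \<in> Ind_on E (W - {v})"
      using ext[of F] facets_subset by (fastforce simp: link_indep[OF assms(1,3)])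
    then have "insert w F = F"
      using F by (intro facets_maximal[of F "deletion (Ind_on E W) v"]) (auto simp: deletion_indep)
    then show False using \<open>w \<notin> F\<close> by auto
  qed
qed

lemma vertex_decomposable_no_edges:
  assumes "finite W" "\<And>e. e \<in> E \<Longrightarrow> \<not> e \<subseteq> W"
  shows "vertex_decomposable (Ind_on E W)"
proof (rule vertex_decomposable.simplex)
  have eq: "Ind_on E W = Pow W" using assms by (auto simp: Ind_def)
  then have "facets (Ind_on E W) = {W}" by (auto simp: facets_def)
  then show "is_simplex (Ind_on E W)"
    using simplicial_complex_indep[OF assms(1), of E] by (simp add: is_simplex_def)
qed

section \<open>Induced cycles and simplicial vertices of chordal graphs\<close>

lemma graph_iso_cycle_graphI:
  assumes g: "bij_betw g {0..<n} U" and E2: "\<forall>e\<in>E. card e = 2"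
    and edge: "\<And>i. i < n \<Longrightarrow> {g i, g ((i + 1) mod n)} \<in> E"
    and no_chord: "\<And>i j. i < j \<Longrightarrow> j < n \<Longrightarrow> {g i, g j} \<in> E \<Longrightarrow> j = i + 1 \<or> i = 0 \<and> j = n - 1"
  shows "iso_cycle E U n"
proof -
  define f where "f = the_inv_into {0..<n} g"
  have inj: "inj_on g {0..<n}" and im: "g ` {0..<n} = U" using g by (auto simp: bij_betw_def)
  have fg: "f (g i) = i" if "i < n" for i
    using the_inv_into_f_f[OF inj] that by (simp add: f_def)
  have "bij_betw f U {0..<n}" unfolding f_def by (rule bij_betw_the_inv_into[OF g])
  moreover have "{{i, (i + 1) mod n} | i. i < n} = (\<lambda>e. f ` e) ` {e \<in> E. e \<subseteq> U}"
  proof (intro equalityI subsetI)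
    fix e assume "e \<in> {{i, (i + 1) mod n} | i. i < n}"
    then obtain i where i: "i < n" "e = {i, (i + 1) mod n}" by blast
    then have "(i + 1) mod n < n" by simp
    then have "e = f ` {g i, g ((i + 1) mod n)}" "{g i, g ((i + 1) mod n)} \<subseteq> U"
      using i fg im by auto
    then show "e \<in> (\<lambda>e. f ` e) ` {e \<in> E. e \<subseteq> U}" using edge[OF i(1)] by blast
  next
    fix d assume "d \<in> (\<lambda>e. f ` e) ` {e \<in> E. e \<subseteq> U}"
    then obtain e where e: "e \<in> E" "e \<subseteq> U" "d = f ` e" by blast
    then obtain a b where ab: "e = {a, b}" "a \<noteq> b" using E2 by (metis card_2_iff)
    then have "a \<in> g ` {0..<n}" "b \<in> g ` {0..<n}" using e im by auto
    then obtain i0 j0 where ij0: "a = g i0" "b = g j0" "i0 < n" "j0 < n" by auto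
    then have "i0 \<noteq> j0" using ab by auto
    define i j where "i = min i0 j0" and "j = max i0 j0"
    have ij: "i < j" "j < n" "e = {g i, g j}"
      using ij0 \<open>i0 \<noteq> j0\<close> ab unfolding i_def j_def by (auto simp: min_def max_def)
    then have d: "d = {i, j}" using fg[of i] fg[of j] e(3) by auto
    from no_chord[OF ij(1,2)] e(1) ij(3) have "j = i + 1 \<or> i = 0 \<and> j = n - 1" by simp
    then show "d \<in> {{i, (i + 1) mod n} | i. i < n}"
    proof
      assume "j = i + 1"
      then have "d = {i, (i + 1) mod n}" "i < n" using d ij by auto
      then show ?thesis by blast
    next
      assume "i = 0 \<and> j = n - 1"
      then have "d = {n - 1, (n - 1 + 1) mod n}" "n - 1 < n" using d ij by auto
      then show ?thesis by blast
    qed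
  qed
  ultimately show ?thesis
    unfolding graph_iso_def cycle_graph_def by auto
qed

text \<open>A shortest walk through \<open>D\<close> closes up to an induced cycle through \<open>v\<close>.\<close>

lemma chordal_no_detour:
  assumes E2: "\<forall>e\<in>E. card e = 2" and ch: "chordal_on E W"
    and D: "D \<subseteq> W" "v \<in> W" "v \<notin> D" "D \<inter> nbrs E v = {}"
    and st: "s \<in> W" "t \<in> W" "s \<in> nbrs E v" "t \<in> nbrs E v" "s \<noteq> t" "{s, t} \<notin> E"
    and walk: "q 0 = s" "q l = t" "\<And>i. i < l \<Longrightarrow> {q i, q (Suc i)} \<in> E" "\<And>i. 0 < i \<Longrightarrow> i < l \<Longrightarrow> q i \<in> D"
  shows False
proof -
  \<comment> \<open>\<open>Q k p\<close> describes a walk \<open>p\<close> of length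
    \<open>k\<close> from \<open>s\<close> to \<open>t\<close> with interior in \<open>D\<close>.
    Minimality of \<open>k\<close> will exclude chords and repetitions.\<close>
  define Q where "Q k p \<longleftrightarrow> p 0 = s \<and> p k = t \<and> (\<forall>i<k. {p i, p (Suc i)} \<in> E) \<and>
    (\<forall>i. 0 < i \<longrightarrow> i < k \<longrightarrow> p i \<in> D)" for k and p :: "nat \<Rightarrow> 'a"
  have "Q l q" using walk by (simp add: Q_def)
  then obtain k where "\<exists>p. Q k p" and min: "\<And>k' p. Q k' p \<Longrightarrow> k \<le> k'"
    using exists_least_iff[of "\<lambda>k. \<exists>p. Q k p"] by (metis not_le)
  then obtain p where "Q k p" by blast
  then have p: "p 0 = s" "p k = t" "\<And>i. i < k \<Longrightarrow> {p i, p (Suc i)} \<in> E" "\<And>i. 0 < i \<Longrightarrow> i < k \<Longrightarrow> p i \<in> D"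
    by (auto simp: Q_def)
  \<comment> \<open>Skipping the \<open>d\<close> vertices after \<open>p i\<close> would shorten
    the walk. When \<open>i + d = k\<close> the end of the walk is cut off, which is legitimate if
    \<open>p i\<close> is already \<open>t\<close>.\<close>
  have no_shortcut: False
    if d: "0 < d" "i + d \<le> k" and edge: "i + d < k \<Longrightarrow> {p i, p (Suc (i + d))} \<in> E"
      and "i + d = k \<Longrightarrow> p i = p k" for i d
  proof -
    define p' where "p' m = (if m \<le> i then p m else p (m + d))" for m
    have "Q (k - d) p'"
      unfolding Q_def
    proof (intro conjI allI impI)
      show "p' 0 = s" using p by (simp add: p'_def)
      show "p' (k - d) = t"
        using that(4) d p(2) by (cases "i + d = k") (auto simp: p'_def)
      fix m assume m: "m < k - d"
      consider "m < i" | "m = i" | "i < m" by linarith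
      then show "{p' m, p' (Suc m)} \<in> E"
      proof cases
        case 1
        then show ?thesis using p(3)[of m] m by (simp add: p'_def)
      next
        case 2
        then show ?thesis using edge m by (simp add: p'_def)
      next
        case 3
        then show ?thesis using p(3)[of "m + d"] m by (simp add: p'_def)
      qed
      assume "0 < m"
      then show "p' m \<in> D" using p(4)[of m] p(4)[of "m + d"] m by (auto simp: p'_def)
    qed
    then show False using min[of "k - d" p'] d by linarith
  qed
  have neq: "p i \<noteq> p j" if "i < j" "j \<le> k" for i j
  proof
    assume "p i = p j"
    then show False using no_shortcut[of "j - i" i] p(3)[of j] that by simp
  qed
  have chord: "j = Suc i" if "i < j" "j \<le> k" "{p i, p j} \<in> E" for i j
  proof (rule ccontr)
    assume "j \<noteq> Suc i"
    then have "0 < j - i - 1" "Suc (i + (j - i - 1)) = j" "i + (j - i - 1) < k" using that(1,2) by linarith+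
    then show False using no_shortcut[of "j - i - 1" i] that by simp
  qed
  have k2: "2 \<le> k"
  proof (rule ccontr)
    assume "\<not> 2 \<le> k"
    then have "k = 0 \<or> k = 1" by linarith
    then show False using p st p(3)[of 0] by auto
  qed
  \<comment> \<open>The walk contributes \<open>k + 1\<close> vertices and \<open>v\<close> closes
    the cycle at index \<open>k + 1\<close>. As \<open>s\<close> and \<open>t\<close> are distinct
    and nonadjacent, \<open>k\<close> is at least two and the cycle has length at least
    four.\<close>
  define g where "g i = (if i \<le> k then p i else v)" for i
  have vst: "{s, v} \<in> E" "{t, v} \<in> E" using st by (auto simp: nbrs_def)
  have pv: "p i \<noteq> v" if "i \<le> k" for i
    using p D(3) st self_notin_nbrs[OF E2, of v] that by (metis bot_nat_0.not_eq_extremum le_neq_implies_less)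
  have pW: "p i \<in> W" if "i \<le> k" for i
    using p D(1) st that by (metis bot_nat_0.not_eq_extremum le_neq_implies_less subsetD)
  have pn: "i = 0 \<or> i = k" if "i \<le> k" "{p i, v} \<in> E" for i
  proof (rule ccontr)
    assume "\<not> (i = 0 \<or> i = k)"
    then have "p i \<in> D" using p that by simp
    then show False using D(4) that by (auto simp: nbrs_def)
  qed
  have "bij_betw g {0..<k + 2} (g ` {0..<k + 2})"
  proof (rule bij_betw_imageI)
    show "inj_on g {0..<k + 2}"
    proof (rule linorder_inj_onI)
      fix i j assume "i < j" "i \<in> {0..<k + 2}" "j \<in> {0..<k + 2}"
      then show "g i \<noteq> g j" using neq[of i j] pv[of i] by (auto simp: g_def)
    qed auto
  qed simp
  then have "iso_cycle E (g ` {0..<k + 2}) (k + 2)"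
  proof (rule graph_iso_cycle_graphI[OF _ E2])
    fix i assume "i < k + 2"
    then consider "i < k" | "i = k" | "i = k + 1" by linarith
    then show "{g i, g ((i + 1) mod (k + 2))} \<in> E"
      using p vst by cases (auto simp: g_def insert_commute)
  next
    fix i j assume ij: "i < j" "j < k + 2" "{g i, g j} \<in> E"
    show "j = i + 1 \<or> i = 0 \<and> j = k + 2 - 1"
    proof (cases "j \<le> k")
      case True
      then show ?thesis using chord[of i j] ij by (simp add: g_def)
    next
      case False
      then have "j = k + 1" "i \<le> k" using ij by auto
      then show ?thesis using pn[of i] ij(3) by (auto simp: g_def)
    qed
  qed
  moreover have "g ` {0..<k + 2} \<subseteq> W" using pW D(2) by (auto simp: g_def)
  moreover have "4 \<le> k + 2" using k2 by simp
  ultimately show False using ch unfolding chordal_on_def by blast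
qed

text \<open>Dirac's theorem. The neighbourhood \<open>T\<close> of a component \<open>C\<close> of the complement of the closed
  neighbourhood of \<open>v\<close> is a clique, so the induction on \<open>C \<union> T\<close> yields a simplicial vertex in \<open>C\<close>.\<close>

lemma chordal_simplicial_nonneighbour:
  assumes E2: "\<forall>e\<in>E. card e = 2" and "finite W" and "chordal_on E W"
    and "v \<in> W" "\<not> W \<subseteq> clnbrs E v"
  shows "\<exists>s\<in>W - clnbrs E v. simplicial E W s"
  using assms(2-)
proof (induction "card W" arbitrary: W v rule: less_induct)
  case less
  define D where "D = W - clnbrs E v"
  obtain c0 where c0: "c0 \<in> D" using less.prems D_def by blast
  define r where "r = {(a, b). a \<in> D \<and> b \<in> D \<and> {a, b} \<in> E}"
  define C where "C = r\<^sup>* `` {c0}"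
  have symr: "sym r" by (auto simp: r_def sym_def insert_commute)
  have CD: "C \<subseteq> D"
  proof
    fix c assume "c \<in> C"
    then have "(c0, c) \<in> r\<^sup>*" by (simp add: C_def)
    then show "c \<in> D" using c0 by (induction) (auto simp: r_def)
  qed
  have c0C: "c0 \<in> C" by (simp add: C_def)
  define T where "T = {t \<in> W - C. \<exists>c\<in>C. {t, c} \<in> E}"
  have step: "b \<in> C" if "a \<in> C" "b \<in> D" "{a, b} \<in> E" for a b
  proof -
    have "(a, b) \<in> r" using that CD by (auto simp: r_def)
    then show ?thesis using that by (auto simp: C_def intro: rtrancl_into_rtrancl)
  qed
  have T: "t \<in> W" "t \<in> nbrs E v" if "t \<in> T" for t
  proof -
    show "t \<in> W" using that by (simp add: T_def)
    obtain c where c: "t \<notin> C" "c \<in> C" "{t, c} \<in> E" using \<open>t \<in> T\<close> by (auto simp: T_def)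
    then have "t \<notin> D" using step[of c t] by (auto simp: insert_commute)
    moreover have "t \<noteq> v" using c CD D_def by (auto simp: nbrs_def insert_commute)
    ultimately show "t \<in> nbrs E v" using \<open>t \<in> W\<close> D_def by blast
  qed
  have nC: "u \<in> C \<union> T" if "c \<in> C" "u \<in> W" "{u, c} \<in> E" for c u
    using that by (auto simp: T_def)
  have clique: "{s, t} \<in> E" if "s \<in> T" "t \<in> T" "s \<noteq> t" for s t
  proof (rule ccontr)
    assume nE: "{s, t} \<notin> E"
    obtain a b where ab: "a \<in> C" "{s, a} \<in> E" "b \<in> C" "{t, b} \<in> E"
      using \<open>s \<in> T\<close> \<open>t \<in> T\<close> unfolding T_def by blast
    have "(a, c0) \<in> r\<^sup>*" "(c0, b) \<in> r\<^sup>*"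
      using ab sym_rtrancl[OF symr] by (auto simp: C_def sym_def)
    then have "(a, b) \<in> r\<^sup>*" by (rule rtrancl_trans)
    then obtain n f where f: "f 0 = a" "f n = b" "\<And>i. i < n \<Longrightarrow> (f i, f (Suc i)) \<in> r"
      by (metis relpow_fun_conv rtrancl_imp_relpow)
    have fD: "f i \<in> D" if "i \<le> n" for i
      using that f ab CD by (cases "i = n") (auto simp: r_def dest!: f(3))
    \<comment> \<open>The walk goes from \<open>s\<close> to \<open>a\<close>, along
      \<open>f\<close> to \<open>b\<close>, and on to \<open>t\<close>; the \<open>n + 1\<close>
      vertices of \<open>f\<close> are shifted by one place.\<close>
    define q where "q i = (if i = 0 then s else if i = n + 2 then t else f (i - 1))" for i
    show False
    proof (rule chordal_no_detour[OF E2 less.prems(2), of D v s t q "n + 2"])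
      show "D \<subseteq> W" "v \<notin> D" "D \<inter> nbrs E v = {}" by (auto simp: D_def)
      show "v \<in> W" by fact
      show "s \<in> W" "t \<in> W" "s \<in> nbrs E v" "t \<in> nbrs E v" using T that by auto
      show "s \<noteq> t" "{s, t} \<notin> E" by fact+
      show "q 0 = s" "q (n + 2) = t" by (auto simp: q_def)
      fix i
      show "{q i, q (Suc i)} \<in> E" if i: "i < n + 2"
      proof -
        consider "i = 0" | "i = n + 1" | "0 < i" "i < n + 1"
          using i by linarith
        then show ?thesis
        proof cases
          case 1
          then show ?thesis using ab f by (simp add: q_def)
        next
          case 2
          then show ?thesis using ab f by (simp add: q_def insert_commute)
        next
          case 3
          then show ?thesis using f(3)[of "i - 1"] by (simp add: q_def r_def)
        qed
      qed
      show "q i \<in> D" if "0 < i" "i < n + 2"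
        using that fD[of "i - 1"] by (auto simp: q_def)
    qed
  qed
  have W': "C \<union> T \<subseteq> W" using CD T D_def by auto
  \<comment> \<open>All neighbours in \<open>W\<close> of a vertex of \<open>C\<close> lie in
    \<open>C \<union> T\<close>, so being simplicial there is being simplicial in
    \<open>W\<close>.\<close>
  have simplicial_lift: ?case if "s \<in> C" "simplicial E (C \<union> T) s" for s
  proof -
    have "W \<inter> nbrs E s = (C \<union> T) \<inter> nbrs E s" using nC[OF that(1)] W' by (auto simp: nbrs_def)
    then have "simplicial E W s" using that W' by (auto simp: simplicial_def)
    then show ?thesis using that CD D_def by blast
  qed
  show ?case
  proof (cases "\<exists>u\<in>C \<union> T. \<not> C \<union> T \<subseteq> clnbrs E u")
    case False
    then have "{a, b} \<in> E" if "a \<in> C \<union> T" "b \<in> C \<union> T" "a \<noteq> b" for a b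
      using that by (auto simp: nbrs_def)
    then have "simplicial E (C \<union> T) c0" using c0C by (auto simp: simplicial_def)
    then show ?thesis using simplicial_lift c0C by blast
  next
    case True
    \<comment> \<open>A simplicial vertex outside the closed neighbourhood of such a
      \<open>u\<close> avoids \<open>T\<close>, so it lies in \<open>C\<close>. If some vertex of
      \<open>T\<close> has a non-neighbour in \<open>C \<union> T\<close>, it serves as
      \<open>u\<close> because \<open>T\<close> is a clique. Otherwise every vertex of
      \<open>T\<close> is adjacent to all others, and any vertex of \<open>C\<close> with a
      non-neighbour serves.\<close>
    have "\<exists>u\<in>C \<union> T. \<not> C \<union> T \<subseteq> clnbrs E u \<and> T \<subseteq> clnbrs E u"
    proof (cases "\<exists>u\<in>T. \<not> C \<union> T \<subseteq> clnbrs E u")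
      case True
      then obtain u where u: "u \<in> T" "\<not> C \<union> T \<subseteq> clnbrs E u" by blast
      then have "T \<subseteq> clnbrs E u" using clique by (auto simp: nbrs_def)
      then show ?thesis using u by blast
    next
      case False
      then obtain u where u: "u \<in> C" "\<not> C \<union> T \<subseteq> clnbrs E u" using True by blast
      have "T \<subseteq> clnbrs E u"
      proof
        fix t assume "t \<in> T"
        then have "u \<in> clnbrs E t" using False u by blast
        then show "t \<in> clnbrs E u" using nbrs_sym[of u E t] by auto
      qed
      then show ?thesis using u by blast
    qed
    then obtain u where u: "u \<in> C \<union> T" "\<not> C \<union> T \<subseteq> clnbrs E u" "T \<subseteq> clnbrs E u"
      by blast
    have "v \<notin> C \<union> T" using CD T(2)[of v] self_notin_nbrs[OF E2] D_def by auto
    then have "C \<union> T \<subset> W" using W' less.prems(3) by blast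
    then have "card (C \<union> T) < card W" using less.prems(1) by (rule psubset_card_mono[rotated])
    then obtain s where "s \<in> C \<union> T - clnbrs E u" "simplicial E (C \<union> T) s"
      using less.hyps[of "C \<union> T" u] u W' less.prems chordal_on_mono finite_subset by metis
    then show ?thesis using simplicial_lift u by blast
  qed
qed

text \<open>Isolated vertices are simplicial but have no neighbour to shed. Discarding them changes
  no neighbourhood of the remaining vertices, each of which has a neighbour.\<close>

lemma chordal_simplicial_nonisolated:
  assumes E2: "\<forall>e\<in>E. card e = 2" and "finite W" and "chordal_on E W" and "e \<in> E" "e \<subseteq> W"
  shows "\<exists>s v. simplicial E W s \<and> v \<in> W \<and> v \<in> nbrs E s"
proof -
  define W' where "W' = {w \<in> W. \<exists>u\<in>W. {u, w} \<in> E}"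
  have W': "W' \<subseteq> W" by (auto simp: W'_def)
  obtain a b where "e = {a, b}" using E2 assms(4) by (metis card_2_iff)
  then have aW: "a \<in> W'" using assms(4,5) by (auto simp: W'_def insert_commute)
  have "\<exists>s\<in>W'. simplicial E W' s"
  proof (cases "\<exists>v\<in>W'. \<not> W' \<subseteq> clnbrs E v")
    case True
    then show ?thesis
      using chordal_simplicial_nonneighbour[OF E2 finite_subset[OF W' assms(2)] chordal_on_mono[OF assms(3) W']]
      by blast
  next
    case False
    then have "{x, y} \<in> E" if "x \<in> W'" "y \<in> W'" "x \<noteq> y" for x y
      using that by (auto simp: nbrs_def)
    then have "simplicial E W' a" using aW by (auto simp: simplicial_def)
    then show ?thesis using aW by blast
  qed
  then obtain s where s: "s \<in> W'" "simplicial E W' s" by blast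
  have "W \<inter> nbrs E s = W' \<inter> nbrs E s" using s(1) by (auto simp: W'_def nbrs_def insert_commute)
  then have "simplicial E W s" using s W' by (auto simp: simplicial_def)
  then show ?thesis using s(1) by (auto simp: W'_def nbrs_def)
qed

text \<open>If \<open>s\<close> is simplicial and \<open>v\<close> is a neighbour of it, the closed
  neighbourhood of \<open>s\<close> within \<open>W\<close> is contained in that of
  \<open>v\<close>. An independent set avoiding the latter can therefore be enlarged by
  \<open>s\<close>.\<close>

lemma chordal_vertex_decomposable:
  assumes E2: "\<forall>e\<in>E. card e = 2" and "finite W" and "chordal_on E W"
  shows "vertex_decomposable (Ind_on E W)"
  using assms(2-)
proof (induction "card W" arbitrary: W rule: less_induct)
  case less
  show ?case
  proof (cases "\<exists>e\<in>E. e \<subseteq> W")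
    case False
    then show ?thesis using vertex_decomposable_no_edges less.prems by blast
  next
    case True
    then obtain s v where sv: "simplicial E W s" "v \<in> W" "v \<in> nbrs E s"
      using chordal_simplicial_nonisolated[OF E2 less.prems] by blast
    have smaller: "vertex_decomposable (Ind_on E W')" if "W' \<subseteq> W - {v}" for W'
    proof (rule less.hyps)
      show "card W' < card W" using that sv less.prems by (intro psubset_card_mono) auto
      show "finite W'" using that less.prems by (auto intro: finite_subset)
      show "chordal_on E W'" using that less.prems chordal_on_mono by (metis Diff_subset order_trans)
    qed
    show ?thesis
    proof (rule vertex_decomposable_indep_shed[OF E2 less.prems(1) sv(2)])
      show "vertex_decomposable (Ind_on E (W - {v}))" by (rule smaller) simp
      show "vertex_decomposable (Ind_on E (W - clnbrs E v))" by (rule smaller) auto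
      fix U assume U: "U \<in> Ind_on E (W - clnbrs E v)"
      have sv': "s \<in> W" "s \<noteq> v" "s \<in> nbrs E v"
        using sv self_notin_nbrs[OF E2] nbrs_sym[of s E v] by (auto simp: simplicial_def)
      have "\<not> e \<subseteq> insert s U" if "e \<in> E" for e
      proof
        assume e: "e \<subseteq> insert s U"
        have "s \<in> e" using e U that by (auto simp: Ind_def)
        then obtain u where u: "e = {u, s}" "u \<noteq> s" "u \<in> nbrs E s"
          using edge_of_two[OF E2 \<open>e \<in> E\<close>] by metis
        then have uU: "u \<in> U" "u \<in> W" "u \<noteq> v" "u \<notin> nbrs E v" using e U by (auto simp: Ind_def)
        then have "{u, v} \<in> E" using sv u by (auto simp: simplicial_def)
        then show False using uU by (simp add: nbrs_def)
      qed
      then have "insert s U \<in> Ind_on E (W - {v})" using U sv' by (auto simp: Ind_def)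
      moreover have "s \<notin> U" using U sv' by (auto simp: Ind_def)
      ultimately show "\<exists>w\<in>W - {v} - U. insert w U \<in> Ind_on E (W - {v})" using sv' by blast
    qed
  qed
qed

section \<open>Five-cycles\<close>

lemma four_le_card_cycle_edges:
  assumes "n \<ge> 4" shows "card (edges (cycle_graph n)) \<ge> 4"
proof -
  let ?e = "\<lambda>i. {i, (i + 1) mod n}"
  have "inj_on ?e {0..<4}"
  proof (rule linorder_inj_onI)
    fix i j :: nat assume "i < j" "i \<in> {0..<4}" "j \<in> {0..<4}"
    moreover then have "i + 1 < n" using assms by simp
    moreover have "j + 1 < n \<or> j = 3 \<and> n = 4" using calculation assms by auto
    ultimately show "?e i \<noteq> ?e j" by (auto simp: doubleton_eq_iff)
  qed auto
  then have "card (?e ` {0..<4}) = 4" by (simp add: card_image)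
  moreover have "?e ` {0..<4} \<subseteq> edges (cycle_graph n)"
    using assms by (auto simp: cycle_graph_def)
  moreover have "finite (edges (cycle_graph n))" by (simp add: cycle_graph_def)
  ultimately show ?thesis using card_mono[of "edges (cycle_graph n)" "?e ` {0..<4}"] by simp
qed

lemma chordal_on_few_edges:
  assumes "finite {e \<in> E. e \<subseteq> W}" "card {e \<in> E. e \<subseteq> W} < 4"
  shows "chordal_on E W"
  unfolding chordal_on_def
proof clarify
  fix U n assume U: "U \<subseteq> W" and n: "n \<ge> 4"
    and iso: "iso_cycle E U n"
  then obtain f :: "'a \<Rightarrow> nat" where f: "edges (cycle_graph n) = (\<lambda>e. f ` e) ` {e \<in> E. e \<subseteq> U}"
    unfolding graph_iso_def by auto
  have sub: "{e \<in> E. e \<subseteq> U} \<subseteq> {e \<in> E. e \<subseteq> W}" using U by auto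
  have "card (edges (cycle_graph n)) \<le> card {e \<in> E. e \<subseteq> U}"
    unfolding f using assms(1) sub by (intro card_image_le) (auto intro: finite_subset)
  also have "\<dots> \<le> card {e \<in> E. e \<subseteq> W}" using assms(1) sub by (rule card_mono)
  finally show False using four_le_card_cycle_edges[OF n] assms(2) by linarith
qed

definition C5_edges :: "(nat \<Rightarrow> 'b) \<Rightarrow> 'b set set" where
  "C5_edges c = (\<lambda>j. {c j, c ((j + 1) mod 5)}) ` {0..<5}"

lemma C5_edges_eq:
  "C5_edges c = {{c 0, c 1}, {c 1, c 2}, {c 2, c 3}, {c 3, c 4}, {c 4, c 0}}"
proof -
  have "{0..<5::nat} = {0, 1, 2, 3, 4}" by auto
  then show ?thesis by (simp add: C5_edges_def numeral_2_eq_2)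
qed

text \<open>At most three of the five edges avoid \<open>c i\<close>, whereas an induced cycle of
  length at least four has at least four edges.\<close>

lemma chordal_on_five_cycle_minus:
  assumes "{e \<in> E. e \<subseteq> W} \<subseteq> C5_edges c" "i < 5" "c i \<notin> W"
  shows "chordal_on E W"
proof -
  have *: "{e \<in> E. e \<subseteq> W} \<subseteq> {e \<in> C5_edges c. c i \<notin> e}" using assms by auto
  have i: "i = 0 \<or> i = 1 \<or> i = 2 \<or> i = 3 \<or> i = 4" using assms(2) by auto
  let ?A = "{{c ((i + 1) mod 5), c ((i + 2) mod 5)},
    {c ((i + 2) mod 5), c ((i + 3) mod 5)}, {c ((i + 3) mod 5), c ((i + 4) mod 5)}}"
  have "{e \<in> C5_edges c. c i \<notin> e} \<subseteq> ?A"
    using i by (elim disjE) (auto simp: C5_edges_eq insert_commute numeral_2_eq_2)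
  then have sub: "{e \<in> E. e \<subseteq> W} \<subseteq> ?A" using * by blast
  have A: "finite ?A" "card ?A \<le> 3" by (simp, rule card_insert_le_m1) (auto intro: card_insert_le_m1)
  show ?thesis
  proof (rule chordal_on_few_edges)
    show "finite {e \<in> E. e \<subseteq> W}" by (rule finite_subset[OF sub A(1)])
    show "card {e \<in> E. e \<subseteq> W} < 4" using card_mono[OF A(1) sub] A(2) by linarith
  qed
qed

text \<open>\<open>W\<close> may contain isolated vertices besides the cycle. An independent set
  avoiding \<open>c 0\<close> and its neighbours meets the cycle in at most one of the adjacent
  vertices \<open>c 2\<close> and \<open>c 3\<close>. If it contains \<open>c 2\<close>, then
  \<open>c 4\<close> can be added to it; if it contains \<open>c 3\<close>, then \<open>c 1\<close>
  can; if neither, then \<open>c 2\<close> can.\<close>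

lemma five_cycle_vertex_decomposable:
  assumes E2: "\<forall>e\<in>E. card e = 2" and fin: "finite W" and EW: "{e \<in> E. e \<subseteq> W} = C5_edges c"
    and inj: "inj_on c {0..<5}" and cW: "c ` {0..<5} \<subseteq> W"
  shows "vertex_decomposable (Ind_on E W)"
proof -
  have ch: "chordal_on E (W - {c 0})"
    using EW by (intro chordal_on_five_cycle_minus[of _ _ c 0]) auto
  have edge: "e \<in> C5_edges c" if "e \<in> E" "e \<subseteq> W" for e using EW that by blast
  have edgeE: "e \<in> E" if "e \<in> C5_edges c" for e using EW that by blast
  have nb: "c 1 \<in> nbrs E (c 0)" "c 4 \<in> nbrs E (c 0)"
    by (auto simp: nbrs_def C5_edges_eq insert_commute intro!: edgeE)
  have c23: "{c 2, c 3} \<in> E" by (rule edgeE) (simp add: C5_edges_eq)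
  have neq: "c i \<noteq> c j" if "i < 5" "j < 5" "i \<noteq> j" for i j
    using inj that by (auto dest: inj_onD)
  have W: "c i \<in> W" if "i < 5" for i using cW that by auto
  show ?thesis
  proof (rule vertex_decomposable_indep_shed[OF E2 fin W[of 0]])
    show "vertex_decomposable (Ind_on E (W - {c 0}))"
      by (rule chordal_vertex_decomposable[OF E2 _ ch]) (simp add: fin)
    show "vertex_decomposable (Ind_on E (W - clnbrs E (c 0)))"
      by (rule chordal_vertex_decomposable[OF E2 _ chordal_on_mono[OF ch]]) (auto simp: fin)
    fix U assume U: "U \<in> Ind_on E (W - clnbrs E (c 0))"
    have U0: "U \<subseteq> W" "c 0 \<notin> U" "c 1 \<notin> U" "c 4 \<notin> U" using U nb by (auto simp: Ind_def)
    have Ui: "\<And>e. e \<in> E \<Longrightarrow> \<not> e \<subseteq> U" using U by (auto simp: Ind_def)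
    have add: "insert w U \<in> Ind_on E (W - {c 0})"
      if w: "w \<in> W" "w \<noteq> c 0" "\<And>e. e \<in> C5_edges c \<Longrightarrow> w \<in> e \<Longrightarrow> \<not> e \<subseteq> insert w U" for w
    proof -
      have "\<not> e \<subseteq> insert w U" if "e \<in> E" for e
        using Ui[OF that] w(3)[of e] edge[OF that] U0(1) w(1) by blast
      then show ?thesis using w U0 by (auto simp: Ind_def)
    qed
    have n: "c 1 \<noteq> c 0" "c 2 \<noteq> c 0" "c 3 \<noteq> c 0" "c 4 \<noteq> c 0" "c 1 \<noteq> c 2" "c 1 \<noteq> c 3" "c 1 \<noteq> c 4"
       "c 2 \<noteq> c 3" "c 2 \<noteq> c 4" "c 3 \<noteq> c 4"
      by (rule neq; simp)+
    consider "c 2 \<in> U" "c 3 \<notin> U" | "c 3 \<in> U" "c 2 \<notin> U" | "c 2 \<notin> U" "c 3 \<notin> U"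
      using Ui[OF c23] by blast
    then show "\<exists>w\<in>W - {c 0} - U. insert w U \<in> Ind_on E (W - {c 0})"
    proof cases
      case 1
      have "insert (c 4) U \<in> Ind_on E (W - {c 0})"
        using 1 U0 W n by (intro add) (auto simp: C5_edges_eq)
      then show ?thesis using U0 W n by (intro bexI[of _ "c 4"]) auto
    next
      case 2
      have "insert (c 1) U \<in> Ind_on E (W - {c 0})"
        using 2 U0 W n by (intro add) (auto simp: C5_edges_eq)
      then show ?thesis using U0 W n by (intro bexI[of _ "c 1"]) auto
    next
      case 3
      have "insert (c 2) U \<in> Ind_on E (W - {c 0})"
        using 3 U0 W n by (intro add) (auto simp: C5_edges_eq)
      then show ?thesis using 3 U0 W n by (intro bexI[of _ "c 2"]) auto
    qed
  qed simp
qed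

lemma graph_iso_five_cycleE:
  assumes "graph_iso (induced_subgraph G A) (cycle_graph 5)"
  obtains c where "inj_on c {0..<5}" "c ` {0..<5} = A" "{e \<in> edges G. e \<subseteq> A} = C5_edges c"
proof -
  obtain f where f: "bij_betw f A {0..<5}"
    and e: "edges (cycle_graph 5) = (\<lambda>e. f ` e) ` {e \<in> edges G. e \<subseteq> A}"
    using assms by (auto simp: graph_iso_def induced_subgraph_def cycle_graph_def)
  define c where "c = the_inv_into A f"
  have c: "bij_betw c {0..<5} A" unfolding c_def by (rule bij_betw_the_inv_into[OF f])
  have cf: "c (f x) = x" if "x \<in> A" for x
    using f that by (simp add: c_def bij_betw_def the_inv_into_f_f)
  have cf': "c ` f ` e = e" if "e \<subseteq> A" for e
    using that cf by (force simp: image_image)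
  have "{e \<in> edges G. e \<subseteq> A} = (\<lambda>e. c ` e) ` edges (cycle_graph 5)"
    unfolding e image_image[of "\<lambda>e. c ` e" "\<lambda>e. f ` e"] using cf' by simp
  also have "\<dots> = C5_edges c"
    unfolding C5_edges_def cycle_graph_def by (simp add: setcompr_eq_image image_image lessThan_def[symmetric] atLeast0LessThan)
  finally show ?thesis using that[of c] c by (auto simp: bij_betw_def)
qed

section \<open>Whiskered graphs\<close>

lemma card_whisker_edge:
  assumes "finite_simple_graph G" "e \<in> edges (whisker G S)" shows "card e = 2"
proof -
  have "card (Inl ` e' :: ('a + 'a) set) = 2" if "e' \<in> edges G" for e'
    using assms(1) that by (simp add: finite_simple_graph_def card_image)
  then show ?thesis using assms(2) by (auto simp: whisker_def)
qed

lemma finite_simple_graph_whisker: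
  assumes "finite_simple_graph G" "S \<subseteq> vertices G"
  shows "finite_simple_graph (whisker G S)"
proof -
  have "finite (vertices (whisker G S))"
    using assms by (auto simp: whisker_def finite_simple_graph_def intro: finite_subset)
  moreover have "e \<subseteq> vertices (whisker G S)" if "e \<in> edges (whisker G S)" for e
    using that assms by (auto simp: whisker_def finite_simple_graph_def) blast+
  ultimately show ?thesis
    using card_whisker_edge[OF assms(1)] by (simp add: finite_simple_graph_def)
qed

text \<open>This keeps isolated vertices out of induced cycles, in particular the leaves whose
  whiskered vertex is gone.\<close>

lemma cycle_graph_vertex_in_edge:
  assumes "iso_cycle E U n" "u \<in> U"
  shows "\<exists>e\<in>E. e \<subseteq> U \<and> u \<in> e"
proof -
  obtain f where f: "bij_betw f U {0..<n}"
    and e: "edges (cycle_graph n) = (\<lambda>e. f ` e) ` {e \<in> E. e \<subseteq> U}"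
    using assms(1) by (auto simp: graph_iso_def cycle_graph_def)
  have "f u < n" using f assms(2) by (auto simp: bij_betw_def)
  then have "{f u, (f u + 1) mod n} \<in> edges (cycle_graph n)" by (auto simp: cycle_graph_def)
  then obtain e where "e \<in> E" "e \<subseteq> U" and im: "{f u, (f u + 1) mod n} = f ` e" using e by auto
  moreover have "f u \<in> f ` e" unfolding im[symmetric] by simp
  ultimately have e: "e \<in> E" "e \<subseteq> U" "f u \<in> f ` e" by auto
  then have "u \<in> e" using f assms(2) by (auto simp: bij_betw_def dest: inj_onD)
  then show ?thesis using e by blast
qed

text \<open>Once the vertices of \<open>S\<close> are gone, their leaves are isolated. An induced
  cycle then lives on the \<open>Inl\<close> copy of \<open>G\<close> and pulls back to an induced
  cycle outside \<open>S\<close>.\<close>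

lemma chordal_on_whisker:
  assumes ch: "chordal_on (edges G) (vertices G - S)"
    and W: "W \<subseteq> vertices (whisker G S)" "\<And>x. x \<in> S \<Longrightarrow> Inl x \<notin> W"
  shows "chordal_on (edges (whisker G S)) W"
  unfolding chordal_on_def
proof clarify
  let ?E = "edges (whisker G S)"
  fix U n assume U: "U \<subseteq> W" and n: "n \<ge> 4"
    and iso: "iso_cycle ?E U n"
  define U' where "U' = {x. Inl x \<in> U}"
  have edge: "\<exists>e'\<in>edges G. e = Inl ` e'" if "e \<in> ?E" "e \<subseteq> U" for e
    using that U W by (auto simp: whisker_def)
  have UU': "U = Inl ` U'"
  proof (intro equalityI subsetI)
    fix u assume "u \<in> U"
    then obtain e where "e \<in> ?E" "e \<subseteq> U" "u \<in> e" using cycle_graph_vertex_in_edge[OF iso] by blast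
    then show "u \<in> Inl ` U'" using edge[of e] by (auto simp: U'_def)
  qed (auto simp: U'_def)
  have "U' \<subseteq> vertices G - S" using U W by (auto simp: U'_def whisker_def)
  moreover obtain f where f: "bij_betw f U {0..<n}"
    and e: "edges (cycle_graph n) = (\<lambda>e. f ` e) ` {e \<in> ?E. e \<subseteq> U}"
    using iso by (auto simp: graph_iso_def cycle_graph_def)
  have eq: "{e \<in> ?E. e \<subseteq> U} = (\<lambda>e. Inl ` e) ` {e \<in> edges G. e \<subseteq> U'}"
  proof (intro equalityI subsetI)
    fix e assume e: "e \<in> {e \<in> ?E. e \<subseteq> U}"
    then obtain e' where "e' \<in> edges G" "e = Inl ` e'" using edge by blast
    moreover then have "e' \<subseteq> U'" using e by (auto simp: U'_def)
    ultimately show "e \<in> (\<lambda>e. Inl ` e) ` {e \<in> edges G. e \<subseteq> U'}" by blast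
  next
    fix e :: "('a + 'a) set" assume "e \<in> (\<lambda>e. Inl ` e) ` {e \<in> edges G. e \<subseteq> U'}"
    then show "e \<in> {e \<in> ?E. e \<subseteq> U}" by (auto simp: whisker_def U'_def)
  qed
  have "edges (cycle_graph n) = (\<lambda>e. (f \<circ> Inl) ` e) ` {e \<in> edges G. e \<subseteq> U'}"
    unfolding e eq by (simp add: image_image image_comp)
  moreover have "bij_betw (f \<circ> Inl) U' {0..<n}"
    using f unfolding UU' by (intro bij_betw_trans[of Inl U' "Inl ` U'"]) (auto simp: bij_betw_def)
  moreover have "vertices (cycle_graph n) = {0..<n}" by (simp add: cycle_graph_def)
  ultimately have "iso_cycle (edges G) U' n"
    unfolding graph_iso_def by auto
  then show False using ch n \<open>U' \<subseteq> vertices G - S\<close> unfolding chordal_on_def by blast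
qed

text \<open>In the five-cycle case \<open>W\<close> either contains the whole cycle, possibly with
  isolated leaves, or misses one of its vertices and is then chordal.\<close>

lemma vertex_decomposable_whisker_base:
  assumes G: "finite_simple_graph G" "S \<subseteq> vertices G"
    and hyp: "chordal (induced_subgraph G (vertices G - S)) \<or>
         graph_iso (induced_subgraph G (vertices G - S)) (cycle_graph 5)"
    and W: "W \<subseteq> vertices (whisker G S)" "\<And>x. x \<in> S \<Longrightarrow> Inl x \<notin> W"
  shows "vertex_decomposable (Ind_on (edges (whisker G S)) W)"
proof -
  let ?E = "edges (whisker G S)"
  have E2: "\<forall>e\<in>?E. card e = 2" using card_whisker_edge[OF G(1)] by blast
  have fin: "finite W"
    using finite_simple_graph_whisker[OF G] W(1) by (auto simp: finite_simple_graph_def intro: finite_subset)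
  note cvd = chordal_vertex_decomposable[OF E2 fin]
  show ?thesis
    using hyp
  proof
    assume "chordal (induced_subgraph G (vertices G - S))"
    then show ?thesis using cvd chordal_on_whisker W by (metis chordal_induced_subgraph)
  next
    assume "graph_iso (induced_subgraph G (vertices G - S)) (cycle_graph 5)"
    then obtain c where c: "inj_on c {0..<5}" "c ` {0..<5} = vertices G - S"
      "{e \<in> edges G. e \<subseteq> vertices G - S} = C5_edges c" by (rule graph_iso_five_cycleE)
    have im: "C5_edges (Inl \<circ> c :: nat \<Rightarrow> 'a + 'a) = (\<lambda>e. Inl ` e) ` C5_edges c"
      by (simp add: C5_edges_eq)
    have sub: "{e \<in> ?E. e \<subseteq> W} \<subseteq> C5_edges (Inl \<circ> c)"
    proof
      fix e assume e: "e \<in> {e \<in> ?E. e \<subseteq> W}"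
      then obtain e' where e': "e' \<in> edges G" "e = Inl ` e'" using W(2) by (auto simp: whisker_def)
      have "e' \<subseteq> vertices G - S"
        using e e' W(2) G(1) by (auto simp: finite_simple_graph_def)
      then show "e \<in> C5_edges (Inl \<circ> c)" using e' c(3) im by blast
    qed
    show ?thesis
    proof (cases "\<exists>i<5. Inl (c i) \<notin> W")
      case True
      then show ?thesis using cvd chordal_on_five_cycle_minus[OF sub] by auto
    next
      case False
      show ?thesis
      proof (rule five_cycle_vertex_decomposable[OF E2 fin, of "Inl \<circ> c"])
        show "inj_on (Inl \<circ> c) {0..<5}" using c(1) by (simp add: inj_on_def)
        show cW: "(Inl \<circ> c) ` {0..<5} \<subseteq> W" using False by auto
        have "C5_edges (Inl \<circ> c) \<subseteq> {e \<in> ?E. e \<subseteq> W}"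
        proof
          fix e assume "e \<in> C5_edges (Inl \<circ> c :: nat \<Rightarrow> 'a + 'a)"
          then obtain e' where e': "e' \<in> C5_edges c" "e = Inl ` e'" using im by auto
          then have "e' \<in> edges G" "e' \<subseteq> c ` {0..<5}" using c by auto
          then show "e \<in> {e \<in> ?E. e \<subseteq> W}" using e' cW by (auto simp: whisker_def)
        qed
        then show "{e \<in> ?E. e \<subseteq> W} = C5_edges (Inl \<circ> c)" using sub by blast
      qed
    qed
  qed
qed

lemma nbrs_whisker:
  assumes "x \<in> S"
  shows "Inr z \<in> nbrs (edges (whisker G S)) (Inl x) \<longleftrightarrow> z = x"
  using assms by (auto simp: nbrs_def whisker_def doubleton_eq_iff)

text \<open>Deletion and link must stay within one class of vertex sets. The invariant is that every
  surviving vertex of \<open>S\<close> still has its leaf: the neighbourhood of \<open>Inl x\<close>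
  contains no leaf but that of \<open>x\<close>, and \<open>Inl x\<close> itself disappears with it.
  The induction is on the number of surviving vertices of \<open>S\<close>.\<close>

lemma vertex_decomposable_whisker_sub:
  assumes G: "finite_simple_graph G" "S \<subseteq> vertices G"
    and hyp: "chordal (induced_subgraph G (vertices G - S)) \<or>
         graph_iso (induced_subgraph G (vertices G - S)) (cycle_graph 5)"
    and W: "W \<subseteq> vertices (whisker G S)" "\<And>x. x \<in> S \<Longrightarrow> Inl x \<in> W \<Longrightarrow> Inr x \<in> W"
  shows "vertex_decomposable (Ind_on (edges (whisker G S)) W)"
  using W
proof (induction "card {x \<in> S. Inl x \<in> W}" arbitrary: W rule: less_induct)
  case less
  let ?E = "edges (whisker G S)"
  have E2: "\<forall>e\<in>?E. card e = 2" using card_whisker_edge[OF G(1)] by blast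
  have fS: "finite S" using G by (auto simp: finite_simple_graph_def intro: finite_subset)
  show ?case
  proof (cases "\<exists>x\<in>S. Inl x \<in> W")
    case False
    then show ?thesis using vertex_decomposable_whisker_base[OF G hyp less.prems(1)] by blast
  next
    case True
    then obtain x where x: "x \<in> S" "Inl x \<in> W" by blast
    have fin: "finite W"
      using finite_simple_graph_whisker[OF G] less.prems(1)
      by (auto simp: finite_simple_graph_def intro: finite_subset)
    have smaller: "vertex_decomposable (Ind_on ?E W')"
      if W': "W' \<subseteq> W - {Inl x}" "\<And>z. z \<in> S \<Longrightarrow> Inl z \<in> W' \<Longrightarrow> Inr z \<in> W'" for W'
    proof (rule less.hyps)
      show "card {x \<in> S. Inl x \<in> W'} < card {x \<in> S. Inl x \<in> W}"
        using W'(1) x fS by (intro psubset_card_mono) auto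
      show "W' \<subseteq> vertices (whisker G S)" using W' less.prems by blast
      show "Inr z \<in> W'" if "z \<in> S" "Inl z \<in> W'" for z using W'(2) that .
    qed
    show ?thesis
    proof (rule vertex_decomposable_indep_shed[OF E2 fin x(2)])
      show "vertex_decomposable (Ind_on ?E (W - {Inl x}))"
        using less.prems(2) by (intro smaller) auto
      show "vertex_decomposable (Ind_on ?E (W - clnbrs ?E (Inl x)))"
        using less.prems(2) nbrs_whisker[OF x(1), of _ G] by (intro smaller) auto
      fix U assume U: "U \<in> Ind_on ?E (W - clnbrs ?E (Inl x))"
      have y: "Inr x \<in> W" "Inr x \<notin> U" "Inl x \<notin> U" "U \<subseteq> W"
        using less.prems(2) x U nbrs_whisker[OF x(1), of x G] by (auto simp: Ind_def)
      have "\<not> e \<subseteq> insert (Inr x) U" if "e \<in> ?E" for e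
      proof
        assume e: "e \<subseteq> insert (Inr x) U"
        have "Inr x \<in> e" using e U that by (auto simp: Ind_def)
        then have "Inl x \<in> e" using that by (auto simp: whisker_def)
        then show False using e y by auto
      qed
      then have "insert (Inr x) U \<in> Ind_on ?E (W - {Inl x})" using y by (auto simp: Ind_def)
      then show "\<exists>w\<in>W - {Inl x} - U. insert w U \<in> Ind_on ?E (W - {Inl x})"
        using y by (intro bexI[of _ "Inr x"]) auto
    qed
  qed
qed

theorem vertex_decomposable_whisker:
  assumes G: "finite_simple_graph G" "S \<subseteq> vertices G"
    and hyp: "chordal (induced_subgraph G (vertices G - S)) \<or>
         graph_iso (induced_subgraph G (vertices G - S)) (cycle_graph 5)"
  shows "vertex_decomposable (Ind (whisker G S))"
proof -
  have "vertex_decomposable (Ind_on (edges (whisker G S)) (vertices (whisker G S)))"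
    by (rule vertex_decomposable_whisker_sub[OF G hyp]) (auto simp: whisker_def)
  then show ?thesis by (subst Ind_eq)
qed

section \<open>Weakly regular sequences\<close>

abbreviation keys :: "('x \<Rightarrow>\<^sub>0 'y::zero) \<Rightarrow> 'x set" where "keys \<equiv> Poly_Mapping.keys"
abbreviation lookup :: "('x \<Rightarrow>\<^sub>0 'y::zero) \<Rightarrow> 'x \<Rightarrow> 'y" where "lookup \<equiv> Poly_Mapping.lookup"
abbreviation single :: "'x \<Rightarrow> 'y \<Rightarrow> ('x \<Rightarrow>\<^sub>0 'y::zero)" where "single \<equiv> Poly_Mapping.single"

text \<open>With \<open>A\<close> the polynomial ring these are its submodules; the arguments on
  sequences take for \<open>A\<close> just the set of entries.\<close>

definition stable :: "'r::comm_ring_1 set \<Rightarrow> 'r set \<Rightarrow> bool" where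
  "stable A L \<longleftrightarrow> 0 \<in> L \<and> (\<forall>p\<in>L. \<forall>q\<in>L. p - q \<in> L) \<and> (\<forall>f\<in>A. \<forall>p\<in>L. f * p \<in> L)"

text \<open>Killing \<open>f\<close> on \<open>L / K\<close> leaves \<open>L\<close> alone and
  enlarges \<open>K\<close>, so iterated quotients remain pairs of subsets of one ring.\<close>

definition ext_by :: "'r::comm_ring_1 set \<Rightarrow> 'r set \<Rightarrow> 'r \<Rightarrow> 'r set" where
  "ext_by L K f = {k + f * l | k l. k \<in> K \<and> l \<in> L}"

text \<open>\<open>wregular fs L K\<close> says that \<open>fs\<close> is a weakly regular sequence on \<open>L / K\<close>.\<close>

fun wregular :: "'r::comm_ring_1 list \<Rightarrow> 'r set \<Rightarrow> 'r set \<Rightarrow> bool" where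
  "wregular [] L K \<longleftrightarrow> True"
| "wregular (f # fs) L K \<longleftrightarrow>
     (\<forall>p\<in>L. f * p \<in> K \<longrightarrow> p \<in> K) \<and> wregular fs L (ext_by L K f)"

lemma stableD:
  assumes "stable A L"
  shows "0 \<in> L" "p \<in> L \<Longrightarrow> q \<in> L \<Longrightarrow> p - q \<in> L" "p \<in> L \<Longrightarrow> q \<in> L \<Longrightarrow> p + q \<in> L"
    "p \<in> L \<Longrightarrow> - p \<in> L" "f \<in> A \<Longrightarrow> p \<in> L \<Longrightarrow> f * p \<in> L"
proof -
  show 0: "0 \<in> L" and minus: "\<And>p q. p \<in> L \<Longrightarrow> q \<in> L \<Longrightarrow> p - q \<in> L" and "f \<in> A \<Longrightarrow> p \<in> L \<Longrightarrow> f * p \<in> L"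
    using assms by (auto simp: stable_def)
  show um: "- p \<in> L" if "p \<in> L" for p using minus[OF 0 that] by simp
  show "p \<in> L \<Longrightarrow> q \<in> L \<Longrightarrow> p + q \<in> L" using minus[of p "- q"] um by simp
qed

lemma stable_mono: "stable A L \<Longrightarrow> B \<subseteq> A \<Longrightarrow> stable B L"
  by (auto simp: stable_def)

lemma ext_byI: "k \<in> K \<Longrightarrow> l \<in> L \<Longrightarrow> k + f * l \<in> ext_by L K f"
  by (auto simp: ext_by_def)

lemma stable_ext_by:
  assumes "stable A L" "stable A K"
  shows "stable A (ext_by L K f)"
  unfolding stable_def
proof (intro conjI ballI)
  show "0 \<in> ext_by L K f"
    using ext_byI[of 0 K 0 L f] stableD(1)[OF assms(1)] stableD(1)[OF assms(2)] by simp
next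
  fix p q assume "p \<in> ext_by L K f" "q \<in> ext_by L K f"
  then obtain k l k' l' where *: "p = k + f * l" "q = k' + f * l'" "k \<in> K" "k' \<in> K" "l \<in> L" "l' \<in> L"
    by (auto simp: ext_by_def)
  then have "p - q = (k - k') + f * (l - l')" by (simp add: algebra_simps)
  then show "p - q \<in> ext_by L K f"
    using * ext_byI stableD(2)[OF assms(1)] stableD(2)[OF assms(2)] by metis
next
  fix g p assume g: "g \<in> A" and "p \<in> ext_by L K f"
  then obtain k l where *: "p = k + f * l" "k \<in> K" "l \<in> L" by (auto simp: ext_by_def)
  then have "g * p = g * k + f * (g * l)" by (simp add: algebra_simps)
  then show "g * p \<in> ext_by L K f"
    using * g ext_byI stableD(5)[OF assms(1)] stableD(5)[OF assms(2)] by metis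
qed

lemma ext_by_superset: "0 \<in> L \<Longrightarrow> K \<subseteq> ext_by L K f"
  using ext_byI[of _ K 0 L f] by fastforce

lemma ext_by_subset:
  assumes "stable {f} L" "K \<subseteq> L" shows "ext_by L K f \<subseteq> L"
  using assms(2) stableD(3,5)[OF assms(1)] by (auto simp: ext_by_def)

text \<open>Transport along an isomorphism from \<open>L1 / K1\<close> to \<open>L2 / K2\<close>
  given on representatives by \<open>h\<close>. Killing an element on both sides preserves the
  situation, so the induction keeps \<open>h\<close> and changes \<open>K1\<close> and
  \<open>K2\<close>. It is applied to the identity and to multiplication by a monomial.\<close>

lemma wregular_iso:
  assumes "stable (set fs) L1" "stable (set fs) L2" "stable (set fs) K1" "stable (set fs) K2"
    and "K1 \<subseteq> L1" "K2 \<subseteq> L2"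
    and add: "\<And>p q. p \<in> L1 \<Longrightarrow> q \<in> L1 \<Longrightarrow> h (p + q) = h p + h q"
    and mult: "\<And>f p. f \<in> set fs \<Longrightarrow> p \<in> L1 \<Longrightarrow> h (f * p) = f * h p"
    and into: "\<And>p. p \<in> L1 \<Longrightarrow> h p \<in> L2"
    and surj: "\<And>q. q \<in> L2 \<Longrightarrow> \<exists>p\<in>L1. q - h p \<in> K2"
    and ker: "\<And>p. p \<in> L1 \<Longrightarrow> h p \<in> K2 \<longleftrightarrow> p \<in> K1"
    and reg: "wregular fs L1 K1"
  shows "wregular fs L2 K2"
  using assms
proof (induction fs arbitrary: K1 K2)
  case Nil
  show ?case by simp
next
  case (Cons f fs)
  note L1 = stableD[OF Cons.prems(1)] and L2 = stableD[OF Cons.prems(2)]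
    and K1 = stableD[OF Cons.prems(3)] and K2 = stableD[OF Cons.prems(4)]
  note sub = Cons.prems(5,6) and add = Cons.prems(7) and mult = Cons.prems(8)
    and into = Cons.prems(9) and surj = Cons.prems(10) and ker = Cons.prems(11)
  have mono: "stable (set (f # fs)) X \<Longrightarrow> stable (set fs) X" for X
    by (erule stable_mono) auto
  have f: "f \<in> set (f # fs)" by simp
  have nzd: "q \<in> K2" if q: "q \<in> L2" "f * q \<in> K2" for q
  proof -
    obtain p where p: "p \<in> L1" "q - h p \<in> K2" using surj[OF q(1)] by blast
    have "f * q - f * (q - h p) = f * h p" by (simp add: algebra_simps)
    then have "h (f * p) \<in> K2" using K2(2)[OF q(2) K2(5)[OF f p(2)]] mult[OF f p(1)] by simp
    then have "f * p \<in> K1" using ker L1(5)[OF f p(1)] by blast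
    then have "h p \<in> K2" using Cons.prems(12) p ker by auto
    then show ?thesis using K2(3)[OF p(2), of "h p"] by simp
  qed
  have "wregular fs L2 (ext_by L2 K2 f)"
  proof (rule Cons.IH[of "ext_by L1 K1 f" "ext_by L2 K2 f"])
    show "stable (set fs) L1" "stable (set fs) L2" using Cons.prems mono by blast+
    show "stable (set fs) (ext_by L1 K1 f)" "stable (set fs) (ext_by L2 K2 f)"
      using Cons.prems mono stable_ext_by by blast+
    show "ext_by L1 K1 f \<subseteq> L1" "ext_by L2 K2 f \<subseteq> L2"
      using ext_by_subset[OF stable_mono[OF Cons.prems(1)] sub(1), of f]
        ext_by_subset[OF stable_mono[OF Cons.prems(2)] sub(2), of f] by simp_all
    show "\<exists>p\<in>L1. q - h p \<in> ext_by L2 K2 f" if "q \<in> L2" for q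
      using surj[OF that] ext_by_superset[OF L2(1)] by blast
    show "h p \<in> ext_by L2 K2 f \<longleftrightarrow> p \<in> ext_by L1 K1 f" if p: "p \<in> L1" for p
    proof
      assume "p \<in> ext_by L1 K1 f"
      then obtain k l where *: "p = k + f * l" "k \<in> K1" "l \<in> L1" by (auto simp: ext_by_def)
      then have "h p = h k + f * h l" using add mult[OF f] L1(5)[OF f] sub by auto
      moreover have "h k \<in> K2" using * ker sub by blast
      ultimately show "h p \<in> ext_by L2 K2 f" using ext_byI into *(3) by metis
    next
      assume "h p \<in> ext_by L2 K2 f"
      then obtain k q where *: "h p = k + f * q" "k \<in> K2" "q \<in> L2" by (auto simp: ext_by_def)
      obtain l where l: "l \<in> L1" "q - h l \<in> K2" using surj[OF *(3)] by blast
      have fl: "f * l \<in> L1" using L1(5)[OF f l(1)] .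
      have pl: "p - f * l \<in> L1" using L1(2)[OF p fl] .
      have "h p = h (p - f * l) + f * h l"
        using add[OF pl fl] mult[OF f l(1)] by simp
      then have "h (p - f * l) = k + f * (q - h l)" using * by (simp add: algebra_simps)
      then have "h (p - f * l) \<in> K2" using K2(3)[OF *(2) K2(5)[OF f l(2)]] by simp
      then have "p - f * l \<in> K1" using ker pl by blast
      then have "(p - f * l) + f * l \<in> ext_by L1 K1 f" using l(1) by (rule ext_byI)
      then show "p \<in> ext_by L1 K1 f" by simp
    qed
  qed (use add mult into Cons.prems(12) in auto)
  then show ?case using nzd by simp
qed

text \<open>Exactness of \<open>0 \<rightarrow> J / I \<rightarrow> L / I \<rightarrow> L / J \<rightarrow> 0\<close> survives division by a nonzerodivisor on \<open>L / J\<close>.\<close>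

lemma wregular_trans:
  assumes "stable (set fs) L" "stable (set fs) J" "stable (set fs) I"
    and "I \<subseteq> J" "J \<subseteq> L" "wregular fs J I" "wregular fs L J"
  shows "wregular fs L I"
  using assms
proof (induction fs arbitrary: I J)
  case Nil
  show ?case by simp
next
  case (Cons f fs)
  note L = stableD[OF Cons.prems(1)] and J = stableD[OF Cons.prems(2)]
    and I = stableD[OF Cons.prems(3)] and sub = Cons.prems(4,5)
  have mono: "stable (set (f # fs)) X \<Longrightarrow> stable (set fs) X" for X
    by (erule stable_mono) auto
  have monof: "stable (set (f # fs)) X \<Longrightarrow> stable {f} X" for X
    by (erule stable_mono) auto
  have f: "f \<in> set (f # fs)" by simp
  have nzdJ: "p \<in> J" if "p \<in> L" "f * p \<in> J" for p using Cons.prems(7) that by auto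
  have nzdI: "p \<in> I" if "p \<in> J" "f * p \<in> I" for p using Cons.prems(6) that by auto
  \<comment> \<open>The inclusion of \<open>J\<close> induces an isomorphism from
    \<open>J / (I + f J)\<close> to \<open>(J + f L) / (I + f L)\<close>. Injectivity uses that
    \<open>f\<close> is a nonzerodivisor on \<open>L / J\<close>: if \<open>f * l\<close> lies in
    \<open>J\<close>, so does \<open>l\<close>.\<close>
  have iJ: "wregular fs (ext_by L J f) (ext_by L I f)"
  proof (rule wregular_iso[where h = id and ?L1.0 = J and ?K1.0 = "ext_by J I f"])
    show "stable (set fs) J" "stable (set fs) (ext_by L J f)"
      "stable (set fs) (ext_by J I f)" "stable (set fs) (ext_by L I f)"
      using Cons.prems(1-3)[THEN mono] stable_ext_by by blast+
    show "ext_by J I f \<subseteq> J" using Cons.prems(2)[THEN monof] sub(1) by (rule ext_by_subset)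
    show "ext_by L I f \<subseteq> ext_by L J f" using sub by (auto simp: ext_by_def)
    show "id p \<in> ext_by L J f" if "p \<in> J" for p
      using ext_by_superset[OF L(1)] that by auto
    show "\<exists>p\<in>J. q - id p \<in> ext_by L I f" if q: "q \<in> ext_by L J f" for q
    proof -
      obtain j l where "q = j + f * l" "j \<in> J" "l \<in> L" using q by (auto simp: ext_by_def)
      then show ?thesis using ext_byI[OF I(1), of l L f] by (intro bexI[of _ j]) auto
    qed
    show "id p \<in> ext_by L I f \<longleftrightarrow> p \<in> ext_by J I f" if p: "p \<in> J" for p
    proof
      assume "id p \<in> ext_by L I f"
      then obtain i l where *: "p = i + f * l" "i \<in> I" "l \<in> L" by (auto simp: ext_by_def)
      then have "f * l \<in> J" using J(2)[OF p, of i] sub by auto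
      then have "l \<in> J" using nzdJ * by blast
      then show "p \<in> ext_by J I f" using * ext_byI by blast
    next
      assume "p \<in> ext_by J I f"
      then show "id p \<in> ext_by L I f" using sub by (auto simp: ext_by_def)
    qed
    show "wregular fs J (ext_by J I f)" using Cons.prems(6) by simp
  qed auto
  have "wregular fs L (ext_by L I f)"
  proof (rule Cons.IH[of "ext_by L J f"])
    show "stable (set fs) L" "stable (set fs) (ext_by L J f)" "stable (set fs) (ext_by L I f)"
      using Cons.prems(1-3)[THEN mono] stable_ext_by by blast+
    show "ext_by L I f \<subseteq> ext_by L J f" using sub by (auto simp: ext_by_def)
    show "ext_by L J f \<subseteq> L" using Cons.prems(1)[THEN monof] sub(2) by (rule ext_by_subset)
    show "wregular fs L (ext_by L J f)" using Cons.prems(7) by simp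
  qed (rule iJ)
  moreover have "p \<in> I" if "p \<in> L" "f * p \<in> I" for p
    using nzdI nzdJ that sub by blast
  ultimately show ?case by simp
qed

lemma wregular_trivial:
  assumes "stable (set fs) L" shows "wregular fs L L"
  using assms
proof (induction fs)
  case (Cons f fs)
  have "ext_by L L f = L"
    using ext_by_superset[of L L f] ext_by_subset[of f L L] Cons.prems stableD(1)
    by (metis stable_mono equalityI insert_mono list.set(2) order_refl empty_subsetI)
  then show ?case using Cons by (auto intro: stable_mono)
qed simp

text \<open>Links the recursion with the indexed successive quotients of
  \<open>regular_sequence\<close>.\<close>

lemma wregular_nth:
  assumes "wregular fs L K" "i < length fs" "p \<in> L" "fs ! i * p \<in> foldl (ext_by L) K (take i fs)"
  shows "p \<in> foldl (ext_by L) K (take i fs)"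
  using assms
proof (induction fs arbitrary: K i)
  case (Cons f fs)
  then show ?case by (cases i) auto
qed simp

section \<open>Monomial spans\<close>

text \<open>The ideals of the filtration are spanned by monomials, so membership becomes a condition
  on each single element of \<open>keys\<close>.\<close>

definition mspan :: "('v \<Rightarrow>\<^sub>0 nat) set \<Rightarrow> ('v, 'k::field) mpoly set" where
  "mspan A = {p. keys p \<subseteq> A}"

abbreviation polys :: "'v set \<Rightarrow> ('v, 'k::field) mpoly set" where
  "polys V \<equiv> mspan {m. keys m \<subseteq> V}"

text \<open>The span of \<open>nonfaces V \<F>\<close> is the Stanley--Reisner ideal of the complex on \<open>V\<close> generated by \<open>\<F>\<close>.\<close>

definition nonfaces :: "'v set \<Rightarrow> 'v set set \<Rightarrow> ('v \<Rightarrow>\<^sub>0 nat) set" where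
  "nonfaces V \<F> = {m. keys m \<subseteq> V \<and> \<not> (\<exists>F\<in>\<F>. keys m \<subseteq> F)}"

abbreviation sr_ideal :: "'v set \<Rightarrow> 'v set set \<Rightarrow> ('v, 'k::field) mpoly set" where
  "sr_ideal V \<F> \<equiv> mspan (nonfaces V \<F>)"

lemma keys_add_nat: "keys (a + b :: 'v \<Rightarrow>\<^sub>0 nat) = keys a \<union> keys b"
  by (auto simp: in_keys_iff lookup_add)

lemma keys_mult_elem:
  assumes "m \<in> keys (p * q :: ('v, 'k::field) mpoly)"
  obtains a b where "a \<in> keys p" "b \<in> keys q" "m = a + b"
  using assms keys_mult[of p q] by blast

lemma lookup_mult_single: "lookup (single a 1 * p :: ('v, 'k::field) mpoly) (a + b) = lookup p b"
proof -
  have "lookup (single a 1 * p) (a + b) = (\<Sum>l. lookup (single a 1) l * (\<Sum>q. lookup p q when a + b = l + q))"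
    by (simp add: lookup_mult)
  also have "\<dots> = (\<Sum>l. (\<Sum>q. lookup p q when a + b = l + q) when l = a)"
    by (rule Sum_any.cong) (simp add: lookup_single when_def)
  also have "\<dots> = (\<Sum>q. lookup p q when b = q)" by simp
  also have "\<dots> = lookup p b" by simp
  finally show ?thesis .
qed

lemma lookup_scale: "lookup (single 0 c * p :: ('v, 'k::field) mpoly) m = c * lookup p m"
  by (simp flip: mult_map_scale_conv_mult add: map.rep_eq when_def)

lemma poly_mapping_sum_single: "(\<Sum>m\<in>keys p. single m (lookup p m)) = p"
  by (rule poly_mapping_eqI) (simp add: lookup_sum lookup_single when_def in_keys_iff)

text \<open>A monomial of the product that arises from one pair of terms cannot cancel. This takes
  the place of leading terms when an element is to be shown a nonzerodivisor or an ideal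
  prime.\<close>

lemma lookup_mult_unique:
  fixes p q :: "('v, 'k::field) mpoly"
  assumes "\<And>a' b'. a' \<in> keys p \<Longrightarrow> b' \<in> keys q \<Longrightarrow> a' + b' = a + b \<Longrightarrow> a' = a \<and> b' = b"
  shows "lookup (p * q) (a + b) = lookup p a * lookup q b"
proof -
  have "lookup (p * q) (a + b) = (\<Sum>m\<in>keys p. lookup (single m (lookup p m) * q) (a + b))"
    by (subst poly_mapping_sum_single[of p, symmetric]) (simp add: sum_distrib_right lookup_sum)
  also have "\<dots> = (\<Sum>m\<in>keys p. if m = a then lookup p a * lookup q b else 0)"
  proof (rule sum.cong)
    fix m assume m: "m \<in> keys p"
    have s: "single m (lookup p m) * q = single 0 (lookup p m) * (single m 1 * q)"
      by (simp add: mult_single flip: mult.assoc)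
    have sm: "lookup (single m (lookup p m) * q) (m + b) = lookup p m * lookup q b"
      by (simp only: s lookup_scale lookup_mult_single)
    show "lookup (single m (lookup p m) * q) (a + b) = (if m = a then lookup p a * lookup q b else 0)"
    proof (cases "m = a")
      case True
      then show ?thesis using sm by simp
    next
      case False
      have "a + b \<notin> keys (single m (lookup p m) * q)"
      proof
        assume "a + b \<in> keys (single m (lookup p m) * q)"
        then obtain a' b' where "a' \<in> keys (single m (lookup p m))" "b' \<in> keys q" "a + b = a' + b'"
          by (rule keys_mult_elem)
        then show False using assms[of m b'] m False by (auto split: if_splits)
      qed
      then show ?thesis using False by (simp add: in_keys_iff)
    qed
  qed simp
  also have "\<dots> = lookup p a * lookup q b" by (simp add: in_keys_iff)
  finally show ?thesis .
qed

lemma mspan_mono: "A \<subseteq> B \<Longrightarrow> mspan A \<subseteq> mspan B"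
  by (auto simp: mspan_def)

lemma mspan_minus: "p \<in> mspan A \<Longrightarrow> q \<in> mspan A \<Longrightarrow> p - q \<in> mspan A"
  using keys_diff[of p q] by (auto simp: mspan_def)

lemma mspan_add: "p \<in> mspan A \<Longrightarrow> q \<in> mspan A \<Longrightarrow> p + q \<in> mspan A"
  using keys_add[of p q] by (auto simp: mspan_def)

lemma mspan_zero: "0 \<in> mspan A"
  by (simp add: mspan_def)

lemma mspan_mult:
  assumes "p \<in> mspan A" "q \<in> mspan B" "\<And>a b. a \<in> A \<Longrightarrow> b \<in> B \<Longrightarrow> a + b \<in> C"
  shows "p * q \<in> mspan C"
  using assms by (auto simp: mspan_def elim!: keys_mult_elem)

lemma single_mspan: "m \<in> A \<Longrightarrow> single m c \<in> mspan A"
  by (simp add: mspan_def)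

lemma sum_mspan: "(\<And>i. i \<in> I \<Longrightarrow> p i \<in> mspan A) \<Longrightarrow> sum p I \<in> mspan A"
  by (induction I rule: infinite_finite_induct) (auto intro: mspan_add mspan_zero)

lemma mspan_subsetI:
  fixes N :: "('v, 'k::field) mpoly set"
  assumes "0 \<in> N" "\<And>p q. p \<in> N \<Longrightarrow> q \<in> N \<Longrightarrow> p + q \<in> N" "\<And>m c. m \<in> A \<Longrightarrow> single m c \<in> N"
  shows "mspan A \<subseteq> N"
proof
  fix p :: "('v, 'k) mpoly" assume "p \<in> mspan A"
  then have "single m (lookup p m) \<in> N" if "m \<in> keys p" for m using that assms(3) by (auto simp: mspan_def)
  moreover have "(\<Sum>m\<in>M. g m) \<in> N" if "finite M" "\<forall>m\<in>M. g m \<in> N" for M and g :: "('v \<Rightarrow>\<^sub>0 nat) \<Rightarrow> ('v, 'k) mpoly"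
    using that by induction (auto intro: assms)
  ultimately have "(\<Sum>m\<in>keys p. single m (lookup p m)) \<in> N" by simp
  then show "p \<in> N" by (simp only: poly_mapping_sum_single)
qed

lemma nonfaces_add: "keys a \<subseteq> V \<Longrightarrow> b \<in> nonfaces V \<F> \<Longrightarrow> a + b \<in> nonfaces V \<F>"
  by (auto simp: nonfaces_def keys_add_nat)

lemma polys_mult_nonfaces: "p \<in> polys V \<Longrightarrow> q \<in> sr_ideal V \<F> \<Longrightarrow> p * q \<in> sr_ideal V \<F>"
  by (erule mspan_mult) (auto intro: nonfaces_add)

lemma polys_mult: "p \<in> polys V \<Longrightarrow> q \<in> polys V \<Longrightarrow> p * q \<in> polys V"
  by (erule mspan_mult) (auto simp: keys_add_nat)

lemma polys_one: "1 \<in> polys V"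
  by (simp add: mspan_def)

lemma polys_power: "p \<in> polys V \<Longrightarrow> p ^ n \<in> polys V"
  by (induction n) (auto intro: polys_mult polys_one)

lemma nonfaces_empty: "nonfaces V {} = {m. keys m \<subseteq> V}"
  by (simp add: nonfaces_def)

lemma nonfaces_subset: "nonfaces V \<F> \<subseteq> {m. keys m \<subseteq> V}"
  by (auto simp: nonfaces_def)

lemma nonfaces_polys: "sr_ideal V \<F> \<subseteq> polys V"
  by (rule mspan_mono[OF nonfaces_subset])

lemma nonfaces_antimono: "\<G> \<subseteq> \<F> \<Longrightarrow> nonfaces V \<F> \<subseteq> nonfaces V \<G>"
  by (auto simp: nonfaces_def)

lemma stable_nonfaces: "A \<subseteq> polys V \<Longrightarrow> stable A (sr_ideal V \<F>)"
  unfolding stable_def using mspan_zero mspan_minus polys_mult_nonfaces by blast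

section \<open>A regular sequence on shellable complexes\<close>

definition sqfree :: "'v set \<Rightarrow> ('v \<Rightarrow>\<^sub>0 nat)" where
  "sqfree U = (\<Sum>x\<in>U. single x 1)"

definition esym :: "'v set \<Rightarrow> nat \<Rightarrow> ('v, 'k::field) mpoly" where
  "esym V i = (\<Sum>U | U \<subseteq> V \<and> card U = i. single (sqfree U) 1)"

text \<open>The order is descending: on the polynomial ring of a face with \<open>d\<close> vertices
  \<open>esym V d\<close> is a single monomial. After killing it, the facets have
  \<open>d - 1\<close> vertices, and the tail is the sequence for them.\<close>

definition esyms :: "'v set \<Rightarrow> nat \<Rightarrow> ('v, 'k::field) mpoly list" where
  "esyms V d = map (esym V) (rev [1..<Suc d])"

lemma esyms_simps: "esyms V 0 = []" "esyms V (Suc d) = esym V (Suc d) # esyms V d"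
  by (simp_all add: esyms_def)

lemma lookup_sqfree: "finite U \<Longrightarrow> lookup (sqfree U) x = (if x \<in> U then 1 else 0)"
  by (simp add: sqfree_def lookup_sum lookup_single when_def)

lemma keys_sqfree: "finite U \<Longrightarrow> keys (sqfree U) = U"
  by (auto simp: in_keys_iff lookup_sqfree split: if_splits)

lemma keys_esym: 
  assumes "finite V" "m \<in> keys (esym V i :: ('v, 'k::field) mpoly)"
  obtains U where "m = sqfree U" "U \<subseteq> V" "card U = i"
proof -
  have "m \<in> (\<Union>U\<in>{U. U \<subseteq> V \<and> card U = i}. keys (single (sqfree U) (1::'k)))"
    using assms(2) unfolding esym_def by (rule subsetD[OF keys_sum])
  then show ?thesis using that by (auto split: if_splits)
qed

lemma lookup_esym:
  assumes "finite V" "U \<subseteq> V" "card U = i"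
  shows "lookup (esym V i :: ('v, 'k::field) mpoly) (sqfree U) = 1"
proof -
  have "sqfree U' = sqfree U \<longleftrightarrow> U' = U" if "U' \<subseteq> V" for U'
    using keys_sqfree assms that finite_subset by metis
  then have "lookup (esym V i :: ('v, 'k) mpoly) (sqfree U) = (\<Sum>U' | U' \<subseteq> V \<and> card U' = i. if U' = U then 1 else 0)"
    unfolding esym_def lookup_sum by (intro sum.cong) (auto simp: lookup_single when_def)
  then show ?thesis using assms by (simp add: sum.If_cases)
qed

lemma esym_polys:
  assumes "finite V" shows "(esym V i :: ('v, 'k::field) mpoly) \<in> polys V"
  unfolding mspan_def
proof clarify
  fix m x assume "m \<in> keys (esym V i :: ('v, 'k) mpoly)" and x: "x \<in> keys m"
  then obtain U where "m = sqfree U" "U \<subseteq> V" using keys_esym[OF assms] by metis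
  then show "x \<in> V" using x keys_sqfree[OF finite_subset[OF _ assms], of U] by auto
qed

lemma set_esyms_polys: "finite V \<Longrightarrow> set (esyms V d) \<subseteq> polys V"
  using esym_polys by (auto simp: esyms_def)

lemma sqfree_factor:
  assumes "U \<subseteq> keys m" shows "\<exists>m'. m = sqfree U + m'"
proof -
  have fin: "finite U" by (rule finite_subset[OF assms finite_keys])
  have "m = sqfree U + (m - sqfree U)"
  proof (rule poly_mapping_eqI)
    fix x
    have "x \<in> U \<Longrightarrow> 0 < lookup m x" using assms by (auto simp: in_keys_iff)
    then show "lookup m x = lookup (sqfree U + (m - sqfree U)) x"
      by (simp add: lookup_add lookup_minus lookup_sqfree[OF fin])
  qed
  then show ?thesis by blast
qed

text \<open>Adding the facet \<open>F\<close> removes from the ideal exactly the monomials with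
  support between \<open>R F\<close> and \<open>F\<close>. Hence multiplication by the monomial of
  \<open>R F\<close> induces an isomorphism from \<open>polys V / sr_ideal V {F}\<close>, the
  polynomial ring in the variables of \<open>F\<close>, onto the quotient of the two ideals.\<close>

lemma shelling_step_wregular:
  assumes fs: "set fs \<subseteq> (polys V :: ('v, 'k::field) mpoly set)" and V: "finite V"
    and sh: "shelling \<F> r R" and F: "F \<in> \<F>" "F \<subseteq> V"
    and base: "wregular fs (polys V) (sr_ideal V {F})"
  shows "wregular fs (sr_ideal V {F' \<in> \<F>. r F' < r F}) (sr_ideal V (insert F {F' \<in> \<F>. r F' < r F}))"
    (is "wregular fs (mspan ?L) (mspan ?K)")
proof (rule wregular_iso[where h = "\<lambda>p. single (sqfree (R F)) 1 * p", OF _ _ _ _ _ _ _ _ _ _ _ base])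
  note st = stable_nonfaces[OF fs]
  have RF: "R F \<subseteq> F" by (rule shelling_restriction_subset[OF sh F(1)])
  have finR: "finite (R F)" using RF F V by (meson finite_subset)
  note kR = keys_sqfree[OF finR]
  have cov: "(\<exists>F'\<in>\<F>. r F' < r F \<and> U \<subseteq> F') \<longleftrightarrow> \<not> R F \<subseteq> U" if "U \<subseteq> F" for U
    by (rule shelling_iff[OF sh F(1) that])
  have ncov: "\<not> (\<exists>F'\<in>\<F>. r F' < r F \<and> R F \<union> U \<subseteq> F')" for U
    using cov[OF RF] by blast
  show "stable (set fs) (polys V)" using st[of "{}"] by (simp add: nonfaces_empty)
  show "stable (set fs) (mspan ?L)" "stable (set fs) (mspan ?K)"
    "stable (set fs) (sr_ideal V {F})" by (rule st)+
  show "sr_ideal V {F} \<subseteq> polys V" by (rule nonfaces_polys)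
  show "mspan ?K \<subseteq> mspan ?L" by (rule mspan_mono[OF nonfaces_antimono]) auto
  have inL: "sqfree (R F) + m \<in> ?L" if "keys m \<subseteq> V" for m
    using ncov[of "keys m"] that RF F by (auto simp: nonfaces_def keys_add_nat kR)
  show "single (sqfree (R F)) 1 * p \<in> mspan ?L" if "p \<in> polys V" for p :: "('v, 'k) mpoly"
    by (rule mspan_mult[of _ "{sqfree (R F)}", OF _ that]) (auto intro: single_mspan inL)
  have inK: "sqfree (R F) + m \<in> ?K \<longleftrightarrow> m \<in> nonfaces V {F}" if "keys m \<subseteq> V" for m
    using ncov[of "keys m"] that RF F by (auto simp: nonfaces_def keys_add_nat kR)
  show "single (sqfree (R F)) 1 * p \<in> mspan ?K \<longleftrightarrow> p \<in> sr_ideal V {F}" if p: "p \<in> polys V" for p :: "('v, 'k) mpoly"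
  proof
    assume *: "single (sqfree (R F)) 1 * p \<in> mspan ?K"
    show "p \<in> sr_ideal V {F}"
      unfolding mspan_def
    proof clarify
      fix m assume m: "m \<in> keys p"
      then have "sqfree (R F) + m \<in> keys (single (sqfree (R F)) 1 * p)"
        using lookup_mult_single[of "sqfree (R F)" p m] by (simp add: in_keys_iff)
      then show "m \<in> nonfaces V {F}" using * inK[of m] p m by (auto simp: mspan_def)
    qed
  next
    assume "p \<in> sr_ideal V {F}"
    then show "single (sqfree (R F)) 1 * p \<in> mspan ?K"
      using inK nonfaces_subset by (intro mspan_mult[of _ "{sqfree (R F)}"]) (fastforce intro: single_mspan)+
  qed
  \<comment> \<open>Surjectivity: being congruent to a multiple of the monomial of
    \<open>R F\<close> is additive, so single terms suffice. Those not supported in \<open>F\<close>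
    vanish modulo \<open>?K\<close>; the others are divisible by that monomial because their support
    lies in no earlier facet.\<close>
  let ?N = "{q :: ('v, 'k) mpoly. \<exists>p\<in>polys V. q - single (sqfree (R F)) 1 * p \<in> mspan ?K}"
  have "mspan ?L \<subseteq> ?N"
  proof (rule mspan_subsetI)
    show "0 \<in> ?N" using mspan_zero by force
  next
    fix p q :: "('v, 'k) mpoly" assume "p \<in> ?N" "q \<in> ?N"
    then obtain p' q' where *: "p' \<in> polys V" "q' \<in> polys V" "p - single (sqfree (R F)) 1 * p' \<in> mspan ?K"
      "q - single (sqfree (R F)) 1 * q' \<in> mspan ?K" by blast
    have "(p + q) - single (sqfree (R F)) 1 * (p' + q') \<in> mspan ?K"
      using mspan_add[OF *(3,4)] by (simp add: algebra_simps)
    then show "p + q \<in> ?N" using mspan_add[OF *(1,2)] by blast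
  next
    fix m and c :: 'k assume m: "m \<in> ?L"
    show "single m c \<in> ?N"
    proof (cases "keys m \<subseteq> F")
      case False
      then have "m \<in> ?K" using m by (auto simp: nonfaces_def)
      then have "single m c - single (sqfree (R F)) 1 * 0 \<in> mspan ?K" by (simp add: single_mspan)
      then show ?thesis using mspan_zero by blast
    next
      case True
      then have "R F \<subseteq> keys m" using cov[OF True] m by (auto simp: nonfaces_def)
      then obtain m' where m': "m = sqfree (R F) + m'" using sqfree_factor by blast
      then have "keys m' \<subseteq> V" using True F by (auto simp: keys_add_nat)
      then have "single m' c \<in> polys V" by (intro single_mspan) simp
      moreover have "single m c - single (sqfree (R F)) 1 * single m' c \<in> mspan ?K"
        by (simp add: mult_single m' mspan_zero)
      ultimately show ?thesis by blast
    qed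
  qed
  then show "\<exists>p\<in>polys V. q - single (sqfree (R F)) 1 * p \<in> mspan ?K" if "q \<in> mspan ?L" for q :: "('v, 'k) mpoly"
    using that by blast
qed (simp_all add: algebra_simps)

text \<open>The ideals for the ranks from \<open>a\<close> to \<open>b\<close> form a descending
  chain, and \<open>wregular_trans\<close> assembles its successive quotients. As
  \<open>base\<close> speaks of the facets between the two bounds, the sequence can be chosen for
  their cardinality.\<close>

lemma shelling_wregular:
  assumes fs: "set fs \<subseteq> (polys V :: ('v, 'k::field) mpoly set)" and V: "finite V"
    and sh: "shelling \<F> r R" and "a \<le> b"
    and base: "\<And>F. F \<in> \<F> \<Longrightarrow> a \<le> r F \<Longrightarrow> r F < b \<Longrightarrow> F \<subseteq> V \<and> wregular fs (polys V) (sr_ideal V {F})"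
  shows "wregular fs (sr_ideal V {F \<in> \<F>. r F < a}) (sr_ideal V {F \<in> \<F>. r F < b})"
  using assms(4,5)
proof (induction b rule: dec_induct)
  case base
  show ?case by (rule wregular_trivial[OF stable_nonfaces[OF fs]])
next
  case (step b)
  note st = stable_nonfaces[OF fs]
  have IH: "wregular fs (sr_ideal V {F \<in> \<F>. r F < a}) (sr_ideal V {F \<in> \<F>. r F < b})"
    by (rule step.IH) (use step.prems in auto)
  show ?case
  proof (cases "\<exists>F\<in>\<F>. r F = b")
    case False
    then have "{F \<in> \<F>. r F < Suc b} = {F \<in> \<F>. r F < b}" by (auto simp: less_Suc_eq)
    then show ?thesis using IH by simp
  next
    case True
    then obtain F where F: "F \<in> \<F>" "r F = b" by blast
    have "r F' < Suc b \<longleftrightarrow> F' = F \<or> r F' < b" if "F' \<in> \<F>" for F'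
      using shelling_inj[OF sh] F that by (auto simp: less_Suc_eq dest: inj_onD)
    then have eq: "{F \<in> \<F>. r F < Suc b} = insert F {F' \<in> \<F>. r F' < r F}"
      using F by auto
    have *: "F \<subseteq> V \<and> wregular fs (polys V) (sr_ideal V {F})"
      using step.prems[of F] F step.hyps by simp
    show ?thesis
    proof (rule wregular_trans[OF st st st])
      show "wregular fs (sr_ideal V {F' \<in> \<F>. r F' < b}) (sr_ideal V {F \<in> \<F>. r F < Suc b})"
        unfolding eq using shelling_step_wregular[OF fs V sh F(1)] * F by simp
      show "sr_ideal V {F \<in> \<F>. r F < Suc b} \<subseteq> sr_ideal V {F' \<in> \<F>. r F' < b}"
        by (intro mspan_mono nonfaces_antimono) auto
      show "sr_ideal V {F' \<in> \<F>. r F' < b} \<subseteq> sr_ideal V {F \<in> \<F>. r F < a}"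
        using step.hyps by (intro mspan_mono nonfaces_antimono) auto
    qed (rule IH)
  qed
qed

text \<open>Number the vertices by \<open>f\<close> and omit them in that order. A face of
  \<open>F - {x}\<close> occurs earlier iff it misses some vertex with a smaller number, so the
  restriction consists of the vertices numbered before \<open>x\<close>.\<close>

lemma shelling_boundary:
  assumes "finite F"
  shows "\<exists>r R. shelling {F - {x} | x. x \<in> F} r R \<and> (\<forall>F'\<in>{F - {x} | x. x \<in> F}. r F' < card F)"
proof -
  let ?B = "{F - {x} | x. x \<in> F}"
  obtain f where f: "bij_betw f F {0..<card F}" using ex_bij_betw_finite_nat[OF assms] by blast
  define r where "r F' = f (THE x. x \<in> F - F')" for F'
  define R where "R F' = {y \<in> F. f y < r F'}" for F'
  have r: "r (F - {x}) = f x" if "x \<in> F" for x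
  proof -
    have "F - (F - {x}) = {x}" using that by auto
    then show ?thesis by (simp add: r_def)
  qed
  have inj: "f x = f y \<longleftrightarrow> x = y" if "x \<in> F" "y \<in> F" for x y
    using f that by (auto simp: bij_betw_def dest: inj_onD)
  have "shelling ?B r R"
    unfolding shelling_def
  proof (intro conjI ballI allI impI)
    show "inj_on r ?B" using r inj by (auto simp: inj_on_def)
    fix F' assume "F' \<in> ?B"
    then obtain x where x: "x \<in> F" "F' = F - {x}" by blast
    show "R F' \<subseteq> F'" using x r by (auto simp: R_def)
    fix U assume "U \<subseteq> F'"
    then show "(\<exists>F''\<in>?B. r F'' < r F' \<and> U \<subseteq> F'') \<longleftrightarrow> \<not> R F' \<subseteq> U"
    proof -
      assume "U \<subseteq> F'"
      have "(\<exists>F''\<in>?B. r F'' < r F' \<and> U \<subseteq> F'') \<longleftrightarrow> (\<exists>y\<in>F. f y < f x \<and> U \<subseteq> F - {y})"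
        using x r by (auto simp: Bex_def) metis+
      also have "\<dots> \<longleftrightarrow> \<not> R F' \<subseteq> U"
        using x r \<open>U \<subseteq> F'\<close> by (auto simp: R_def)
      finally show ?thesis .
    qed
  qed
  moreover have "r F' < card F" if "F' \<in> ?B" for F'
    using that r f by (auto simp: bij_betw_def)
  ultimately show ?thesis by blast
qed

text \<open>A set of \<open>Suc d\<close> elements contained in \<open>F\<close> is \<open>F\<close>
  itself, so modulo \<open>sr_ideal V {F}\<close> the symmetric polynomial is the monomial of
  \<open>F\<close>. Adding this monomial to the ideal removes the face \<open>F\<close> and leaves
  its boundary.\<close>

lemma ext_by_esym:
  assumes V: "finite V" and F: "F \<subseteq> V" "card F = Suc d"
  shows "ext_by (polys V) (sr_ideal V {F}) (esym V (Suc d) :: ('v, 'k::field) mpoly) =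
    sr_ideal V {F - {x} | x. x \<in> F}"
    (is "ext_by _ (mspan ?P) ?e = mspan ?B")
proof
  have finF: "finite F" using F V finite_subset by blast
  have B: "m \<in> ?B \<longleftrightarrow> keys m \<subseteq> V \<and> \<not> keys m \<subset> F" for m :: "'v \<Rightarrow>\<^sub>0 nat"
  proof -
    obtain x where "x \<in> F" using F by fastforce
    then show ?thesis by (auto simp: nonfaces_def)
  qed
  have P: "m \<in> ?P \<longleftrightarrow> keys m \<subseteq> V \<and> \<not> keys m \<subseteq> F" for m :: "'v \<Rightarrow>\<^sub>0 nat"
    by (auto simp: nonfaces_def)
  have PB: "?P \<subseteq> ?B" using P B by blast
  have e: "m \<in> ?B" if m: "m \<in> keys ?e" for m
  proof -
    obtain U where U: "m = sqfree U" "U \<subseteq> V" "card U = Suc d" using keys_esym[OF V m] by metis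
    then have "keys m = U" using V finite_subset keys_sqfree by blast
    moreover have "\<not> U \<subset> F" using psubset_card_mono[OF finF, of U] U F by auto
    ultimately show ?thesis using B U by simp
  qed
  show "ext_by (polys V) (mspan ?P) ?e \<subseteq> mspan ?B"
  proof
    fix p :: "('v, 'k) mpoly" assume "p \<in> ext_by (polys V) (mspan ?P) ?e"
    then obtain k l where kl: "p = k + ?e * l" "k \<in> mspan ?P" "l \<in> polys V" by (auto simp: ext_by_def)
    have "?e \<in> mspan ?B" using e by (auto simp: mspan_def)
    then have "l * ?e \<in> mspan ?B" using polys_mult_nonfaces[OF kl(3)] by blast
    then show "p \<in> mspan ?B"
      using kl subsetD[OF mspan_mono[OF PB] kl(2)] by (simp add: mspan_add mult.commute)
  qed
  have st: "stable {} (ext_by (polys V) (mspan ?P) ?e)"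
    using stable_nonfaces[of "{}" V "{F}"] stable_nonfaces[of "{}" V "{}"]
    by (intro stable_ext_by) (auto simp: nonfaces_empty)
  show "mspan ?B \<subseteq> ext_by (polys V) (mspan ?P) ?e"
  proof (rule mspan_subsetI)
    fix m and c :: 'k assume m: "m \<in> ?B"
    show "single m c \<in> ext_by (polys V) (mspan ?P) ?e"
    proof (cases "keys m \<subseteq> F")
      case False
      then have "m \<in> ?P" using m B P by blast
      then have "single m c + ?e * 0 \<in> ext_by (polys V) (mspan ?P) ?e"
        by (intro ext_byI mspan_zero single_mspan)
      then show ?thesis by simp
    next
      case True
      then have kF: "keys m = F" using m B by blast
      then obtain m' where m': "m = sqfree F + m'" using sqfree_factor by blast
      then have "keys m' \<subseteq> V" using kF F by (auto simp: keys_add_nat)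
      then have l: "single m' c \<in> polys V" by (intro single_mspan) simp
      let ?r = "single (sqfree F) (1::'k) - ?e"
      have "?r \<in> mspan ?P"
        unfolding mspan_def
      proof clarify
        fix u assume u: "u \<in> keys ?r"
        have "u \<noteq> sqfree F" using u lookup_esym[OF V F, where ?'k = 'k] by (auto simp: in_keys_iff lookup_minus)
        then have "u \<in> keys ?e" using u by (auto simp: in_keys_iff lookup_minus lookup_single)
        then obtain U where U: "u = sqfree U" "U \<subseteq> V" "card U = Suc d" using keys_esym[OF V] by metis
        then have "keys u = U" using V finite_subset keys_sqfree by blast
        moreover have "\<not> U \<subseteq> F" using card_subset_eq[OF finF, of U] U F \<open>u \<noteq> sqfree F\<close> by auto
        ultimately show "u \<in> ?P" using P U by simp
      qed
      then have "single m' c * ?r + ?e * single m' c \<in> ext_by (polys V) (mspan ?P) ?e"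
        by (intro ext_byI polys_mult_nonfaces l)
      moreover have "single m c = single m' c * ?r + ?e * single m' c"
        by (simp add: m' algebra_simps mult_single)
      ultimately show ?thesis by simp
    qed
  qed (use stableD[OF st] in auto)
qed

lemma esyms_wregular_simplex:
  assumes V: "finite V" and "F \<subseteq> V" "card F = d"
  shows "wregular (esyms V d) (polys V) (sr_ideal V {F} :: ('v, 'k::field) mpoly set)"
  using assms(2-)
proof (induction d arbitrary: F)
  case 0
  show ?case by (simp add: esyms_simps)
next
  case (Suc d)
  have finF: "finite F" using Suc.prems V finite_subset by blast
  let ?e = "esym V (Suc d) :: ('v, 'k) mpoly"
  have nzd: "p \<in> sr_ideal V {F}"
    if p: "p \<in> polys V" "?e * p \<in> sr_ideal V {F}" for p :: "('v, 'k) mpoly"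
    unfolding mspan_def
  proof clarify
    fix m assume m: "m \<in> keys p"
    then have mV: "keys m \<subseteq> V" using p by (auto simp: mspan_def)
    show "m \<in> nonfaces V {F}"
    proof (rule ccontr)
      assume "m \<notin> nonfaces V {F}"
      then have mF: "keys m \<subseteq> F" using mV by (auto simp: nonfaces_def)
      \<comment> \<open>Among the terms of \<open>?e\<close> only \<open>sqfree F\<close> has
        support inside \<open>F\<close>, so the coefficient at \<open>sqfree F + m\<close> comes
        from a single pair of terms.\<close>
      have "lookup (?e * p) (sqfree F + m) = lookup ?e (sqfree F) * lookup p m"
      proof (rule lookup_mult_unique)
        fix a b assume ab: "a \<in> keys ?e" "b \<in> keys p" "a + b = sqfree F + m"
        obtain U where U: "a = sqfree U" "U \<subseteq> V" "card U = Suc d" using keys_esym[OF V ab(1)] by metis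
        have "keys a \<subseteq> keys (sqfree F + m)" using ab(3) by (metis Un_upper1 keys_add_nat)
        then have "U \<subseteq> F" using U V mF by (auto simp: keys_add_nat keys_sqfree[OF finF] keys_sqfree finite_subset)
        then have "U = F" using card_subset_eq[OF finF] U Suc.prems by auto
        then show "a = sqfree F \<and> b = m" using ab U by simp
      qed
      also have "\<dots> \<noteq> 0" using m lookup_esym[OF V Suc.prems, where ?'k = 'k] by (simp add: in_keys_iff)
      finally have "sqfree F + m \<in> nonfaces V {F}" using p(2) by (auto simp: mspan_def in_keys_iff)
      then show False using mF by (auto simp: nonfaces_def keys_add_nat keys_sqfree[OF finF])
    qed
  qed
  let ?B = "{F - {x} | x. x \<in> F}"
  obtain r R where sh: "shelling ?B r R" "\<forall>F'\<in>?B. r F' < card F"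
    using shelling_boundary[OF finF] by blast
  \<comment> \<open>The rank bound \<open>0\<close> gives the empty family, whose ideal is all of
    \<open>polys V\<close>; the bound \<open>card F\<close> gives the whole boundary.\<close>
  have "wregular (esyms V d) (sr_ideal V {F' \<in> ?B. r F' < 0})
     (sr_ideal V {F' \<in> ?B. r F' < card F} :: ('v, 'k) mpoly set)"
  proof (rule shelling_wregular[OF set_esyms_polys[OF V] V sh(1)])
    fix F' assume "F' \<in> ?B"
    then obtain x where "x \<in> F" "F' = F - {x}" by blast
    then show "F' \<subseteq> V \<and> wregular (esyms V d) (polys V) (sr_ideal V {F'} :: ('v, 'k) mpoly set)"
      using Suc.prems finF by (intro conjI Suc.IH) auto
  qed simp
  moreover have "{F' \<in> ?B. r F' < card F} = ?B" using sh(2) by blast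
  moreover have "{F' \<in> ?B. r F' < 0} = {}" by simp
  ultimately have "wregular (esyms V d) (polys V) (sr_ideal V ?B :: ('v, 'k) mpoly set)"
    by (simp only: nonfaces_empty)
  then show ?case using nzd by (simp add: esyms_simps ext_by_esym[OF V Suc.prems])
qed

lemma esyms_wregular_layer:
  assumes V: "finite V" and \<F>: "\<And>F. F \<in> \<F> \<Longrightarrow> F \<subseteq> V"
    and sh: "shelling \<F> r R" and lay: "\<forall>d. \<exists>a. \<forall>F\<in>\<F>. r F < a \<longleftrightarrow> d < card F"
  shows "wregular (esyms V d) (sr_ideal V {F \<in> \<F>. d < card F})
     (sr_ideal V {F \<in> \<F>. d \<le> card F} :: ('v, 'k::field) mpoly set)"
proof (cases d)
  case 0
  then show ?thesis by (simp add: esyms_simps)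
next
  case (Suc c)
  obtain a where a: "\<And>F. F \<in> \<F> \<Longrightarrow> r F < a \<longleftrightarrow> d < card F" using lay by blast
  obtain b where b: "\<And>F. F \<in> \<F> \<Longrightarrow> r F < b \<longleftrightarrow> d \<le> card F" using lay Suc by (metis Suc_le_eq)
  \<comment> \<open>The thresholds are arbitrary, so \<open>a \<le> b\<close> is not guaranteed;
    \<open>max a b\<close> selects the same facets as \<open>b\<close> and is at least
    \<open>a\<close>.\<close>
  have eq: "{F \<in> \<F>. r F < a} = {F \<in> \<F>. d < card F}" "{F \<in> \<F>. r F < max a b} = {F \<in> \<F>. d \<le> card F}"
    using a b by (auto simp: less_max_iff_disj)
  have "wregular (esyms V d) (sr_ideal V {F \<in> \<F>. r F < a}) (sr_ideal V {F \<in> \<F>. r F < max a b} :: ('v, 'k) mpoly set)"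
  proof (rule shelling_wregular[OF set_esyms_polys[OF V] V sh])
    fix F assume F: "F \<in> \<F>" "a \<le> r F" "r F < max a b"
    then have "card F = d" using a[of F] b[of F] by auto
    then show "F \<subseteq> V \<and> wregular (esyms V d) (polys V) (sr_ideal V {F} :: ('v, 'k) mpoly set)"
      using esyms_wregular_simplex[OF V] \<F> F by blast
  qed simp
  then show ?thesis by (simp only: eq)
qed

section \<open>Monomial primes\<close>

text \<open>Maximising one coordinate of \<open>F\<close> after another picks a lexicographically
  largest element of each set, and a sum of two maxima in a coordinate forces both summands to
  attain them.\<close>

lemma unique_extremal_sum:
  fixes A B :: "('v \<Rightarrow>\<^sub>0 nat) set"
  assumes "finite F" "finite A" "A \<noteq> {}" "finite B" "B \<noteq> {}"
    and "\<And>a a' x. a \<in> A \<Longrightarrow> a' \<in> A \<Longrightarrow> x \<notin> F \<Longrightarrow> lookup a x = lookup a' x"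
    and "\<And>b b' x. b \<in> B \<Longrightarrow> b' \<in> B \<Longrightarrow> x \<notin> F \<Longrightarrow> lookup b x = lookup b' x"
  shows "\<exists>a\<in>A. \<exists>b\<in>B. \<forall>a'\<in>A. \<forall>b'\<in>B. a' + b' = a + b \<longrightarrow> a' = a \<and> b' = b"
  using assms
proof (induction F arbitrary: A B rule: finite_induct)
  case empty
  obtain a b where ab: "a \<in> A" "b \<in> B" using empty by blast
  then have "a' = a" if "a' \<in> A" for a' using empty(5)[OF that ab(1)] by (intro poly_mapping_eqI) auto
  moreover have "b' = b" if "b' \<in> B" for b' using empty(6)[OF that ab(2)] by (intro poly_mapping_eqI) auto
  ultimately show ?case using ab by blast
next
  case (insert v F)
  define i where "i = Max ((\<lambda>a. lookup a v) ` A)"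
  define j where "j = Max ((\<lambda>b. lookup b v) ` B)"
  let ?A = "{a \<in> A. lookup a v = i}" and ?B = "{b \<in> B. lookup b v = j}"
  have iA: "lookup a v \<le> i" if "a \<in> A" for a using that insert.prems by (simp add: i_def)
  have jB: "lookup b v \<le> j" if "b \<in> B" for b using that insert.prems by (simp add: j_def)
  have "i \<in> (\<lambda>a. lookup a v) ` A" "j \<in> (\<lambda>b. lookup b v) ` B"
    unfolding i_def j_def using insert.prems by (auto intro!: Max_in)
  then have ne: "?A \<noteq> {}" "?B \<noteq> {}" by auto
  have "\<exists>a\<in>?A. \<exists>b\<in>?B. \<forall>a'\<in>?A. \<forall>b'\<in>?B. a' + b' = a + b \<longrightarrow> a' = a \<and> b' = b"
  proof (rule insert.IH)
    show "finite ?A" "finite ?B" using insert.prems by auto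
    show "lookup a x = lookup a' x" if "a \<in> ?A" "a' \<in> ?A" "x \<notin> F" for a a' x
      using that insert.prems(5)[of a a' x] by (cases "x = v") auto
    show "lookup b x = lookup b' x" if "b \<in> ?B" "b' \<in> ?B" "x \<notin> F" for b b' x
      using that insert.prems(6)[of b b' x] by (cases "x = v") auto
  qed (rule ne)+
  then obtain a b where ab: "a \<in> ?A" "b \<in> ?B"
    and u: "\<And>a' b'. a' \<in> ?A \<Longrightarrow> b' \<in> ?B \<Longrightarrow> a' + b' = a + b \<Longrightarrow> a' = a \<and> b' = b" by blast
  have "a' = a \<and> b' = b" if "a' \<in> A" "b' \<in> B" "a' + b' = a + b" for a' b'
  proof -
    have "lookup a' v + lookup b' v = i + j"
      using arg_cong[OF that(3), of "\<lambda>m. lookup m v"] ab by (simp add: lookup_add)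
    then have "lookup a' v = i" "lookup b' v = j" using iA[OF that(1)] jB[OF that(2)] by auto
    then show ?thesis using u that by blast
  qed
  then show ?case using ab by blast
qed

text \<open>The quotient by this ideal is the polynomial ring in the variables of \<open>F\<close>.
  For two polynomials outside the ideal, extremal terms supported in \<open>F\<close> multiply to a
  term that survives, because a monomial supported in \<open>F\<close> has only factors supported in
  \<open>F\<close>.\<close>

lemma nonfaces_simplex_prime:
  fixes p q :: "('v, 'k::field) mpoly"
  assumes "finite F" "p \<in> polys V" "q \<in> polys V" "p * q \<in> sr_ideal V {F}"
  shows "p \<in> sr_ideal V {F} \<or> q \<in> sr_ideal V {F}"
proof (rule ccontr)
  assume *: "\<not> ?thesis"
  define A where "A = {m \<in> keys p. keys m \<subseteq> F}"
  define B where "B = {m \<in> keys q. keys m \<subseteq> F}"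
  have ne: "A \<noteq> {}" "B \<noteq> {}" using * assms by (auto simp: A_def B_def mspan_def nonfaces_def)
  have out: "lookup m x = 0" if "m \<in> A \<or> m \<in> B" "x \<notin> F" for m x
    using that by (auto simp: A_def B_def in_keys_iff)
  have "\<exists>a\<in>A. \<exists>b\<in>B. \<forall>a'\<in>A. \<forall>b'\<in>B. a' + b' = a + b \<longrightarrow> a' = a \<and> b' = b"
    using out by (intro unique_extremal_sum[OF assms(1) _ ne(1) _ ne(2)]) (auto simp: A_def B_def)
  then obtain a b where ab: "a \<in> A" "b \<in> B"
    and u: "\<And>a' b'. a' \<in> A \<Longrightarrow> b' \<in> B \<Longrightarrow> a' + b' = a + b \<Longrightarrow> a' = a \<and> b' = b" by blast
  have kab: "keys (a + b) \<subseteq> F" using ab by (auto simp: A_def B_def keys_add_nat)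
  have "lookup (p * q) (a + b) = lookup p a * lookup q b"
  proof (rule lookup_mult_unique)
    fix a' b' assume *: "a' \<in> keys p" "b' \<in> keys q" "a' + b' = a + b"
    then have "keys a' \<union> keys b' \<subseteq> F" using kab by (metis keys_add_nat)
    then show "a' = a \<and> b' = b" using * by (intro u) (auto simp: A_def B_def)
  qed
  also have "\<dots> \<noteq> 0" using ab by (simp add: A_def B_def in_keys_iff)
  finally have "a + b \<in> nonfaces V {F}" using assms(4) by (auto simp: mspan_def in_keys_iff)
  then show False using kab by (auto simp: nonfaces_def)
qed

lemma nonfaces_simplex_strict:
  assumes "F \<subseteq> V" "x \<in> F"
  shows "sr_ideal V {F} \<subset> (sr_ideal V {F - {x}} :: ('v, 'k::field) mpoly set)"
proof (rule psubsetI)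
  show "sr_ideal V {F} \<subseteq> (sr_ideal V {F - {x}} :: ('v, 'k) mpoly set)"
    by (rule mspan_mono) (auto simp: nonfaces_def)
  have "single (single x 1) 1 \<in> (sr_ideal V {F - {x}} :: ('v, 'k) mpoly set)"
    using assms by (intro single_mspan) (auto simp: nonfaces_def)
  moreover have "single (single x 1) 1 \<notin> (sr_ideal V {F} :: ('v, 'k) mpoly set)"
    using assms by (simp add: mspan_def nonfaces_def)
  ultimately show "sr_ideal V {F} \<noteq> (sr_ideal V {F - {x}} :: ('v, 'k) mpoly set)" by blast
qed

section \<open>Linear dependence and chains of ideals\<close>

text \<open>Gaussian elimination: equation \<open>b\<close> is solved for an unknown
  \<open>z\<close> with nonzero coefficient, which leaves one unknown and one equation
  fewer.\<close>

lemma homogeneous_system_solution: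
  fixes M :: "'a \<Rightarrow> 'b \<Rightarrow> 'k::field"
  assumes "finite B" "finite A" "card B < card A"
  shows "\<exists>c. (\<exists>a\<in>A. c a \<noteq> 0) \<and> (\<forall>b\<in>B. (\<Sum>a\<in>A. c a * M a b) = 0)"
  using assms
proof (induction B arbitrary: A M rule: finite_induct)
  case empty
  then have "A \<noteq> {}" by auto
  then show ?case by (intro exI[of _ "\<lambda>_. 1"]) auto
next
  case (insert b B)
  show ?case
  proof (cases "\<exists>a\<in>A. M a b \<noteq> 0")
    case False
    obtain c where "\<exists>a\<in>A. c a \<noteq> 0" "\<forall>b\<in>B. (\<Sum>a\<in>A. c a * M a b) = 0"
      using insert.IH[of A M] insert.prems insert.hyps by auto
    then show ?thesis using False by (intro exI[of _ c]) auto
  next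
    case True
    then obtain z where z: "z \<in> A" "M z b \<noteq> 0" by blast
    \<comment> \<open>Equation \<open>b'\<close> minus the multiple of equation \<open>b\<close>
      that cancels the unknown \<open>z\<close>.\<close>
    define M' where "M' a b' = M a b' - M a b / M z b * M z b'" for a b'
    have "card B < card (A - {z})" using insert.prems insert.hyps z by simp
    then obtain c where c: "\<exists>a\<in>A - {z}. c a \<noteq> 0" "\<And>b'. b' \<in> B \<Longrightarrow> (\<Sum>a\<in>A - {z}. c a * M' a b') = 0"
      using insert.IH[of "A - {z}" M'] insert.prems by auto
    define s where "s = - (\<Sum>a\<in>A - {z}. c a * M a b) / M z b"
    define c' where "c' = c(z := s)"
    have sum: "(\<Sum>a\<in>A. c' a * M a b') = s * M z b' + (\<Sum>a\<in>A - {z}. c a * M a b')" for b'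
      using insert.prems z by (subst sum.remove[of A z]) (auto simp: c'_def intro!: sum.cong)
    have "(\<Sum>a\<in>A. c' a * M a b) = 0" using z by (simp add: sum s_def)
    moreover have "(\<Sum>a\<in>A. c' a * M a b') = 0" if "b' \<in> B" for b'
    proof -
      have "0 = (\<Sum>a\<in>A - {z}. c a * M a b' - c a * M a b * (M z b' / M z b))"
        using c(2)[OF that] by (simp add: M'_def algebra_simps)
      also have "\<dots> = (\<Sum>a\<in>A - {z}. c a * M a b') - (\<Sum>a\<in>A - {z}. c a * M a b) * (M z b' / M z b)"
        by (simp add: sum_subtractf sum_distrib_right sum_divide_distrib)
      also have "\<dots> = (\<Sum>a\<in>A. c' a * M a b')" by (simp add: sum s_def)
      finally show ?thesis by simp
    qed
    moreover have "\<exists>a\<in>A. c' a \<noteq> 0" using c(1) by (auto simp: c'_def)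
    ultimately show ?thesis by (intro exI[of _ c']) auto
  qed
qed

text \<open>The exponents form a list and \<open>i\<close> is the index of the first factor:
  dropping the head moves on to the next polynomial, in step with the next ideal of a chain.\<close>

fun mono_power :: "(nat \<Rightarrow> 'r::comm_ring_1) \<Rightarrow> nat \<Rightarrow> nat list \<Rightarrow> 'r" where
  "mono_power f i [] = 1"
| "mono_power f i (x # xs) = f i ^ x * mono_power f (Suc i) xs"

lemma mono_power_polys:
  assumes "\<And>j. j < n \<Longrightarrow> f j \<in> polys V" "i + length xs \<le> n"
  shows "mono_power f i xs \<in> polys V"
  using assms(2)
proof (induction xs arbitrary: i)
  case (Cons x xs)
  have "f i ^ x \<in> polys V" using Cons.prems by (intro polys_power assms(1)) simp
  then show ?case using Cons by (simp add: polys_mult)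
qed (simp add: polys_one)

text \<open>The terms of least exponent in the first variable dominate, modulo the next ideal of the chain.\<close>

lemma ideal_chain_independent:
  fixes N :: "nat \<Rightarrow> ('v, 'k::field) mpoly set" and f :: "nat \<Rightarrow> ('v, 'k) mpoly"
  assumes st: "\<And>i. i \<le> n \<Longrightarrow> stable (polys V) (N i)"
    and mono: "\<And>i. i < n \<Longrightarrow> N i \<subseteq> N (Suc i)"
    and f: "\<And>i. i < n \<Longrightarrow> f i \<in> polys V" "\<And>i. i < n \<Longrightarrow> f i \<in> N (Suc i)"
    and nzd: "\<And>i r. i < n \<Longrightarrow> r \<in> polys V \<Longrightarrow> f i * r \<in> N i \<Longrightarrow> r \<in> N i"
    and one: "1 \<notin> N n"
    and A: "i \<le> n" "finite A" "\<And>xs. xs \<in> A \<Longrightarrow> length xs = n - i" "\<And>xs. xs \<in> A \<Longrightarrow> c xs \<noteq> 0"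
    and rel: "(\<Sum>xs\<in>A. single 0 (c xs) * mono_power f i xs) \<in> N i"
  shows "A = {}"
proof -
  note add = stableD(3)[OF st] and zero = stableD(1)[OF st] and mult = stableD(5)[OF st]
  show ?thesis
    using A rel
  proof (induction "n - i" arbitrary: i A c)
    case 0
    then have i: "i = n" by simp
    show ?case
    proof (rule ccontr)
      assume "A \<noteq> {}"
      have "xs = []" if "xs \<in> A" for xs using "0.prems"(3)[OF that] i by simp
      then have A: "A = {[]}" using \<open>A \<noteq> {}\<close> by blast
      then have "single 0 (c []) \<in> N n" using "0.prems"(5) i by simp
      then have "single 0 (1 / c []) * single 0 (c []) \<in> N n"
        by (intro mult single_mspan) auto
      then show False using one "0.prems"(4)[of "[]"] A by (simp add: mult_single)
    qed
  next
    case (Suc k)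
    then have i: "i < n" by simp
    note pow = polys_power[OF f(1)[OF i]] and mp = mono_power_polys[of n f, OF f(1)]
    have cancel: "r \<in> N i" if "r \<in> polys V" "f i ^ x * r \<in> N i" for r x
      using that
    proof (induction x)
      case (Suc x)
      then have "f i * (f i ^ x * r) \<in> N i" by (simp add: algebra_simps)
      then have "f i ^ x * r \<in> N i" using nzd[OF i] polys_mult[OF pow Suc.prems(1)] by blast
      then show ?case using Suc by blast
    qed simp
    show ?case
    proof (rule ccontr)
      assume ne: "A \<noteq> {}"
      have cons: "xs = hd xs # tl xs" "length (tl xs) = n - Suc i" if "xs \<in> A" for xs
        using Suc.prems(3)[OF that] i by (cases xs; simp)+
      \<comment> \<open>Every term contains \<open>f i ^ e\<close>, which can be cancelled modulo
        \<open>N i\<close>. The remaining terms with \<open>hd xs > e\<close> still contain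
        \<open>f i\<close> and lie in \<open>N (Suc i)\<close>, so those with
        \<open>hd xs = e\<close> give a relation modulo \<open>N (Suc i)\<close> that no longer
        involves \<open>f i\<close>.\<close>
      define e where "e = Min (hd ` A)"
      have e: "e \<le> hd xs" if "xs \<in> A" for xs using that Suc.prems(2) by (simp add: e_def)
      have "e \<in> hd ` A" unfolding e_def using ne Suc.prems(2) by (intro Min_in) auto
      define A0 where "A0 = {xs \<in> A. hd xs = e}"
      have A0: "A0 \<noteq> {}" "A0 \<subseteq> A" using \<open>e \<in> hd ` A\<close> by (auto simp: A0_def)
      let ?t = "\<lambda>xs. single 0 (c xs) * (f i ^ (hd xs - e) * mono_power f (Suc i) (tl xs))"
      have tV: "?t xs \<in> polys V" if "xs \<in> A" for xs
        using cons[OF that] i by (intro polys_mult pow mp single_mspan) auto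
      have "single 0 (c xs) * mono_power f i xs = f i ^ e * ?t xs" if "xs \<in> A" for xs
      proof -
        have "mono_power f i xs = f i ^ hd xs * mono_power f (Suc i) (tl xs)"
          by (subst cons(1)[OF that]) simp
        also have "f i ^ hd xs = f i ^ e * f i ^ (hd xs - e)"
          using e[OF that] by (simp flip: power_add)
        finally show ?thesis by (simp add: algebra_simps)
      qed
      then have "f i ^ e * (\<Sum>xs\<in>A. ?t xs) \<in> N i"
        using Suc.prems(5) by (simp add: sum_distrib_left)
      then have "(\<Sum>xs\<in>A. ?t xs) \<in> N i" using cancel sum_mspan[of A ?t] tV by blast
      then have sN: "(\<Sum>xs\<in>A. ?t xs) \<in> N (Suc i)" using mono[OF i] by blast
      have rest: "?t xs \<in> N (Suc i)" if "xs \<in> A - A0" for xs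
      proof -
        have "hd xs - e = Suc (hd xs - e - 1)" using e[of xs] that by (auto simp: A0_def)
        then have "f i ^ (hd xs - e) = f i * f i ^ (hd xs - e - 1)" by (metis power_Suc)
        then have "?t xs = (single 0 (c xs) * (f i ^ (hd xs - e - 1) * mono_power f (Suc i) (tl xs))) * f i"
          by (simp only: mult_ac)
        also have "\<dots> \<in> N (Suc i)"
          using i cons[of xs] that f(2)[OF i] by (intro mult polys_mult pow mp single_mspan) auto
        finally show ?thesis .
      qed
      have sumN: "(\<Sum>x\<in>X. g x) \<in> N (Suc i)" if "finite X" "\<forall>x\<in>X. g x \<in> N (Suc i)" for X and g :: "nat list \<Rightarrow> _"
        using that i by induction (auto intro: add zero)
      have "(\<Sum>xs\<in>A - A0. ?t xs) \<in> N (Suc i)" using rest Suc.prems(2) by (intro sumN) auto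
      then have "single 0 (- 1) * (\<Sum>xs\<in>A - A0. ?t xs) \<in> N (Suc i)"
        using i by (intro mult single_mspan) auto
      then have "(\<Sum>xs\<in>A. ?t xs) + single 0 (- 1) * (\<Sum>xs\<in>A - A0. ?t xs) \<in> N (Suc i)"
        using add i sN by simp
      moreover have "single 0 (- 1) * q = - q" for q :: "('v, 'k) mpoly"
        using single_uminus[of "0 :: 'v \<Rightarrow>\<^sub>0 nat" "1::'k"] by simp
      ultimately have s0: "(\<Sum>xs\<in>A0. ?t xs) \<in> N (Suc i)"
        using sum.subset_diff[OF A0(2) Suc.prems(2), of ?t] by simp
      have inj: "inj_on tl A0"
      proof (rule inj_onI)
        fix xs ys assume "xs \<in> A0" "ys \<in> A0" "tl xs = tl ys"
        then show "xs = ys" using cons(1)[of xs] cons(1)[of ys] by (auto simp: A0_def)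
      qed
      have "(\<Sum>ys\<in>tl ` A0. single 0 (c (e # ys)) * mono_power f (Suc i) ys) = (\<Sum>xs\<in>A0. ?t xs)"
      proof (subst sum.reindex[OF inj], rule sum.cong)
        fix xs assume "xs \<in> A0"
        then have "e # tl xs = xs" "hd xs = e" using cons(1)[of xs] by (auto simp: A0_def)
        then show "((\<lambda>ys. single 0 (c (e # ys)) * mono_power f (Suc i) ys) \<circ> tl) xs = ?t xs" by simp
      qed simp
      with s0 have s1: "(\<Sum>ys\<in>tl ` A0. single 0 (c (e # ys)) * mono_power f (Suc i) ys) \<in> N (Suc i)" by simp
      have "tl ` A0 = {}"
      proof (rule Suc.hyps(1)[of "Suc i" "tl ` A0" "\<lambda>ys. c (e # ys)", OF _ _ _ _ _ s1])
        show "k = n - Suc i" "Suc i \<le> n" using Suc.hyps i by auto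
        show "finite (tl ` A0)" using Suc.prems(2) A0(2) finite_subset by blast
        show "length ys = n - Suc i" if "ys \<in> tl ` A0" for ys using that cons(2) A0 by auto
        show "c (e # ys) \<noteq> 0" if "ys \<in> tl ` A0" for ys
          using that Suc.prems(4) cons(1) by (force simp: A0_def)
      qed
      then show False using A0 by simp
    qed
  qed
qed

section \<open>Counting monomials with bounded exponents\<close>

definition exp_bounded :: "nat \<Rightarrow> ('v, 'k::field) mpoly \<Rightarrow> bool" where
  "exp_bounded E p \<longleftrightarrow> (\<forall>m\<in>keys p. \<forall>x. lookup m x \<le> E)"

lemma exp_bounded_mult: "exp_bounded a p \<Longrightarrow> exp_bounded b q \<Longrightarrow> exp_bounded (a + b) (p * q)"
  unfolding exp_bounded_def by (auto elim!: keys_mult_elem simp: lookup_add intro!: add_mono)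

lemma exp_bounded_mono: "exp_bounded a p \<Longrightarrow> a \<le> b \<Longrightarrow> exp_bounded b p"
  unfolding exp_bounded_def using order_trans by blast

lemma exp_bounded_one: "exp_bounded 0 1"
  by (simp add: exp_bounded_def)

lemma ex_exp_bounded: "\<exists>E. exp_bounded E p"
proof -
  define A where "A = (\<Union>m\<in>keys p. (\<lambda>x. lookup m x) ` keys m)"
  have "finite A" by (simp add: A_def)
  then obtain E where E: "\<forall>a\<in>A. a \<le> E" using finite_nat_set_iff_bounded_le by blast
  have "lookup m x \<le> E" if "m \<in> keys p" for m x
    using E that by (cases "x \<in> keys m") (auto simp: A_def in_keys_iff)
  then show ?thesis unfolding exp_bounded_def by blast
qed

lemma exp_bounded_power: "exp_bounded D p \<Longrightarrow> exp_bounded (D * k) (p ^ k)"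
  using exp_bounded_one exp_bounded_mult by (induction k) force+

lemma exp_bounded_mono_power:
  assumes "\<And>j. j < n \<Longrightarrow> exp_bounded D (f j)" "i + length xs \<le> n" "\<forall>x\<in>set xs. x \<le> K"
  shows "exp_bounded (D * K * length xs) (mono_power f i xs)"
  using assms(2,3)
proof (induction xs arbitrary: i)
  case Nil
  show ?case by (simp add: exp_bounded_one)
next
  case (Cons x xs)
  have "exp_bounded (D * x) (f i ^ x)" using Cons.prems assms(1) by (intro exp_bounded_power) auto
  then have "exp_bounded (D * K) (f i ^ x)" by (rule exp_bounded_mono) (use Cons.prems in auto)
  moreover have "exp_bounded (D * K * length xs) (mono_power f (Suc i) xs)" using Cons by auto
  ultimately have "exp_bounded (D * K + D * K * length xs) (f i ^ x * mono_power f (Suc i) xs)"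
    by (rule exp_bounded_mult)
  then show ?case by simp
qed

text \<open>Bounding each exponent instead of the total degree makes these monomials a box, hence
  the plain power as bound.\<close>

lemma card_bounded_monomials:
  assumes "finite F"
  shows "finite {m :: 'v \<Rightarrow>\<^sub>0 nat. keys m \<subseteq> F \<and> (\<forall>x. lookup m x \<le> E)}" (is "finite ?M")
    and "card {m :: 'v \<Rightarrow>\<^sub>0 nat. keys m \<subseteq> F \<and> (\<forall>x. lookup m x \<le> E)} \<le> (E + 1) ^ card F"
proof -
  let ?h = "\<lambda>m. restrict (lookup m) F"
  have inj: "inj_on ?h ?M"
  proof (rule inj_onI, rule poly_mapping_eqI)
    fix m m' x assume m: "m \<in> ?M" "m' \<in> ?M" "?h m = ?h m'"
    show "lookup m x = lookup m' x"
    proof (cases "x \<in> F")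
      case True
      then show ?thesis using fun_cong[OF m(3), of x] by simp
    next
      case False
      then have "x \<notin> keys m" "x \<notin> keys m'" using m by auto
      then show ?thesis by (simp add: in_keys_iff)
    qed
  qed
  have sub: "?h ` ?M \<subseteq> PiE F (\<lambda>_. {0..E})" by auto
  have fin: "finite (PiE F (\<lambda>_. {0..E}))" using assms by (intro finite_PiE) auto
  show "finite ?M" by (rule inj_on_finite[OF inj sub fin])
  have "card ?M \<le> card (PiE F (\<lambda>_. {0..E}))" by (rule card_inj_on_le[OF inj sub fin])
  also have "\<dots> = (E + 1) ^ card F" using assms by (simp add: card_PiE)
  finally show "card ?M \<le> (E + 1) ^ card F" .
qed

text \<open>Suppose \<open>n\<close> exceeds \<open>d\<close>. There are \<open>(K + 1) ^ n\<close>
  products of the \<open>f i\<close> with exponents up to \<open>K\<close>, but modulo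
  \<open>sr_ideal V \<F>\<close> only monomials supported on a member of \<open>\<F>\<close> matter,
  and their number is of order \<open>K ^ d\<close>. Linear algebra yields a nontrivial relation in
  \<open>N 0\<close>, against \<open>ideal_chain_independent\<close>.\<close>

lemma ideal_chain_length:
  fixes N :: "nat \<Rightarrow> ('v, 'k::field) mpoly set" and f :: "nat \<Rightarrow> ('v, 'k) mpoly"
  assumes st: "\<And>i. i \<le> n \<Longrightarrow> stable (polys V) (N i)"
    and mono: "\<And>i. i < n \<Longrightarrow> N i \<subseteq> N (Suc i)"
    and f: "\<And>i. i < n \<Longrightarrow> f i \<in> polys V" "\<And>i. i < n \<Longrightarrow> f i \<in> N (Suc i)"
    and nzd: "\<And>i r. i < n \<Longrightarrow> r \<in> polys V \<Longrightarrow> f i * r \<in> N i \<Longrightarrow> r \<in> N i"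
    and one: "1 \<notin> N n"
    and \<F>: "finite \<F>" "\<And>F. F \<in> \<F> \<Longrightarrow> finite F \<and> card F \<le> d"
    and sub: "sr_ideal V \<F> \<subseteq> N 0"
  shows "n \<le> d"
proof (rule ccontr)
  assume "\<not> n \<le> d"
  then have dn: "Suc d \<le> n" by simp
  have "\<forall>i. \<exists>E. exp_bounded E (f i)" by (simp add: ex_exp_bounded)
  then obtain D0 where D0: "\<And>i. exp_bounded (D0 i) (f i)" by metis
  define D where "D = Max (D0 ` {..<n})"
  have D: "exp_bounded D (f j)" if "j < n" for j
    using D0[of j] by (rule exp_bounded_mono) (use that in \<open>auto simp: D_def\<close>)
  \<comment> \<open>\<open>D\<close> bounds the exponents in each \<open>f i\<close>, hence
    \<open>E\<close> those in the products. Since \<open>E + 1 \<le> (D * n + 1) * (K + 1)\<close>,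
    there are at most \<open>card \<F> * (D * n + 1) ^ d * (K + 1) ^ d\<close> relevant monomials.
    Taking the first two factors as \<open>K\<close> makes this \<open>K * (K + 1) ^ d\<close>, less
    than \<open>(K + 1) ^ Suc d\<close>.\<close>
  define K where "K = card \<F> * (D * n + 1) ^ d"
  define E where "E = D * K * n"
  define A0 where "A0 = {xs. set xs \<subseteq> {0..K} \<and> length xs = n}"
  define B where "B = (\<Union>F\<in>\<F>. {m :: 'v \<Rightarrow>\<^sub>0 nat. keys m \<subseteq> F \<and> (\<forall>x. lookup m x \<le> E)})"
  have finA: "finite A0" unfolding A0_def by (rule finite_lists_length_eq) simp
  have cardA: "card A0 = (K + 1) ^ n" unfolding A0_def by (subst card_lists_length_eq) auto
  have finB: "finite B" unfolding B_def using \<F> card_bounded_monomials(1) by blast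
  have "card B \<le> (\<Sum>F\<in>\<F>. card {m :: 'v \<Rightarrow>\<^sub>0 nat. keys m \<subseteq> F \<and> (\<forall>x. lookup m x \<le> E)})"
    unfolding B_def by (rule card_UN_le[OF \<F>(1)])
  also have "\<dots> \<le> (\<Sum>F\<in>\<F>. (E + 1) ^ d)"
  proof (rule sum_mono)
    fix F assume "F \<in> \<F>"
    then have "finite F" "card F \<le> d" using \<F> by auto
    then show "card {m :: 'v \<Rightarrow>\<^sub>0 nat. keys m \<subseteq> F \<and> (\<forall>x. lookup m x \<le> E)} \<le> (E + 1) ^ d"
      using card_bounded_monomials(2)[of F E] power_increasing[of "card F" d "E + 1"] by linarith
  qed
  also have "\<dots> = card \<F> * (E + 1) ^ d" by simp
  also have "\<dots> \<le> card \<F> * ((D * n + 1) * (K + 1)) ^ d"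
    by (intro mult_left_mono power_mono) (auto simp: E_def algebra_simps)
  also have "\<dots> = K * (K + 1) ^ d" by (simp only: K_def power_mult_distrib mult.assoc)
  also have "\<dots> < (K + 1) ^ Suc d" by simp
  also have "\<dots> \<le> (K + 1) ^ n" using dn by (intro power_increasing) auto
  finally have "card B < card A0" by (simp add: cardA)
  then obtain c where c: "\<exists>xs\<in>A0. c xs \<noteq> 0"
    "\<And>m. m \<in> B \<Longrightarrow> (\<Sum>xs\<in>A0. c xs * lookup (mono_power f 0 xs) m) = 0"
    using homogeneous_system_solution[OF finB finA, of "\<lambda>xs m. lookup (mono_power f 0 xs) m"] by blast
  define A where "A = {xs \<in> A0. c xs \<noteq> 0}"
  have AA0: "A \<subseteq> A0" by (auto simp: A_def)
  let ?p = "\<Sum>xs\<in>A. single 0 (c xs) * mono_power f 0 xs"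
  have lp: "lookup ?p m = (\<Sum>xs\<in>A. c xs * lookup (mono_power f 0 xs) m)" for m
    by (simp add: lookup_sum lookup_scale)
  have lp0: "lookup ?p m = 0" if "m \<in> B" for m
  proof -
    have "lookup ?p m = (\<Sum>xs\<in>A0. c xs * lookup (mono_power f 0 xs) m)"
      unfolding lp by (rule sum.mono_neutral_left[OF finA AA0]) (auto simp: A_def)
    then show ?thesis using c(2)[OF that] by simp
  qed
  note powV = mono_power_polys[of n f, OF f(1)]
  have "?p \<in> sr_ideal V \<F>"
    unfolding mspan_def
  proof clarify
    fix m assume m: "m \<in> keys ?p"
    then have "lookup ?p m \<noteq> 0" by (simp add: in_keys_iff)
    then obtain xs where xs: "xs \<in> A" "lookup (mono_power f 0 xs) m \<noteq> 0"
      unfolding lp using sum.neutral by (metis (no_types, lifting) mult_zero_right)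
    then have "xs \<in> A0" using AA0 by blast
    then have l: "length xs = n" "\<forall>x\<in>set xs. x \<le> K" by (auto simp: A0_def)
    have mk: "m \<in> keys (mono_power f 0 xs)" using xs by (simp add: in_keys_iff)
    have "exp_bounded E (mono_power f 0 xs)"
      using exp_bounded_mono_power[where f = f and n = n and i = 0 and xs = xs and K = K, OF D] l by (simp add: E_def)
    then have "\<forall>x. lookup m x \<le> E" using mk by (simp add: exp_bounded_def)
    then have "\<not> (\<exists>F\<in>\<F>. keys m \<subseteq> F)" using lp0[of m] m by (auto simp: B_def in_keys_iff)
    moreover have "keys m \<subseteq> V" using powV[of 0 xs] mk l by (auto simp: mspan_def)
    ultimately show "m \<in> nonfaces V \<F>" by (simp add: nonfaces_def)
  qed
  then have pN: "?p \<in> N 0" using sub by blast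
  have "A = {}"
  proof (rule ideal_chain_independent[of n V N f 0, OF st mono f nzd one])
    show "finite A" using finA AA0 finite_subset by blast
    show "length xs = n - 0" if "xs \<in> A" for xs using that AA0 by (auto simp: A0_def)
    show "c xs \<noteq> 0" if "xs \<in> A" for xs using that by (simp add: A_def)
  qed (use pN in auto)
  then show False using c(1) by (auto simp: A_def)
qed

text \<open>Graded Nakayama for monomial ideals: let \<open>m\<close> have least degree among the
  monomials in the larger ideal but not in the smaller. A multiplier without constant term could
  produce \<open>m\<close> only from a monomial of lower degree, which lies in the smaller ideal
  together with its multiples. So nothing obtained from the sequence has a term at
  \<open>m\<close>.\<close>

lemma foldl_ext_by_proper:
  assumes V: "finite V" and fs: "\<And>f. f \<in> set fs \<Longrightarrow> f \<in> polys V \<and> lookup f 0 = 0"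
    and L: "\<G> \<subseteq> \<F>" and ne: "m0 \<in> nonfaces V \<G>" "m0 \<notin> nonfaces V \<F>"
  shows "foldl (ext_by (sr_ideal V \<G>)) (sr_ideal V \<F>) fs \<noteq> (sr_ideal V \<G> :: ('v, 'k::field) mpoly set)"
proof -
  let ?L = "sr_ideal V \<G> :: ('v, 'k) mpoly set" and ?K = "sr_ideal V \<F> :: ('v, 'k) mpoly set"
  define deg where "deg m = (\<Sum>x\<in>V. lookup m x)" for m :: "'v \<Rightarrow>\<^sub>0 nat"
  define P where "P m \<longleftrightarrow> m \<in> nonfaces V \<G> \<and> m \<notin> nonfaces V \<F>" for m
  have "P m0" using ne by (simp add: P_def)
  then obtain m where m: "P m" and min: "\<And>m'. P m' \<Longrightarrow> deg m \<le> deg m'"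
    using ex_has_least_nat[of P m0 deg] by blast
  define Z where "Z = {p \<in> ?L. lookup p m = 0}"
  have step: "f * l \<in> Z" if f: "f \<in> polys V" "lookup f 0 = 0" and l: "l \<in> ?L" for f l
  proof -
    have "m \<notin> keys (f * l)"
    proof
      assume "m \<in> keys (f * l)"
      then obtain a b where ab: "a \<in> keys f" "b \<in> keys l" "m = a + b" by (rule keys_mult_elem)
      have aV: "keys a \<subseteq> V" using ab f by (auto simp: mspan_def)
      have "a \<noteq> 0" using ab f by (auto simp: in_keys_iff)
      then obtain x where x: "x \<in> keys a" by (metis all_not_in_conv keys_eq_empty)
      then have "x \<in> V" "0 < lookup a x" using aV by (auto simp: in_keys_iff)
      then have "0 < deg a" unfolding deg_def using V by (meson sum_pos2 zero_le)
      moreover have "deg m = deg a + deg b" by (simp add: deg_def ab lookup_add sum.distrib)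
      ultimately have "\<not> P b" using min[of b] by auto
      then have "b \<in> nonfaces V \<F>" using ab l by (auto simp: P_def mspan_def)
      then have "m \<in> nonfaces V \<F>" using nonfaces_add[OF aV] ab by simp
      then show False using m by (simp add: P_def)
    qed
    then show ?thesis using polys_mult_nonfaces[OF f(1) l] by (simp add: Z_def in_keys_iff)
  qed
  have "foldl (ext_by ?L) K fs \<subseteq> Z" if "K \<subseteq> Z" for K
    using fs that
  proof (induction fs arbitrary: K)
    case (Cons f fs)
    have "ext_by ?L K f \<subseteq> Z"
      using Cons.prems step by (fastforce simp: ext_by_def Z_def lookup_add intro: mspan_add)
    then show ?case using Cons.IH Cons.prems(1) by simp
  qed simp
  moreover have "?K \<subseteq> Z"
    using m mspan_mono[OF nonfaces_antimono[OF L]] by (auto simp: Z_def mspan_def P_def in_keys_iff)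
  ultimately have "foldl (ext_by ?L) ?K fs \<subseteq> Z" by blast
  moreover have "single m 1 \<in> ?L - Z" using m by (simp add: P_def Z_def single_mspan)
  ultimately show ?thesis by blast
qed

lemma esym_lookup_zero: "finite V \<Longrightarrow> 0 < i \<Longrightarrow> lookup (esym V i :: ('v, 'k::field) mpoly) 0 = 0"
proof (rule ccontr)
  assume V: "finite V" "0 < i" and "lookup (esym V i :: ('v, 'k) mpoly) 0 \<noteq> 0"
  then have "0 \<in> keys (esym V i :: ('v, 'k) mpoly)" by (simp add: in_keys_iff)
  then obtain U where U: "0 = sqfree U" "U \<subseteq> V" "card U = i" using keys_esym[OF V(1)] by metis
  then have "U = {}" using keys_sqfree[OF finite_subset[OF U(2) V(1)]] by simp
  then show False using U V by simp
qed

section \<open>The polynomial ring as a ring record\<close>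

lemma mpoly_ring_simps [simp]:
  "carrier (mpoly_ring V) = polys V"
  "add (mpoly_ring V) = (+)" "mult (mpoly_ring V) = (*)"
  "zero (mpoly_ring V) = 0" "one (mpoly_ring V) = 1"
  by (auto simp: mpoly_ring_def mspan_def)

lemma polys_uminus: "p \<in> polys V \<Longrightarrow> - p \<in> polys V"
  using mspan_minus[OF mspan_zero] by force

lemma cring_mpoly_ring: "cring (mpoly_ring V :: ('v, 'k::field) mpoly ring)"
proof (rule cringI)
  show "abelian_group (mpoly_ring V :: ('v, 'k) mpoly ring)"
    by (rule abelian_groupI)
      (auto simp: mspan_add mspan_zero algebra_simps intro!: bexI[of _ "- _"] polys_uminus)
  show "comm_monoid (mpoly_ring V :: ('v, 'k) mpoly ring)"
    by (rule comm_monoidI) (auto simp: polys_mult polys_one algebra_simps)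
qed (simp add: algebra_simps)

lemma ring_mpoly_ring: "ring (mpoly_ring V :: ('v, 'k::field) mpoly ring)"
  using cring_mpoly_ring by (rule cring.axioms)

lemma a_inv_mpoly_ring:
  assumes "p \<in> polys V" shows "\<ominus>\<^bsub>mpoly_ring V\<^esub> p = (- p :: ('v, 'k::field) mpoly)"
proof -
  interpret cring "mpoly_ring V :: ('v, 'k) mpoly ring" by (rule cring_mpoly_ring)
  show ?thesis using assms polys_uminus[OF assms] by (intro minus_equality) auto
qed

lemma ideal_mpoly_ring_iff:
  "ideal I (mpoly_ring V :: ('v, 'k::field) mpoly ring) \<longleftrightarrow> stable (polys V) I \<and> I \<subseteq> polys V"
proof
  let ?R = "mpoly_ring V :: ('v, 'k) mpoly ring"
  assume "ideal I ?R"
  then interpret ideal I ?R .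
  have sub: "I \<subseteq> polys V" using Icarr by auto
  have "p - q \<in> I" if "p \<in> I" "q \<in> I" for p q
  proof -
    have "p \<oplus>\<^bsub>?R\<^esub> (\<ominus>\<^bsub>?R\<^esub> q) \<in> I"
      by (intro additive_subgroup.a_closed[OF additive_subgroup_axioms]
          additive_subgroup.a_inv_closed[OF additive_subgroup_axioms] that)
    then show ?thesis using a_inv_mpoly_ring[OF subsetD[OF sub that(2)]] by simp
  qed
  moreover have "f * p \<in> I" if "f \<in> polys V" "p \<in> I" for f p using I_l_closed[of p f] that by simp
  moreover have "0 \<in> I" using additive_subgroup.zero_closed[OF additive_subgroup_axioms] by simp
  ultimately show "stable (polys V) I \<and> I \<subseteq> polys V" using sub by (simp add: stable_def)
next
  let ?R = "mpoly_ring V :: ('v, 'k) mpoly ring"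
  assume *: "stable (polys V) I \<and> I \<subseteq> polys V"
  note st = stableD[OF conjunct1[OF *]]
  interpret cring ?R by (rule cring_mpoly_ring)
  show "ideal I ?R"
  proof (rule idealI[OF ring_mpoly_ring])
    show "subgroup I (add_monoid ?R)"
    proof (rule add.subgroupI)
      show "I \<subseteq> carrier ?R" using * by simp
      show "I \<noteq> {}" using st(1) by blast
      show "\<ominus>\<^bsub>?R\<^esub> a \<in> I" if "a \<in> I" for a using a_inv_mpoly_ring[of a V] st(4) that * by auto
      show "a \<oplus>\<^bsub>?R\<^esub> b \<in> I" if "a \<in> I" "b \<in> I" for a b using st(3) that by simp
    qed
    show "x \<otimes>\<^bsub>?R\<^esub> a \<in> I" "a \<otimes>\<^bsub>?R\<^esub> x \<in> I" if "a \<in> I" "x \<in> carrier ?R" for a x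
      using st(5)[of x a] that by (simp_all add: mult.commute)
  qed
qed

section \<open>Presentations of modules as subquotients of the polynomial ring\<close>

text \<open>\<open>\<pi>\<close> induces an isomorphism from \<open>L / K\<close> to
  \<open>M\<close>. Quotient records have cosets as elements, and quotients of quotients have sets
  of cosets; this relation lets every module of the filtration be handled by two sets of
  polynomials.\<close>

definition presents :: "'v set \<Rightarrow> ('v, 'k::field) mpoly set \<Rightarrow> ('v, 'k) mpoly set \<Rightarrow>
    (('v, 'k) mpoly \<Rightarrow> 'm) \<Rightarrow> (('v, 'k) mpoly, 'm) module \<Rightarrow> bool" where
  "presents V L K \<pi> M \<longleftrightarrow>
     stable (polys V) L \<and> stable (polys V) K \<and> K \<subseteq> L \<and> carrier M = \<pi> ` L \<and>
     (\<forall>p\<in>L. \<forall>q\<in>L. \<pi> p \<oplus>\<^bsub>M\<^esub> \<pi> q = \<pi> (p + q)) \<and>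
     (\<forall>a\<in>polys V. \<forall>p\<in>L. a \<odot>\<^bsub>M\<^esub> \<pi> p = \<pi> (a * p)) \<and> \<zero>\<^bsub>M\<^esub> = \<pi> 0 \<and>
     (\<forall>p\<in>L. \<forall>q\<in>L. \<pi> p = \<pi> q \<longleftrightarrow> p - q \<in> K)"

lemma presentsD:
  assumes "presents V L K \<pi> M"
  shows "stable (polys V) L" "stable (polys V) K" "K \<subseteq> L" "carrier M = \<pi> ` L"
    "\<And>p q. p \<in> L \<Longrightarrow> q \<in> L \<Longrightarrow> \<pi> p \<oplus>\<^bsub>M\<^esub> \<pi> q = \<pi> (p + q)"
    "\<And>a p. a \<in> polys V \<Longrightarrow> p \<in> L \<Longrightarrow> a \<odot>\<^bsub>M\<^esub> \<pi> p = \<pi> (a * p)" "\<zero>\<^bsub>M\<^esub> = \<pi> 0"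
    "\<And>p q. p \<in> L \<Longrightarrow> q \<in> L \<Longrightarrow> \<pi> p = \<pi> q \<longleftrightarrow> p - q \<in> K"
  using assms by (simp_all add: presents_def)

lemma presents_zero_iff: "presents V L K \<pi> M \<Longrightarrow> p \<in> L \<Longrightarrow> \<pi> p = \<zero>\<^bsub>M\<^esub> \<longleftrightarrow> p \<in> K"
  using presentsD(7,8)[of V L K \<pi> M] stableD(1)[OF presentsD(1)[of V L K \<pi> M]] by simp

lemma presents_self_module: "presents V (polys V) {0} (\<lambda>p. p) (self_module (mpoly_ring V))"
  using stable_nonfaces[of "polys V" V "{}"]
  by (auto simp: presents_def self_module_def nonfaces_empty mspan_zero stable_def)

lemma presents_coset:
  assumes pr: "presents V L K \<pi> M" and K': "K \<subseteq> K'" "K' \<subseteq> L" and p: "p \<in> L"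
  shows "\<pi> ` K' +>\<^bsub>M\<^esub> \<pi> p = \<pi> ` ((\<lambda>k. k + p) ` K')"
proof -
  have "\<pi> ` K' +>\<^bsub>M\<^esub> \<pi> p = (\<lambda>k. \<pi> k \<oplus>\<^bsub>M\<^esub> \<pi> p) ` K'" by (auto simp: a_r_coset_def')
  also have "\<dots> = (\<lambda>k. \<pi> (k + p)) ` K'"
    using presentsD(5)[OF pr _ p] K' by (intro image_cong) auto
  finally show ?thesis by (simp add: image_image)
qed

text \<open>A further quotient keeps \<open>L\<close> and replaces \<open>K\<close> by
  \<open>K'\<close>, whatever the nesting of cosets in the carrier.\<close>

lemma presents_quot_module:
  assumes pr: "presents V L K \<pi> M" and K': "K \<subseteq> K'" "K' \<subseteq> L" "stable (polys V) K'"
  shows "presents V L K' (\<lambda>p. \<pi> ` K' +>\<^bsub>M\<^esub> \<pi> p) (quot_module M (\<pi> ` K'))"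
proof -
  note D = presentsD[OF pr]
  note L = stableD[OF D(1)] and st = stableD[OF K'(3)]
  let ?c = "\<lambda>p. \<pi> ` K' +>\<^bsub>M\<^esub> \<pi> p"
  note c = presents_coset[OF pr K'(1,2)]
  have eq: "?c p = ?c q \<longleftrightarrow> p - q \<in> K'" if p: "p \<in> L" and q: "q \<in> L" for p q
  proof
    assume "?c p = ?c q"
    then have "\<pi> (0 + p) \<in> \<pi> ` ((\<lambda>k. k + q) ` K')" using c[OF p] c[OF q] st(1) by blast
    then obtain k where k: "k \<in> K'" "\<pi> p = \<pi> (k + q)" by auto
    then have "p - (k + q) \<in> K'" using D(8)[OF p L(3)[of k q]] K' q by auto
    then have "(p - (k + q)) + k \<in> K'" using st(3) k by blast
    then show "p - q \<in> K'" by simp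
  next
    assume pq: "p - q \<in> K'"
    have "(\<lambda>k. k + p) ` K' = (\<lambda>k. k + q) ` K'"
    proof (intro equalityI subsetI)
      fix x assume "x \<in> (\<lambda>k. k + p) ` K'"
      then obtain k where "k \<in> K'" "x = (k + (p - q)) + q" by auto
      then show "x \<in> (\<lambda>k. k + q) ` K'" using st(3)[OF _ pq] by blast
    next
      fix x assume "x \<in> (\<lambda>k. k + q) ` K'"
      then obtain k where "k \<in> K'" "x = (k - (p - q)) + p" by auto
      then show "x \<in> (\<lambda>k. k + p) ` K'" using st(2)[OF _ pq] by blast
    qed
    then show "?c p = ?c q" using c[OF p] c[OF q] by simp
  qed
  have add: "?c p <+>\<^bsub>M\<^esub> ?c q = ?c (p + q)" if p: "p \<in> L" and q: "q \<in> L" for p q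
  proof -
    have pi: "\<pi> (k + p) \<oplus>\<^bsub>M\<^esub> \<pi> (k' + q) = \<pi> ((k + k') + (p + q))" if "k \<in> K'" "k' \<in> K'" for k k'
      using D(5)[OF L(3)[of k p] L(3)[of k' q]] that K' p q by (auto simp: algebra_simps)
    have "?c p <+>\<^bsub>M\<^esub> ?c q = (\<Union>k\<in>K'. \<Union>k'\<in>K'. {\<pi> ((k + k') + (p + q))})"
      unfolding c[OF p] c[OF q] set_add_def' by (simp add: pi)
    also have "\<dots> = \<pi> ` ((\<lambda>k. k + (p + q)) ` K')"
    proof (intro equalityI subsetI)
      fix x assume "x \<in> (\<Union>k\<in>K'. \<Union>k'\<in>K'. {\<pi> ((k + k') + (p + q))})"
      then show "x \<in> \<pi> ` ((\<lambda>k. k + (p + q)) ` K')" using st(3) by blast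
    next
      fix x assume "x \<in> \<pi> ` ((\<lambda>k. k + (p + q)) ` K')"
      then obtain k where "k \<in> K'" "x = \<pi> ((k + 0) + (p + q))" by auto
      then show "x \<in> (\<Union>k\<in>K'. \<Union>k'\<in>K'. {\<pi> ((k + k') + (p + q))})" using st(1) by blast
    qed
    finally show ?thesis using c[OF L(3)[OF p q]] by simp
  qed
  have smult: "(\<Union>x\<in>?c p. \<pi> ` K' +>\<^bsub>M\<^esub> (a \<odot>\<^bsub>M\<^esub> x)) = ?c (a * p)" if a: "a \<in> polys V" and p: "p \<in> L" for a p
  proof -
    have "\<pi> ` K' +>\<^bsub>M\<^esub> (a \<odot>\<^bsub>M\<^esub> \<pi> (k + p)) = ?c (a * p)" if k: "k \<in> K'" for k
    proof -
      have kp: "k + p \<in> L" using L(3) K' k p by blast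
      have "a * (k + p) - a * p = a * k" by (simp add: algebra_simps)
      then have "?c (a * (k + p)) = ?c (a * p)"
        using eq[OF L(5)[OF a kp] L(5)[OF a p]] st(5)[OF a k] by simp
      then show ?thesis using D(6)[OF a kp] by simp
    qed
    then show ?thesis unfolding c[OF p] using st(1) by auto
  qed
  have zero: "\<pi> ` K' = ?c 0" using c[OF L(1)] by simp
  have carr: "a_rcosets\<^bsub>M\<^esub> (\<pi> ` K') = ?c ` L"
    unfolding A_RCOSETS_def' D(4) by auto
  show ?thesis
    unfolding presents_def quot_module_def
    using D(1) K' eq add smult zero carr by simp
qed

lemma presents_carrier_update:
  assumes pr: "presents V L K \<pi> M" and L': "K \<subseteq> L'" "L' \<subseteq> L" "stable (polys V) L'"
  shows "presents V L' K \<pi> (M\<lparr>carrier := \<pi> ` L'\<rparr>)"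
  using pr L' unfolding presents_def by (simp add: subset_iff)

lemma presents_abelian_group:
  assumes pr: "presents V L K \<pi> M" shows "abelian_group M"
proof -
  note D = presentsD[OF pr] note L = stableD[OF D(1)]
  show ?thesis
  proof (rule abelian_groupI)
    fix x assume "x \<in> carrier M"
    then obtain p where "p \<in> L" "x = \<pi> p" using D(4) by auto
    then have "\<pi> (- p) \<oplus>\<^bsub>M\<^esub> x = \<zero>\<^bsub>M\<^esub>" "\<pi> (- p) \<in> carrier M" using D(4,5,7) L(4) by auto
    then show "\<exists>y\<in>carrier M. y \<oplus>\<^bsub>M\<^esub> x = \<zero>\<^bsub>M\<^esub>" by blast
  qed (auto simp: D(4,5,7) L(1,3) ac_simps)
qed

lemma presents_submodule:
  assumes pr: "presents V L K \<pi> M" and L': "L' \<subseteq> L" "stable (polys V) L'"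
  shows "submodule (\<pi> ` L') (mpoly_ring V) M"
proof -
  note D = presentsD[OF pr] note L = stableD[OF D(1)] and st = stableD[OF L'(2)]
  interpret abelian_group M by (rule presents_abelian_group[OF pr])
  show ?thesis
  proof (intro submodule.intro submodule_axioms.intro add.subgroupI)
    show "\<pi> ` L' \<subseteq> carrier M" using D(4) L' by auto
    show "\<pi> ` L' \<noteq> {}" using st(1) by blast
    show "\<ominus>\<^bsub>M\<^esub> a \<in> \<pi> ` L'" if a: "a \<in> \<pi> ` L'" for a
    proof -
      obtain p where p: "p \<in> L'" "a = \<pi> p" using a by blast
      then have "p \<in> L" "- p \<in> L" using L' L(4) by auto
      then have "\<ominus>\<^bsub>M\<^esub> a = \<pi> (- p)" using D(4,5,7) p by (intro minus_equality) auto
      then show ?thesis using st(4)[OF p(1)] by blast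
    qed
    show "a \<oplus>\<^bsub>M\<^esub> b \<in> \<pi> ` L'" if ab: "a \<in> \<pi> ` L'" "b \<in> \<pi> ` L'" for a b
    proof -
      obtain p q where "p \<in> L'" "q \<in> L'" "a = \<pi> p" "b = \<pi> q" using ab by blast
      then show ?thesis using D(5)[of p q] L' st(3)[of p q] by auto
    qed
    show "a \<odot>\<^bsub>M\<^esub> x \<in> \<pi> ` L'" if ax: "a \<in> carrier (mpoly_ring V)" "x \<in> \<pi> ` L'" for a x
    proof -
      obtain p where "p \<in> L'" "x = \<pi> p" using ax by blast
      then show ?thesis using D(6)[of a p] L' st(5)[of a p] ax by auto
    qed
  qed
qed

text \<open>Together with \<open>presents_submodule\<close> this is the correspondence between
  submodules of \<open>M\<close> and stable sets between \<open>K\<close> and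
  \<open>L\<close>.\<close>

lemma presents_submodule_vimage:
  assumes pr: "presents V L K \<pi> M" and N: "submodule N (mpoly_ring V) M"
  shows "N \<subseteq> \<pi> ` L" "K \<subseteq> {p \<in> L. \<pi> p \<in> N}" "stable (polys V) {p \<in> L. \<pi> p \<in> N}"
proof -
  note D = presentsD[OF pr] note L = stableD[OF D(1)]
  interpret submodule N "mpoly_ring V" M by (rule N)
  show "N \<subseteq> \<pi> ` L" using subset D(4) by simp
  have zero: "\<pi> 0 \<in> N" using one_closed D(7) by simp
  show "K \<subseteq> {p \<in> L. \<pi> p \<in> N}" 
  proof
    fix p assume "p \<in> K"
    then have "p \<in> L" "\<pi> p = \<pi> 0" using presents_zero_iff[OF pr, of p] D(3,7) by auto
    then show "p \<in> {p \<in> L. \<pi> p \<in> N}" using zero by simp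
  qed
  have sm: "\<pi> (a * p) \<in> N" if "a \<in> polys V" "p \<in> L" "\<pi> p \<in> N" for a p
    using smult_closed[of a "\<pi> p"] D(6)[OF that(1,2)] that by simp
  have ad: "\<pi> (p + q) \<in> N" if "p \<in> L" "q \<in> L" "\<pi> p \<in> N" "\<pi> q \<in> N" for p q
    using m_closed[of "\<pi> p" "\<pi> q"] D(5)[OF that(1,2)] that by simp
  have "\<pi> (p - q) \<in> N" if "p \<in> L" "q \<in> L" "\<pi> p \<in> N" "\<pi> q \<in> N" for p q
    using ad[OF that(1) L(4)[OF that(2)] that(3)] sm[OF polys_uminus[OF polys_one], of q] that by simp
  then show "stable (polys V) {p \<in> L. \<pi> p \<in> N}"
    unfolding stable_def using L zero sm by auto
qed

section \<open>Regular sequences on presented modules\<close>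

lemma foldl_ext_by_stable:
  assumes "stable A L" "stable A K" "set fs \<subseteq> A" "K \<subseteq> L"
  shows "stable A (foldl (ext_by L) K fs)" "K \<subseteq> foldl (ext_by L) K fs" "foldl (ext_by L) K fs \<subseteq> L"
proof -
  have "stable A (foldl (ext_by L) K fs) \<and> K \<subseteq> foldl (ext_by L) K fs \<and> foldl (ext_by L) K fs \<subseteq> L"
    using assms(2-)
  proof (induction fs arbitrary: K)
    case (Cons f fs)
    have "ext_by L K f \<subseteq> L"
      using stable_mono[OF assms(1), of "{f}"] Cons.prems by (intro ext_by_subset) auto
    then show ?case
      using Cons.IH[OF stable_ext_by[OF assms(1) Cons.prems(1), of f]] Cons.prems
        ext_by_superset[OF stableD(1)[OF assms(1)], of K f] by auto
  qed simp
  then show "stable A (foldl (ext_by L) K fs)" "K \<subseteq> foldl (ext_by L) K fs" "foldl (ext_by L) K fs \<subseteq> L"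
    by auto
qed

lemma foldl_ext_by_mem:
  assumes "stable A L" "stable A K" "set fs \<subseteq> A" "K \<subseteq> L" "f \<in> set fs" "p \<in> L"
  shows "f * p \<in> foldl (ext_by L) K fs"
  using assms(2-)
proof (induction fs arbitrary: K)
  case (Cons g fs)
  have sub: "ext_by L K g \<subseteq> L"
    using stable_mono[OF assms(1), of "{g}"] Cons.prems by (intro ext_by_subset) auto
  have st: "stable A (ext_by L K g)" by (rule stable_ext_by[OF assms(1) Cons.prems(1)])
  show ?case
  proof (cases "f = g")
    case True
    have "0 + f * p \<in> ext_by L K g"
      unfolding True using stableD(1)[OF Cons.prems(1)] Cons.prems(5) by (rule ext_byI)
    then show ?thesis using foldl_ext_by_stable(2)[OF assms(1) st _ sub, of fs] Cons.prems by auto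
  next
    case False
    then show ?thesis using Cons.IH[OF st _ sub] Cons.prems by auto
  qed
qed simp

lemma foldl_ext_by_least:
  assumes "stable A N" "K \<subseteq> N" "\<And>f p. f \<in> set fs \<Longrightarrow> p \<in> L \<Longrightarrow> f * p \<in> N"
  shows "foldl (ext_by L) K fs \<subseteq> N"
  using assms(2,3)
proof (induction fs arbitrary: K)
  case (Cons f fs)
  have "ext_by L K f \<subseteq> N"
    using Cons.prems stableD(3)[OF assms(1)] by (auto simp: ext_by_def)
  then show ?case using Cons by simp
qed simp

lemma presents_list_times_module:
  assumes pr: "presents V L K \<pi> M" and fs: "set fs \<subseteq> polys V"
  shows "list_times_module (mpoly_ring V) M fs = \<pi> ` foldl (ext_by L) K fs"
proof -
  note D = presentsD[OF pr]
  note F = foldl_ext_by_stable[OF D(1,2) fs D(3)]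
  let ?X = "{f \<odot>\<^bsub>M\<^esub> x | f x. f \<in> set fs \<and> x \<in> carrier M}"
  show ?thesis
    unfolding list_times_module_def submodule_span_def
  proof (intro equalityI Inter_lower Inter_greatest)
    have "?X \<subseteq> \<pi> ` foldl (ext_by L) K fs"
    proof
      fix y assume "y \<in> ?X"
      then obtain f p where fp: "f \<in> set fs" "p \<in> L" "y = f \<odot>\<^bsub>M\<^esub> \<pi> p" using D(4) by auto
      then show "y \<in> \<pi> ` foldl (ext_by L) K fs"
        using D(6)[of f p] fs foldl_ext_by_mem[OF D(1,2) fs D(3) fp(1,2)] by auto
    qed
    then show "\<pi> ` foldl (ext_by L) K fs \<in> {N. submodule N (mpoly_ring V) M \<and> ?X \<subseteq> N}"
      using presents_submodule[OF pr F(3,1)] by blast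
  next
    fix N assume N: "N \<in> {N. submodule N (mpoly_ring V) M \<and> ?X \<subseteq> N}"
    note vi = presents_submodule_vimage[OF pr, of N]
    have "foldl (ext_by L) K fs \<subseteq> {p \<in> L. \<pi> p \<in> N}"
    proof (rule foldl_ext_by_least)
      show "stable (polys V) {p \<in> L. \<pi> p \<in> N}" "K \<subseteq> {p \<in> L. \<pi> p \<in> N}" using vi N by auto
      fix f p assume fp: "f \<in> set fs" "p \<in> L"
      then have "f \<odot>\<^bsub>M\<^esub> \<pi> p \<in> N" using N D(4) by blast
      then show "f * p \<in> {p \<in> L. \<pi> p \<in> N}"
        using D(6)[of f p] fp fs stableD(5)[OF D(1), of f p] by auto
    qed
    then show "\<pi> ` foldl (ext_by L) K fs \<subseteq> N" by blast
  qed
qed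

lemma presents_nonzerodivisor_on:
  assumes pr: "presents V L K \<pi> M" and f: "f \<in> polys V"
  shows "nonzerodivisor_on M f \<longleftrightarrow> (\<forall>p\<in>L. f * p \<in> K \<longrightarrow> p \<in> K)"
proof -
  note D = presentsD[OF pr] note L = stableD[OF D(1)]
  have "(f \<odot>\<^bsub>M\<^esub> \<pi> p = \<zero>\<^bsub>M\<^esub> \<longrightarrow> \<pi> p = \<zero>\<^bsub>M\<^esub>) \<longleftrightarrow> (f * p \<in> K \<longrightarrow> p \<in> K)" if "p \<in> L" for p
    using D(6)[OF f that] presents_zero_iff[OF pr that] presents_zero_iff[OF pr L(5)[OF f that]] by simp
  then show ?thesis unfolding nonzerodivisor_on_def D(4) by simp
qed

text \<open>Regularity on iterated quotient records becomes a statement on polynomials. Properness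
  transfers because both sets contain \<open>K\<close>, so that equal images under
  \<open>\<pi>\<close> mean equal sets.\<close>

lemma presents_regular_sequence:
  assumes pr: "presents V L K \<pi> M"
  shows "regular_sequence (mpoly_ring V) M fs \<longleftrightarrow> set fs \<subseteq> polys V \<and>
     (\<forall>i<length fs. \<forall>p\<in>L. fs ! i * p \<in> foldl (ext_by L) K (take i fs) \<longrightarrow>
        p \<in> foldl (ext_by L) K (take i fs)) \<and> foldl (ext_by L) K fs \<noteq> L"
proof (cases "set fs \<subseteq> polys V")
  case fs: True
  note D = presentsD[OF pr]
  note F = foldl_ext_by_stable[OF D(1,2) _ D(3)]
  have "nonzerodivisor_on (quot_module M (list_times_module (mpoly_ring V) M (take i fs))) (fs ! i) \<longleftrightarrow>
      (\<forall>p\<in>L. fs ! i * p \<in> foldl (ext_by L) K (take i fs) \<longrightarrow> p \<in> foldl (ext_by L) K (take i fs))"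
    if i: "i < length fs" for i
  proof -
    have t: "set (take i fs) \<subseteq> polys V" using fs set_take_subset by fast
    have "fs ! i \<in> polys V" using fs i nth_mem by blast
    then show ?thesis
      unfolding presents_list_times_module[OF pr t]
      by (rule presents_nonzerodivisor_on[OF presents_quot_module[OF pr F(2,3,1)[OF t]]])
  qed
  moreover have "\<pi> ` foldl (ext_by L) K fs = \<pi> ` L \<longleftrightarrow> foldl (ext_by L) K fs = L"
  proof
    assume eq: "\<pi> ` foldl (ext_by L) K fs = \<pi> ` L"
    have "p \<in> foldl (ext_by L) K fs" if p: "p \<in> L" for p
    proof -
      obtain q where q: "q \<in> foldl (ext_by L) K fs" "\<pi> p = \<pi> q" using eq p by blast
      then have "p - q \<in> K" using D(8)[OF p] F(3)[OF fs] by blast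
      then have "(p - q) + q \<in> foldl (ext_by L) K fs"
        using q F(2)[OF fs] stableD(3)[OF F(1)[OF fs]] by blast
      then show ?thesis by simp
    qed
    then show "foldl (ext_by L) K fs = L" using F(3)[OF fs] by blast
  qed simp
  ultimately show ?thesis
    unfolding regular_sequence_def presents_list_times_module[OF pr fs] D(4) using fs by simp
next
  case False
  then show ?thesis by (simp add: regular_sequence_def)
qed

lemma presents_annihilator:
  assumes pr: "presents V L K \<pi> M"
  shows "annihilator (mpoly_ring V) M = {a \<in> polys V. \<forall>p\<in>L. a * p \<in> K}"
proof -
  note D = presentsD[OF pr] note L = stableD[OF D(1)]
  have "a \<odot>\<^bsub>M\<^esub> \<pi> p = \<zero>\<^bsub>M\<^esub> \<longleftrightarrow> a * p \<in> K" if "a \<in> polys V" "p \<in> L" for a p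
    using D(6)[OF that] presents_zero_iff[OF pr L(5)[OF that]] by simp
  then show ?thesis unfolding annihilator_def D(4) by auto
qed

lemma stable_colon:
  assumes "stable (polys V) L" "stable (polys V) K"
  shows "stable (polys V) {a \<in> polys V. \<forall>p\<in>L. a * p \<in> K}"
proof -
  note K = stableD[OF assms(2)] and L = stableD[OF assms(1)]
  show ?thesis
    unfolding stable_def
    using K mspan_minus polys_mult by (auto simp: mspan_zero left_diff_distrib mult.assoc)
qed

text \<open>The chain consists of the colon ideals \<open>N i\<close> of multipliers that send
  \<open>L\<close> into \<open>X i\<close>, the set reached from \<open>K\<close> after
  \<open>i\<close> members of the sequence. Each member lies in the next colon ideal and is a
  nonzerodivisor modulo its own, and properness keeps \<open>1\<close> out of the last.\<close>

lemma regular_sequence_length_le: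
  assumes pr: "presents V L K \<pi> M" and reg: "regular_sequence (mpoly_ring V) M fs"
    and \<F>: "finite \<F>" "\<And>F. F \<in> \<F> \<Longrightarrow> finite F \<and> card F \<le> d"
    and J: "\<And>a p. a \<in> sr_ideal V \<F> \<Longrightarrow> p \<in> L \<Longrightarrow> a * p \<in> K"
  shows "length fs \<le> d"
proof -
  note D = presentsD[OF pr] note L = stableD[OF D(1)]
  have fs: "set fs \<subseteq> polys V"
    and nzd: "\<And>i p. i < length fs \<Longrightarrow> p \<in> L \<Longrightarrow> fs ! i * p \<in> foldl (ext_by L) K (take i fs) \<Longrightarrow>
        p \<in> foldl (ext_by L) K (take i fs)"
    and ne: "foldl (ext_by L) K fs \<noteq> L"
    using reg presents_regular_sequence[OF pr] by auto
  define X where "X i = foldl (ext_by L) K (take i fs)" for i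
  define N where "N i = {a \<in> polys V. \<forall>p\<in>L. a * p \<in> X i}" for i
  have t: "set (take i fs) \<subseteq> polys V" for i using fs set_take_subset by fast
  note F = foldl_ext_by_stable[OF D(1,2) t D(3), folded X_def]
  have stN: "stable (polys V) (N i)" for i unfolding N_def by (rule stable_colon[OF D(1) F(1)])
  have X_Suc: "X (Suc i) = ext_by L (X i) (fs ! i)" if "i < length fs" for i
    using that by (simp add: X_def take_Suc_conv_app_nth)
  show ?thesis
  proof (rule ideal_chain_length[where N = N and f = "(!) fs" and V = V and \<F> = \<F>])
    show "stable (polys V) (N i)" for i by (rule stN)
    show "N i \<subseteq> N (Suc i)" if "i < length fs" for i
      using ext_by_superset[OF L(1), of "X i" "fs ! i"] X_Suc[OF that] by (auto simp: N_def)
    show fi: "fs ! i \<in> polys V" if "i < length fs" for i using fs nth_mem[OF that] by blast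
    show "fs ! i \<in> N (Suc i)" if "i < length fs" for i
      using ext_byI[OF stableD(1)[OF F(1)], of _ L "fs ! i" i] X_Suc[OF that] fi[OF that]
      by (auto simp: N_def)
    show "r \<in> N i" if "i < length fs" "r \<in> polys V" "fs ! i * r \<in> N i" for i r
      using that nzd[OF that(1) L(5)[OF that(2)]] by (auto simp: N_def X_def mult.assoc)
    show "1 \<notin> N (length fs)" using ne F(3)[of "length fs"] by (auto simp: N_def X_def)
    show "sr_ideal V \<F> \<subseteq> N 0"
      using J nonfaces_polys by (fastforce simp: N_def X_def)
  qed (use \<F> in auto)
qed

section \<open>Krull dimension of quotients of the polynomial ring\<close>

lemma carrier_FactRing: "carrier (R Quot I) = (+>\<^bsub>R\<^esub>) I ` carrier R"
  by (auto simp: FactRing_def A_RCOSETS_def')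

text \<open>The preimages \<open>N i\<close> of the primes form the chain. An element of
  \<open>N (Suc i)\<close> outside the prime \<open>N i\<close> is a nonzerodivisor modulo
  \<open>N i\<close>, so \<open>ideal_chain_length\<close> applies.\<close>

lemma krull_dim_quotient_le:
  fixes A :: "('v, 'k::field) mpoly set"
  assumes A: "ideal A (mpoly_ring V)" and J: "sr_ideal V \<F> \<subseteq> A"
    and \<F>: "finite \<F>" "\<And>F. F \<in> \<F> \<Longrightarrow> finite F \<and> card F \<le> d"
  shows "krull_dim (mpoly_ring V Quot A) \<le> enat d"
  unfolding krull_dim_def
proof (rule Sup_least, clarify)
  let ?R = "mpoly_ring V :: ('v, 'k) mpoly ring"
  let ?h = "\<lambda>r. A +>\<^bsub>?R\<^esub> r"
  fix n P assume P: "\<forall>i\<le>n. primeideal (P i) (?R Quot A)" "\<forall>i<n. P i \<subset> P (Suc i)"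
  interpret A: ideal A ?R by (rule A)
  interpret h: ring_hom_ring ?R "?R Quot A" ?h by (rule A.rcos_ring_hom_ring)
  define N where "N i = {r \<in> carrier ?R. ?h r \<in> P i}" for i
  have prime: "primeideal (N i) ?R" if "i \<le> n" for i
    unfolding N_def using P(1) that by (intro h.primeideal_vimage cring_mpoly_ring) blast
  have st: "stable (polys V) (N i)" if "i \<le> n" for i
    using primeideal.axioms(1)[OF prime[OF that]] ideal_mpoly_ring_iff by blast
  have "\<exists>r. r \<in> N (Suc i) \<and> r \<notin> N i" if i: "i < n" for i
  proof -
    obtain Y where Y: "Y \<in> P (Suc i)" "Y \<notin> P i" using P(2) i by blast
    have "ideal (P (Suc i)) (?R Quot A)" using P(1) i by (auto intro: primeideal.axioms(1))
    then have "Y \<in> carrier (?R Quot A)" using Y(1) by (rule ideal.Icarr)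
    then obtain r where "r \<in> carrier ?R" "Y = ?h r"
      by (auto simp: carrier_FactRing)
    then show ?thesis using Y by (auto simp: N_def)
  qed
  then obtain f where f: "\<And>i. i < n \<Longrightarrow> f i \<in> N (Suc i)" "\<And>i. i < n \<Longrightarrow> f i \<notin> N i" by metis
  have NV: "N i \<subseteq> polys V" for i by (auto simp: N_def)
  have "n \<le> d"
  proof (rule ideal_chain_length[where N = N and f = f and V = V and \<F> = \<F>])
    show "stable (polys V) (N i)" if "i \<le> n" for i by (rule st[OF that])
    show "N i \<subseteq> N (Suc i)" if "i < n" for i using P(2) that by (auto simp: N_def)
    show "f i \<in> N (Suc i)" if "i < n" for i using f(1) that .
    show "f i \<in> polys V" if "i < n" for i using f(1)[OF that] NV by blast
    show "r \<in> N i" if "i < n" "r \<in> polys V" "f i * r \<in> N i" for i r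
    proof -
      have "f i \<in> carrier ?R" "r \<in> carrier ?R" "f i \<otimes>\<^bsub>?R\<^esub> r \<in> N i"
        using f(1)[OF that(1)] NV that by auto
      then show ?thesis using primeideal.I_prime[OF prime[of i]] f(2)[OF that(1)] that(1) by fastforce
    qed
    show "1 \<notin> N n"
    proof
      assume "1 \<in> N n"
      then have "N n = carrier ?R"
        using ideal.one_imp_carrier[OF primeideal.axioms(1)[OF prime[of n]]] by simp
      then show False using primeideal.I_notcarr[OF prime[of n]] by simp
    qed
    have "A \<subseteq> N 0"
    proof
      fix a assume a: "a \<in> A"
      then have aV: "a \<in> carrier ?R" by (rule A.Icarr)
      have "?h a = A" using a by (rule A.a_rcos_const)
      moreover have "additive_subgroup (P 0) (?R Quot A)" using P(1) by (auto intro: ideal.axioms primeideal.axioms(1))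
      then have "\<zero>\<^bsub>?R Quot A\<^esub> \<in> P 0" by (rule additive_subgroup.zero_closed)
      then have "A \<in> P 0" by (simp add: FactRing_def)
      ultimately show "a \<in> N 0" using aV by (simp add: N_def)
    qed
    then show "sr_ideal V \<F> \<subseteq> N 0" using J by blast
  qed (use \<F> in auto)
  then show "enat n \<le> enat d" by simp
qed

lemma primeideal_image_quotient:
  assumes "cring R" "ideal I R" "primeideal P R" "I \<subseteq> P"
  shows "primeideal ((+>\<^bsub>R\<^esub>) I ` P) (R Quot I)"
proof -
  interpret cring R by fact
  interpret I: ideal I R by fact
  interpret P: primeideal P R by fact
  let ?h = "\<lambda>r. I +>\<^bsub>R\<^esub> r"
  interpret h: ring_hom_ring R "R Quot I" ?h by (rule I.rcos_ring_hom_ring)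
  have mem: "r \<in> P" if r: "r \<in> carrier R" "?h r \<in> ?h ` P" for r
  proof -
    obtain p where p: "p \<in> P" "?h r = ?h p" using r by blast
    then have "r \<ominus>\<^bsub>R\<^esub> p \<in> I"
      using quotient_eq_iff_same_a_r_cos[OF assms(2) r(1) P.Icarr[OF p(1)]] by simp
    then have "(r \<ominus>\<^bsub>R\<^esub> p) \<oplus>\<^bsub>R\<^esub> p \<in> P" using P.a_closed p assms(4) by blast
    moreover have "(r \<ominus>\<^bsub>R\<^esub> p) \<oplus>\<^bsub>R\<^esub> p = r"
      using r(1) P.Icarr[OF p(1)] by (simp add: a_minus_def a_assoc l_neg)
    ultimately show ?thesis by simp
  qed
  note carr = carrier_FactRing[of R I]
  show ?thesis
  proof (rule primeidealI)
    show "ideal (?h ` P) (R Quot I)" by (rule ring_ideal_imp_quot_ideal[OF assms(2) P.is_ideal])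
    show "cring (R Quot I)" by (rule I.quotient_is_cring[OF assms(1)])
    show "carrier (R Quot I) \<noteq> ?h ` P"
    proof
      assume eq: "carrier (R Quot I) = ?h ` P"
      have "carrier R \<subseteq> P"
      proof
        fix r assume r: "r \<in> carrier R"
        then have "?h r \<in> ?h ` P" unfolding eq[symmetric] carr by (rule imageI)
        then show "r \<in> P" by (rule mem[OF r])
      qed
      then show False using P.I_notcarr P.a_subset by blast
    qed
    fix a b assume "a \<in> carrier (R Quot I)" "b \<in> carrier (R Quot I)" and ab: "a \<otimes>\<^bsub>R Quot I\<^esub> b \<in> ?h ` P"
    then obtain x y where xy: "x \<in> carrier R" "y \<in> carrier R" "a = ?h x" "b = ?h y" using carr by auto
    then have "?h (x \<otimes>\<^bsub>R\<^esub> y) \<in> ?h ` P" using ab by simp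
    then have "x \<otimes>\<^bsub>R\<^esub> y \<in> P" using mem xy by blast
    then show "a \<in> ?h ` P \<or> b \<in> ?h ` P" using P.I_prime xy by blast
  qed
qed

lemma primeideal_nonfaces_simplex:
  assumes "finite F"
  shows "primeideal (sr_ideal V {F}) (mpoly_ring V :: ('v, 'k::field) mpoly ring)"
proof (rule primeidealI)
  let ?P = "sr_ideal V {F} :: ('v, 'k) mpoly set"
  show "ideal ?P (mpoly_ring V)"
    by (simp add: ideal_mpoly_ring_iff stable_nonfaces nonfaces_polys)
  show "cring (mpoly_ring V :: ('v, 'k) mpoly ring)" by (rule cring_mpoly_ring)
  have "1 \<notin> ?P" by (simp add: mspan_def nonfaces_def)
  then show "carrier (mpoly_ring V) \<noteq> ?P" using polys_one by auto
  fix a b :: "('v, 'k) mpoly"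
  assume "a \<in> carrier (mpoly_ring V)" "b \<in> carrier (mpoly_ring V)" "a \<otimes>\<^bsub>mpoly_ring V\<^esub> b \<in> ?P"
  then show "a \<in> ?P \<or> b \<in> ?P" using nonfaces_simplex_prime[OF assms] by simp
qed

text \<open>Removing the vertices of \<open>F\<close> one at a time gives a strictly increasing
  chain of monomial primes, which stays strict in the quotient because all its members contain
  \<open>A\<close>.\<close>

lemma krull_dim_quotient_ge:
  fixes A :: "('v, 'k::field) mpoly set"
  assumes A: "ideal A (mpoly_ring V)" and sub: "A \<subseteq> sr_ideal V {F}" and F: "F \<subseteq> V" "finite F"
  shows "enat (card F) \<le> krull_dim (mpoly_ring V Quot A)"
proof -
  let ?R = "mpoly_ring V :: ('v, 'k) mpoly ring"
  let ?h = "\<lambda>r. A +>\<^bsub>?R\<^esub> r"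
  interpret A: ideal A ?R by (rule A)
  obtain f where f: "bij_betw f {0..<card F} F" using ex_bij_betw_nat_finite[OF F(2)] by blast
  define E where "E i = f ` {i..<card F}" for i
  have E: "E i \<subseteq> F" for i using f by (auto simp: E_def bij_betw_def)
  have E0: "E 0 = F" using f by (simp add: E_def bij_betw_def)
  have ESuc: "E (Suc i) = E i - {f i}" "f i \<in> E i" if "i < card F" for i
  proof -
    have "{i..<card F} = insert i {Suc i..<card F}" using that by auto
    moreover have "f j \<noteq> f i" if "j \<in> {Suc i..<card F}" for j
      using f that \<open>i < card F\<close> inj_onD[of f "{0..<card F}" i j] by (auto simp: bij_betw_def)
    ultimately show "E (Suc i) = E i - {f i}" "f i \<in> E i" by (auto simp: E_def)
  qed
  define Q where "Q i = (sr_ideal V {E i} :: ('v, 'k) mpoly set)" for i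
  have strict: "Q i \<subset> Q (Suc i)" if "i < card F" for i
    unfolding Q_def ESuc(1)[OF that] by (rule nonfaces_simplex_strict) (use E F ESuc(2)[OF that] in auto)
  have prime: "primeideal (Q i) ?R" for i
    unfolding Q_def using E F finite_subset by (intro primeideal_nonfaces_simplex) blast
  have AQ: "A \<subseteq> Q i" for i
  proof -
    have "Q 0 \<subseteq> Q i" unfolding Q_def E0 using E by (intro mspan_mono) (auto simp: nonfaces_def)
    then show ?thesis using sub by (auto simp: Q_def E0)
  qed
  have "primeideal (?h ` Q i) (?R Quot A)" for i
    by (rule primeideal_image_quotient[OF cring_mpoly_ring A prime AQ])
  moreover have "?h ` Q i \<subset> ?h ` Q (Suc i)" if i: "i < card F" for i
  proof (rule psubsetI)
    show "?h ` Q i \<subseteq> ?h ` Q (Suc i)" using strict[OF i] by blast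
    obtain r where r: "r \<in> Q (Suc i)" "r \<notin> Q i" using strict[OF i] by blast
    have "?h r \<notin> ?h ` Q i"
    proof
      assume "?h r \<in> ?h ` Q i"
      then obtain q where q: "q \<in> Q i" "?h r = ?h q" by blast
      have carr: "r \<in> carrier ?R" "q \<in> carrier ?R"
        using r(1) q(1) nonfaces_polys by (auto simp: Q_def)
      have "r \<ominus>\<^bsub>?R\<^esub> q \<in> A"
        using A.quotient_eq_iff_same_a_r_cos[OF A carr] q(2) by simp
      then have "r - q \<in> A" using carr by (simp add: a_minus_def a_inv_mpoly_ring)
      then have "(r - q) + q \<in> Q i" using AQ q(1) mspan_add unfolding Q_def by blast
      then show False using r(2) by simp
    qed
    then show "?h ` Q i \<noteq> ?h ` Q (Suc i)" using r(1) by blast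
  qed
  ultimately have "\<exists>P. (\<forall>i\<le>card F. primeideal (P i) (?R Quot A)) \<and> (\<forall>i<card F. P i \<subset> P (Suc i))"
    by (intro exI[of _ "\<lambda>i. ?h ` Q i"]) blast
  then show ?thesis
    unfolding krull_dim_def by (intro Sup_upper) blast
qed

section \<open>Cohen-Macaulayness of a single layer\<close>

lemma mem_irrelevant_ideal:
  assumes "p \<in> polys V" "lookup p 0 = 0"
  shows "(p :: ('v, 'k::field) mpoly) \<in> irrelevant_ideal V"
proof -
  let ?R = "mpoly_ring V :: ('v, 'k) mpoly ring"
  interpret cring ?R by (rule cring_mpoly_ring)
  have varV: "var ` V \<subseteq> carrier ?R" by (auto simp: var_def mspan_def split: if_splits)
  have "ideal (irrelevant_ideal V) ?R" unfolding irrelevant_ideal_def by (rule genideal_ideal[OF varV])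
  then have st: "stable (polys V) (irrelevant_ideal V :: ('v, 'k) mpoly set)"
    using ideal_mpoly_ring_iff by blast
  note I = stableD[OF st]
  have "mspan {m :: 'v \<Rightarrow>\<^sub>0 nat. keys m \<subseteq> V \<and> m \<noteq> 0} \<subseteq> (irrelevant_ideal V :: ('v, 'k) mpoly set)"
  proof (rule mspan_subsetI)
    fix m :: "'v \<Rightarrow>\<^sub>0 nat" and c :: 'k assume m: "m \<in> {m. keys m \<subseteq> V \<and> m \<noteq> 0}"
    then obtain x where x: "x \<in> keys m" by (metis (mono_tags) all_not_in_conv keys_eq_empty mem_Collect_eq)
    then obtain m' :: "'v \<Rightarrow>\<^sub>0 nat" where m': "m = sqfree {x} + m'" using sqfree_factor[of "{x}" m] by auto
    have "var x \<in> (irrelevant_ideal V :: ('v, 'k) mpoly set)"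
      unfolding irrelevant_ideal_def using genideal_self[OF varV] x m by auto
    moreover have "single m' c \<in> polys V" using m m' by (intro single_mspan) (auto simp: keys_add_nat)
    ultimately have "single m' c * var x \<in> (irrelevant_ideal V :: ('v, 'k) mpoly set)" by (intro I(5))
    then show "single m c \<in> (irrelevant_ideal V :: ('v, 'k) mpoly set)"
      by (simp add: var_def mult_single m' sqfree_def add.commute)
  qed (use I in auto)
  moreover have "p \<in> mspan {m. keys m \<subseteq> V \<and> m \<noteq> 0}"
    using assms by (auto simp: mspan_def in_keys_iff)
  ultimately show ?thesis by blast
qed

text \<open>The dimension comes from squeezing the annihilator between the Stanley-Reisner ideal of
  the facets of cardinality \<open>d\<close> and the prime ideal of one such facet. The depth is
  realised by \<open>esyms V d\<close>, and the same facets bound the length of every regular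
  sequence.\<close>

lemma layer_cohen_macaulay:
  fixes M :: "(('v, 'k::field) mpoly, 'm) module"
  assumes V: "finite V" and \<F>: "\<And>F. F \<in> \<F> \<Longrightarrow> F \<subseteq> V"
    and anti: "\<And>F F'. F \<in> \<F> \<Longrightarrow> F' \<in> \<F> \<Longrightarrow> F \<subseteq> F' \<Longrightarrow> F = F'"
    and sh: "shelling \<F> r R" and lay: "\<forall>d. \<exists>a. \<forall>F\<in>\<F>. r F < a \<longleftrightarrow> d < card F"
    and F: "F \<in> \<F>" "card F = d"
    and pr: "presents V (sr_ideal V {F \<in> \<F>. d < card F}) (sr_ideal V {F \<in> \<F>. d \<le> card F}) \<pi> M"
  shows "cohen_macaulay (mpoly_ring V) (irrelevant_ideal V) M" "module_dim (mpoly_ring V) M = enat d"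
proof -
  let ?G = "{F \<in> \<F>. d < card F}" and ?H = "{F \<in> \<F>. d \<le> card F}" and ?C = "{F \<in> \<F>. card F = d}"
  let ?L = "sr_ideal V ?G :: ('v, 'k) mpoly set" and ?K = "sr_ideal V ?H :: ('v, 'k) mpoly set"
  note D = presentsD[OF pr]
  have "\<F> \<subseteq> Pow V" using \<F> by blast
  then have fin\<F>: "finite \<F>" using V by (meson finite_Pow_iff finite_subset)
  then have finC: "finite ?C" by simp
  have C: "finite F \<and> card F \<le> d" if "F \<in> ?C" for F using that \<F>[of F] V finite_subset by auto
  have finF: "finite F" using \<F>[OF F(1)] V finite_subset by blast
  \<comment> \<open>A facet with at least \<open>d\<close> vertices has exactly \<open>d\<close> or
    more; the two factors exclude one case each.\<close>
  have J: "a * p \<in> ?K" if a: "a \<in> sr_ideal V ?C" and p: "p \<in> ?L" for a p :: "('v, 'k) mpoly"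
    using a p
  proof (rule mspan_mult)
    fix x y :: "'v \<Rightarrow>\<^sub>0 nat" assume "x \<in> nonfaces V ?C" "y \<in> nonfaces V ?G"
    then show "x + y \<in> nonfaces V ?H"
      by (auto simp: nonfaces_def keys_add_nat le_less)
  qed
  \<comment> \<open>The monomial of \<open>F\<close> is nonzero in the layer, since by the antichain
    property \<open>F\<close> lies in no larger facet. It witnesses properness of the sequence, and
    whatever annihilates it lies in the prime ideal of \<open>F\<close>.\<close>
  have facet: "sqfree F \<in> nonfaces V ?G"
    using anti[OF F(1)] F \<F>[OF F(1)] by (force simp: nonfaces_def keys_sqfree[OF finF])
  have facet': "sqfree F \<notin> nonfaces V ?H"
    using F by (auto simp: nonfaces_def keys_sqfree[OF finF])
  let ?A = "annihilator (mpoly_ring V) M"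
  have A: "?A = {a \<in> polys V. \<forall>p\<in>?L. a * p \<in> ?K}" by (rule presents_annihilator[OF pr])
  have idA: "ideal ?A (mpoly_ring V)"
    unfolding ideal_mpoly_ring_iff A using stable_colon[OF D(1,2)] by auto
  have JA: "sr_ideal V ?C \<subseteq> ?A"
    unfolding A using J nonfaces_polys by blast
  have AP: "?A \<subseteq> sr_ideal V {F}"
  proof
    fix a assume a: "a \<in> ?A"
    then have aV: "a \<in> polys V" and aK: "single (sqfree F) 1 * a \<in> ?K"
      using single_mspan[OF facet, of 1] by (auto simp: A mult.commute)
    show "a \<in> sr_ideal V {F}"
      unfolding mspan_def
    proof clarify
      fix m assume m: "m \<in> keys a"
      then have "sqfree F + m \<in> keys (single (sqfree F) 1 * a)"
        using lookup_mult_single[of "sqfree F" a m] by (simp add: in_keys_iff)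
      then have "sqfree F + m \<in> nonfaces V ?H" using aK by (auto simp: mspan_def)
      then show "m \<in> nonfaces V {F}"
        using F by (auto simp: nonfaces_def keys_add_nat keys_sqfree[OF finF])
    qed
  qed
  have dim: "module_dim (mpoly_ring V) M = enat d"
    unfolding module_dim_def
    using krull_dim_quotient_le[OF idA JA finC C] krull_dim_quotient_ge[OF idA AP \<F>[OF F(1)] finF] F(2)
    by (intro antisym) auto
  have es: "f \<in> polys V \<and> lookup f 0 = 0" if f: "f \<in> set (esyms V d)" for f :: "('v, 'k) mpoly"
  proof -
    obtain i where "f = esym V i" "0 < i" using f by (auto simp: esyms_def)
    then show ?thesis by (simp add: esym_polys[OF V] esym_lookup_zero[OF V])
  qed
  have "regular_sequence (mpoly_ring V) M (esyms V d)"
    unfolding presents_regular_sequence[OF pr]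
    using es wregular_nth[OF esyms_wregular_layer[OF V \<F> sh lay, of d]]
      foldl_ext_by_proper[OF V es _ facet facet'] by (auto simp: subset_iff)
  moreover have "set (esyms V d) \<subseteq> (irrelevant_ideal V :: ('v, 'k) mpoly set)"
    by (intro subsetI mem_irrelevant_ideal) (use es in auto)
  moreover have "length (esyms V d :: ('v, 'k) mpoly list) = d" by (simp add: esyms_def)
  ultimately have "enat d \<le> module_depth (mpoly_ring V) (irrelevant_ideal V) M"
    unfolding module_depth_def by (intro Sup_upper CollectI exI[of _ "esyms V d"]) simp
  moreover have "module_depth (mpoly_ring V) (irrelevant_ideal V) M \<le> enat d"
    unfolding module_depth_def using regular_sequence_length_le[OF pr _ finC C J]
    by (intro Sup_least) auto
  ultimately show "cohen_macaulay (mpoly_ring V) (irrelevant_ideal V) M"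
    unfolding cohen_macaulay_def dim by (rule antisym[rotated])
  show "module_dim (mpoly_ring V) M = enat d" by (rule dim)
qed

section \<open>Edge ideals and the dimension filtration\<close>

text \<open>The support of a monomial is dependent iff it contains an edge, that is, iff the
  monomial is divisible by a generator.\<close>

lemma edge_ideal_eq:
  assumes G: "finite_simple_graph H"
  shows "edge_ideal H = (sr_ideal (vertices H) (Ind H) :: ('v, 'k::field) mpoly set)"
proof
  let ?V = "vertices H"
  let ?R = "mpoly_ring ?V :: ('v, 'k) mpoly ring"
  let ?I = "edge_ideal H :: ('v, 'k) mpoly set"
  let ?X = "{var x * var y | x y. {x, y} \<in> edges H} :: ('v, 'k) mpoly set"
  interpret cring ?R by (rule cring_mpoly_ring)
  have edge: "var x * var y = (single (sqfree {x, y}) 1 :: ('v, 'k) mpoly)" "x \<in> ?V" "y \<in> ?V"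
    if "{x, y} \<in> edges H" for x y
  proof -
    have "x \<noteq> y" "{x, y} \<subseteq> ?V" using G that by (force simp: finite_simple_graph_def)+
    then show "var x * var y = (single (sqfree {x, y}) 1 :: ('v, 'k) mpoly)" "x \<in> ?V" "y \<in> ?V"
      by (simp_all add: var_def mult_single sqfree_def)
  qed
  have nf: "m \<in> nonfaces ?V (Ind H) \<longleftrightarrow> keys m \<subseteq> ?V \<and> (\<exists>e\<in>edges H. e \<subseteq> keys m)" for m :: "'v \<Rightarrow>\<^sub>0 nat"
    unfolding nonfaces_def Ind_def by blast
  have X: "?X \<subseteq> sr_ideal ?V (Ind H)"
  proof
    fix p assume "p \<in> ?X"
    then obtain x y where xy: "p = var x * var y" "{x, y} \<in> edges H" by blast
    then have "sqfree {x, y} \<in> nonfaces ?V (Ind H)"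
      unfolding nf using edge(2,3)[OF xy(2)] by (auto simp: keys_sqfree intro: bexI[of _ "{x, y}"])
    then show "p \<in> sr_ideal ?V (Ind H)"
      unfolding xy(1) edge(1)[OF xy(2)] by (rule single_mspan)
  qed
  have "ideal (sr_ideal ?V (Ind H)) ?R"
    by (simp add: ideal_mpoly_ring_iff stable_nonfaces nonfaces_polys)
  then show "edge_ideal H \<subseteq> (sr_ideal ?V (Ind H) :: ('v, 'k) mpoly set)"
    unfolding edge_ideal_def using X by (rule genideal_minimal)
  have XV: "?X \<subseteq> carrier ?R" using X nonfaces_polys by fastforce
  have "ideal (edge_ideal H) ?R" unfolding edge_ideal_def by (rule genideal_ideal[OF XV])
  then have st: "stable (polys ?V) ?I"
    using ideal_mpoly_ring_iff by blast
  note I = stableD[OF st]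
  show "sr_ideal ?V (Ind H) \<subseteq> ?I"
  proof (rule mspan_subsetI)
    fix m :: "'v \<Rightarrow>\<^sub>0 nat" and c :: 'k assume m: "m \<in> nonfaces ?V (Ind H)"
    then obtain e where e: "e \<in> edges H" "e \<subseteq> keys m" using nf by blast
    then obtain x y where xy: "e = {x, y}" using G by (metis card_2_iff finite_simple_graph_def)
    obtain m' :: "'v \<Rightarrow>\<^sub>0 nat" where m': "m = sqfree {x, y} + m'" using sqfree_factor e xy by blast
    have "var x * var y \<in> ?I"
      unfolding edge_ideal_def using genideal_self[OF XV] e xy by blast
    moreover have "single m' c \<in> polys ?V"
      using m m' by (intro single_mspan) (auto simp: nonfaces_def keys_add_nat)
    ultimately have "single m' c * (var x * var y) \<in> ?I" using I(5) by blast
    then show "single m c \<in> ?I"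
      using edge(1)[of x y] e xy by (simp add: mult_single m' add.commute)
  qed (use I in auto)
qed

lemma nonfaces_facets:
  assumes "simplicial_complex \<Delta>"
  shows "nonfaces V \<Delta> = nonfaces V (facets \<Delta>)"
proof -
  have "(\<exists>F\<in>\<Delta>. U \<subseteq> F) \<longleftrightarrow> (\<exists>F\<in>facets \<Delta>. U \<subseteq> F)" for U
    using ex_facet_superset[OF finite_simplicial_complex[OF assms]] facets_subset by (meson order_trans subsetD)
  then show ?thesis by (simp add: nonfaces_def)
qed

section \<open>Homogeneous components and the filtration\<close>

lemma presents_finsum:
  fixes n :: nat
  assumes pr: "presents V L K \<pi> M" and g: "\<And>d. d \<le> n \<Longrightarrow> g d \<in> L"
  shows "finsum M (\<lambda>d. \<pi> (g d)) {..n} = \<pi> (\<Sum>d\<le>n. g d)"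
proof -
  note D = presentsD[OF pr] note L = stableD[OF D(1)]
  interpret abelian_group M by (rule presents_abelian_group[OF pr])
  show ?thesis
    using g
  proof (induction n)
    case 0
    then show ?case using D(4) by (simp add: finsum_0)
  next
    case (Suc n)
    have gL: "g d \<in> L" if "d \<le> Suc n" for d using Suc.prems that .
    have sL: "(\<Sum>d\<le>k. g d) \<in> L" if "k \<le> n" for k
      using that by (induction k) (auto intro!: L(3) gL)
    have "(\<lambda>d. \<pi> (g d)) \<in> {..Suc n} \<rightarrow> carrier M" using gL D(4) by auto
    then have "finsum M (\<lambda>d. \<pi> (g d)) {..Suc n} = \<pi> (g (Suc n)) \<oplus>\<^bsub>M\<^esub> finsum M (\<lambda>d. \<pi> (g d)) {..n}"
      by (rule finsum_Suc)
    also have "\<dots> = \<pi> (g (Suc n) + (\<Sum>d\<le>n. g d))"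
      using Suc.IH gL D(5)[OF gL[of "Suc n"] sL[of n]] by simp
    finally show ?case by (simp add: add.commute)
  qed
qed

definition degree_part :: "nat \<Rightarrow> ('v, 'k::field) mpoly \<Rightarrow> ('v, 'k) mpoly" where
  "degree_part d p = (\<Sum>m\<in>{m \<in> keys p. mon_degree m = d}. single m (lookup p m))"

lemma keys_degree_part: "m \<in> keys (degree_part d p) \<Longrightarrow> m \<in> keys p \<and> mon_degree m = d"
proof -
  assume "m \<in> keys (degree_part d p)"
  then have "m \<in> (\<Union>x\<in>{m \<in> keys p. mon_degree m = d}. keys (single x (lookup p x)))"
    unfolding degree_part_def by (rule subsetD[OF keys_sum])
  then show ?thesis by (auto split: if_splits)
qed

lemma sum_degree_part:
  assumes "\<And>m. m \<in> keys p \<Longrightarrow> mon_degree m \<le> n"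
  shows "(\<Sum>d\<le>n. degree_part d p) = p"
proof -
  have "(\<Sum>d\<le>n. degree_part d p) = (\<Sum>m\<in>keys p. single m (lookup p m))"
    unfolding degree_part_def using assms by (intro sum.group) auto
  then show ?thesis by (simp add: poly_mapping_sum_single)
qed

text \<open>The filtration is indexed by the cardinalities that occur among the facets; an absent
  one would repeat an ideal and break strictness.\<close>

lemma shellable_sequentially_cohen_macaulay:
  fixes H :: "'v ugraph"
  assumes G: "finite_simple_graph H" and sh: "\<exists>r R. shelling (facets (Ind H)) r R"
  shows "sequentially_cohen_macaulay_graph TYPE('k::field) H"
proof -
  define V where "V = vertices H"
  define \<F> where "\<F> = facets (Ind H)"
  have finV: "finite V" using G by (simp add: V_def finite_simple_graph_def)
  have sc: "simplicial_complex (Ind H)"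
    using simplicial_complex_indep[OF finV, of "edges H"] by (simp add: V_def Ind_def)
  have \<F>V: "F \<subseteq> V" if "F \<in> \<F>" for F
    using that facets_subset by (fastforce simp: \<F>_def Ind_def V_def)
  have fin\<F>: "finite \<F>" using \<F>V finV by (meson PowI finite_Pow_iff finite_subset subsetI)
  have anti: "F = F'" if "F \<in> \<F>" "F' \<in> \<F>" "F \<subseteq> F'" for F F'
    using that facets_antichain by (metis \<F>_def)
  have "{} \<in> Ind H" using G by (auto simp: Ind_def finite_simple_graph_def)
  then have ne: "\<F> \<noteq> {}"
    using ex_facet_superset[OF finite_simplicial_complex[OF sc]] by (auto simp: \<F>_def)
  obtain r0 R where sh0: "shelling \<F> r0 R" using sh by (auto simp: \<F>_def)
  have "\<exists>r. shelling \<F> r R \<and> (\<forall>d. \<exists>a. \<forall>F\<in>\<F>. r F < a \<longleftrightarrow> d < card F)"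
  proof (rule shelling_rearrange[OF sh0 fin\<F>])
    show "F = F'" if "F \<in> \<F>" "F' \<in> \<F>" "F \<subseteq> F'" for F F' by (rule anti[OF that])
    show "finite F" if "F \<in> \<F>" for F by (rule finite_subset[OF \<F>V[OF that] finV])
  qed
  then obtain r where sh: "shelling \<F> r R" and lay: "\<forall>d. \<exists>a. \<forall>F\<in>\<F>. r F < a \<longleftrightarrow> d < card F"
    by blast
  define s where "s = sorted_list_of_set (card ` \<F>)"
  define t where "t = length s"
  have set_s: "set s = card ` \<F>" and s_sorted: "sorted_wrt (<) s"
    using fin\<F> by (simp_all add: s_def strict_sorted_list_of_set)
  have t0: "0 < t" using set_s ne by (auto simp: t_def)
  have s_less: "s ! i < s ! j" if "i < j" "j < t" for i j
    using sorted_wrt_nth_less[OF s_sorted that(1)] that(2) by (simp add: t_def)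
  have s_iff: "s ! i < s ! j \<longleftrightarrow> i < j" if "i < t" "j < t" for i j
    using s_less[of i j] s_less[of j i] that by (cases i j rule: linorder_cases) auto
  have facet_s: "\<exists>F\<in>\<F>. card F = s ! i" if "i < t" for i
    using that set_s nth_mem[of i s] by (auto simp: t_def)
  have s_facet: "\<exists>j<t. card F = s ! j" if "F \<in> \<F>" for F
    using that set_s by (metis imageI in_set_conv_nth t_def)
  define \<G> where "\<G> i = (if i = 0 then \<F> else {F \<in> \<F>. s ! (i - 1) < card F})" for i
  define I where "I i = (sr_ideal V (\<G> i) :: ('v, 'k) mpoly set)" for i
  \<comment> \<open>No facet has cardinality strictly between consecutive entries of
    \<open>s\<close>, so exceeding the previous entry is the same as reaching the current one; at
    \<open>i = 0\<close> every facet qualifies.\<close>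
  have lower: "\<G> i = {F \<in> \<F>. s ! i \<le> card F}" if i: "i < t" for i
  proof -
    have "(i = 0 \<or> s ! (i - 1) < card F) \<longleftrightarrow> s ! i \<le> card F" if F: "F \<in> \<F>" for F
    proof -
      obtain j where j: "j < t" "card F = s ! j" using s_facet[OF F] by blast
      have "s ! i \<le> s ! j \<longleftrightarrow> i \<le> j" using s_iff[OF j(1) i] by linarith
      moreover have "s ! (i - 1) < s ! j \<longleftrightarrow> i - 1 < j" using i j(1) by (intro s_iff) auto
      ultimately show ?thesis using j(2) by (cases i) auto
    qed
    then show ?thesis by (auto simp: \<G>_def)
  qed
  have upper: "\<G> (Suc i) = {F \<in> \<F>. s ! i < card F}" for i by (simp add: \<G>_def)
  have Gt: "\<G> t = {}"
  proof -
    have "\<not> s ! (t - 1) < card F" if F: "F \<in> \<F>" for F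
    proof -
      obtain j where j: "j < t" "card F = s ! j" using s_facet[OF F] by blast
      then show ?thesis using s_iff[of "t - 1" j] by simp
    qed
    then show ?thesis using t0 by (auto simp: \<G>_def)
  qed
  have mono: "I i \<subseteq> I (Suc i)" if "i < t" for i
    unfolding I_def lower[OF that] upper by (intro mspan_mono nonfaces_antimono) auto
  have I_mono: "I i \<subseteq> I j" if "i \<le> j" "j \<le> t" for i j
    using that
  proof (induction j rule: dec_induct)
    case (step n)
    then show ?case using mono[of n] by auto
  qed simp
  have stI: "stable (polys V) (I i)" for i unfolding I_def by (rule stable_nonfaces) simp
  have It: "I t = polys V" by (simp add: I_def Gt nonfaces_empty)
  have I0: "edge_ideal H = I 0"
    unfolding edge_ideal_eq[OF G] nonfaces_facets[OF sc] by (simp add: I_def \<G>_def \<F>_def V_def)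
  let ?R = "mpoly_ring V :: ('v, 'k) mpoly ring"
  let ?M = "edge_module H :: (('v, 'k) mpoly, ('v, 'k) mpoly set) module"
  define \<pi> where "\<pi> p = I 0 +>\<^bsub>?R\<^esub> p" for p
  have pr: "presents V (polys V) (I 0) \<pi> ?M"
  proof -
    have "presents V (polys V) (I 0) (\<lambda>p. (\<lambda>p. p) ` I 0 +>\<^bsub>self_module ?R\<^esub> p) (quot_module (self_module ?R) ((\<lambda>p. p) ` I 0))"
    proof (rule presents_quot_module[OF presents_self_module])
      show "{0} \<subseteq> I 0" "I 0 \<subseteq> polys V" using stableD(1)[OF stI] I_mono[of 0 t] It by auto
    qed (rule stI)
    moreover have "(\<lambda>p. p) ` I 0 +>\<^bsub>self_module ?R\<^esub> p = \<pi> p" for p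
      by (simp add: \<pi>_def a_r_coset_def' self_module_def)
    ultimately show ?thesis by (simp add: edge_module_def I0 V_def)
  qed
  note D = presentsD[OF pr]
  define N where "N i = \<pi> ` I i" for i
  have IV: "I i \<subseteq> polys V" if "i \<le> t" for i using I_mono[OF that] It by auto
  let ?Q = "\<lambda>i. subquotient ?M (N (Suc i)) (N i)"
  have layer: "cohen_macaulay ?R (irrelevant_ideal V) (?Q i)"
      "module_dim ?R (?Q i) = enat (s ! i)" if i: "i < t" for i
  proof -
    have prI: "presents V (I (Suc i)) (I 0) \<pi> (?M\<lparr>carrier := \<pi> ` I (Suc i)\<rparr>)"
      using I_mono[of 0 "Suc i"] IV[of "Suc i"] i stI by (intro presents_carrier_update[OF pr]) auto
    have "presents V (I (Suc i)) (I i) (\<lambda>p. \<pi> ` I i +>\<^bsub>?M\<lparr>carrier := \<pi> ` I (Suc i)\<rparr>\<^esub> \<pi> p) (?Q i)"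
      unfolding subquotient_def N_def
      using I_mono[of 0 i] mono[OF i] i stI by (intro presents_quot_module[OF prI]) auto
    then have prS: "presents V (sr_ideal V {F \<in> \<F>. s ! i < card F}) (sr_ideal V {F \<in> \<F>. s ! i \<le> card F})
        (\<lambda>p. \<pi> ` I i +>\<^bsub>?M\<lparr>carrier := \<pi> ` I (Suc i)\<rparr>\<^esub> \<pi> p) (?Q i)"
      by (simp add: I_def lower[OF i] upper)
    obtain F where F: "F \<in> \<F>" "card F = s ! i" using facet_s[OF i] by blast
    note lcm = layer_cohen_macaulay[OF finV _ _ sh lay F prS]
    show "cohen_macaulay ?R (irrelevant_ideal V) (?Q i)"
      by (rule lcm(1)) (use \<F>V anti in blast)+
    show "module_dim ?R (?Q i) = enat (s ! i)"
      by (rule lcm(2)) (use \<F>V anti in blast)+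
  qed
  have graded: "graded_submodule ?R ?M (edge_module_part H) (N i)" if i: "i \<le> t" for i
    unfolding graded_submodule_def
  proof (intro conjI ballI)
    show "submodule (N i) ?R ?M" unfolding N_def by (rule presents_submodule[OF pr IV[OF i] stI])
    fix x assume "x \<in> N i"
    then obtain p where p: "p \<in> I i" "x = \<pi> p" by (auto simp: N_def)
    \<comment> \<open>Inserting \<open>0\<close> makes the maximum meaningful for
      \<open>p = 0\<close>.\<close>
    define n where "n = Max (insert 0 (mon_degree ` keys p))"
    have n: "mon_degree m \<le> n" if "m \<in> keys p" for m using that by (simp add: n_def)
    have dI: "degree_part d p \<in> I i" for d
      using p(1) keys_degree_part[of _ d p] by (fastforce simp: I_def mspan_def)
    have dV: "degree_part d p \<in> polys V" for d using dI IV[OF i] by blast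
    have "x = finsum ?M (\<lambda>d. \<pi> (degree_part d p)) {..n}"
      using presents_finsum[OF pr, of n "\<lambda>d. degree_part d p"] dV sum_degree_part[of p n] n p(2) by simp
    moreover have "\<pi> (degree_part d p) \<in> N i \<inter> edge_module_part H d" for d
    proof -
      have "degree_part d p \<in> homogeneous_part V d"
        using dV keys_degree_part by (auto simp: homogeneous_part_def)
      then show ?thesis
        using dI by (auto simp: N_def edge_module_part_def \<pi>_def I0 V_def)
    qed
    ultimately show "\<exists>n f. (\<forall>d\<le>n. f d \<in> N i \<inter> edge_module_part H d) \<and> x = finsum ?M f {..n}"
      by (intro exI[of _ n] exI[of _ "\<lambda>d. \<pi> (degree_part d p)"]) auto
  qed
  have strict: "N i \<subset> N (Suc i)" if i: "i < t" for i
  proof (rule psubsetI)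
    show "N i \<subseteq> N (Suc i)" unfolding N_def using mono[OF i] by blast
    obtain F where F: "F \<in> \<F>" "card F = s ! i" using facet_s[OF i] by blast
    have finF: "finite F" using \<F>V[OF F(1)] finV finite_subset by blast
    \<comment> \<open>The monomial of a facet of cardinality \<open>s ! i\<close> separates the two
      ideals; its class separates the submodules because \<open>I 0\<close> is contained in
      \<open>I i\<close>.\<close>
    let ?p = "single (sqfree F) (1::'k)"
    have "?p \<in> I (Suc i)"
      unfolding I_def upper using anti[OF F(1)] F \<F>V[OF F(1)]
      by (intro single_mspan) (force simp: nonfaces_def keys_sqfree[OF finF])
    moreover have "?p \<notin> I i"
    proof -
      have "\<exists>F'\<in>{F \<in> \<F>. s ! i \<le> card F}. keys (sqfree F) \<subseteq> F'"
        using F by (intro bexI[of _ F]) (simp_all add: keys_sqfree[OF finF])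
      then have "sqfree F \<notin> nonfaces V {F \<in> \<F>. s ! i \<le> card F}" unfolding nonfaces_def by blast
      then show ?thesis unfolding I_def lower[OF i] by (simp add: mspan_def)
    qed
    moreover have "?p \<in> I i" if p: "\<pi> ?p \<in> N i" "?p \<in> polys V"
    proof -
      obtain q where q: "q \<in> I i" "\<pi> ?p = \<pi> q" using p(1) by (auto simp: N_def)
      then have "?p - q \<in> I 0" using D(8)[OF p(2), of q] IV[of i] i by auto
      then have "?p - q \<in> I i" using I_mono[of 0 i] i by auto
      from stableD(3)[OF stI this q(1)] show ?thesis by simp
    qed
    ultimately have "\<pi> ?p \<in> N (Suc i) - N i" using IV[of "Suc i"] i by (auto simp: N_def)
    then show "N i \<noteq> N (Suc i)" by blast
  qed
  have "N 0 = {\<zero>\<^bsub>?M\<^esub>}"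
  proof -
    have "\<pi> p = \<zero>\<^bsub>?M\<^esub>" if "p \<in> I 0" for p
      using presents_zero_iff[OF pr] that IV[of 0] by auto
    then show ?thesis using stableD(1)[OF stI, of 0] by (auto simp: N_def)
  qed
  moreover have "N t = carrier ?M" by (simp add: N_def It D(4))
  moreover have "N (i - 1) \<subset> N i" "cohen_macaulay ?R (irrelevant_ideal V) (subquotient ?M (N i) (N (i - 1)))"
    if i: "i \<in> {1..t}" for i
  proof -
    obtain j where "i = Suc j" "j < t" using i by (cases i) auto
    then show "N (i - 1) \<subset> N i" "cohen_macaulay ?R (irrelevant_ideal V) (subquotient ?M (N i) (N (i - 1)))"
      using strict[of j] layer(1)[of j] by simp_all
  qed
  moreover have "module_dim ?R (subquotient ?M (N i) (N (i - 1))) < module_dim ?R (subquotient ?M (N (i + 1)) (N i))"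
    if "i \<in> {1..<t}" for i
    using layer(2)[of "i - 1"] layer(2)[of i] s_less[of "i - 1" i] that by auto
  ultimately show ?thesis
    unfolding sequentially_cohen_macaulay_graph_def sequentially_cohen_macaulay_def V_def[symmetric]
    using graded by (intro exI[of _ t] exI[of _ N]) auto
qed

theorem corollary4p8:
  fixes G :: "'a ugraph" and S :: "'a set"
  assumes "finite_simple_graph G"
    and "S \<subseteq> vertices G"
    and "chordal (induced_subgraph G (vertices G - S)) \<or>
         graph_iso (induced_subgraph G (vertices G - S)) (cycle_graph 5)"
  shows "vertex_decomposable (Ind (whisker G S)) \<and>
         sequentially_cohen_macaulay_graph TYPE('k::field) (whisker G S)"
proof
  show vd: "vertex_decomposable (Ind (whisker G S))"
    by (rule vertex_decomposable_whisker[OF assms])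
  show "sequentially_cohen_macaulay_graph TYPE('k::field) (whisker G S)"
    by (rule shellable_sequentially_cohen_macaulay[OF finite_simple_graph_whisker[OF assms(1,2)]
        vertex_decomposable_imp_shelling[OF vd]])
qed

end
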